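(* Let $n,n'\ge1$ be coprime integers, $N\ge1$, and let $q,v,u_0,\dots,u_{n-1}\in\mathbb{C}^*$. The representation $\mathbf{C}^{(n,n')}_{u_0,\dots,u_{n-1}}$ of the double affine Hecke algebra $\mathcal{H}_N$ is isomorphic to the twisted Cherednik representation $\mathbf{C}_u^{\sigma}$ with $u=u_0\cdots u_{n-1}q^{1-n}$.
   Context: $\mathcal{H}_N$ is the algebra with generators $T_1,\dots,T_{N-1},\pi^{\pm1},Y_1^{\pm1},\dots,Y_N^{\pm1}$ and relations: $(T_i-v)(T_i+v^{-1})=0$; $T_iT_{i+1}T_i=T_{i+1}T_iT_{i+1}$; $T_iT_j=T_jT_i$ for $|i-j|>1$; $T_iY_iT_i=Y_{i+1}$; $T_iY_j=Y_jT_i$ for $j\ne i,i+1$; $Y_iY_j=Y_jY_i$; $\pi Y_i\pi^{-1}=q^{\delta_{i,N}}Y_{i+1}$ with $Y_{N+1}:=Y_1$; $\pi T_i\pi^{-1}=T_{i+1}$ ($1\le i\le N-2$); $\pi^NT_i=T_i\pi^N$. Put $X_i=T_i\cdots T_{N-1}\pi^{-1}T_1^{-1}\cdots T_{i-1}^{-1}$. **Cherednik representation** $\mathbf{C}_u$: induced from the one-dimensional representation $T_i\mapsto v$, $\pi\mapsto u$ of the subalgebra generated by $T_1,\dots,T_{N-1},\pi^{\pm1}$; as a space it is $\mathbb{C}[Y_1^{\pm1},\dots,Y_N^{\pm1}]$. **Representation** $\mathbf{C}^{(n,n')}_{u_0,\dots,u_{n-1}}$: the space $(\mathbb{C}^n[Y^{\pm1}])^{\otimes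 N}=(\mathbb{C}^n)^{\otimes N}[Y_1^{\pm1},\dots,Y_N^{\pm1}]$, with $Y_i$ acting by multiplication, $T_i=s_i^YR_{i,i+1}+(v-v^{-1})\frac{s_i^Y-1}{Y_i/Y_{i+1}-1}$, $\pi=\kappa_1^{n'}D_1s_1\cdots s_{N-1}$. Here $\mathbb{C}^n$ has basis $e_0,\dots,e_{n-1}$, $e_{nj+a}=Y^je_a$; $R=v\sum_aE_{aa}\otimes E_{aa}+\sum_{a<b}(E_{ab}\otimes E_{ba}+E_{ba}\otimes E_{ab}+(v-v^{-1})E_{aa}\otimes E_{bb})$; $s_i^Y$ swaps only the variables $Y_i,Y_{i+1}$; $s_i$ swaps the tensor factors $i,i+1$ of $(\mathbb{C}^n[Y^{\pm1}])^{\otimes N}$; $\kappa e_i=e_{i-1}$, $D(Y^je_a)=u_aq^jY^je_a$ for $0\le a<n$; subscript $1$ means acting on the first factor. **The twist.** $\widetilde{SL}(2,\mathbb{Z})$ (braid group on 3 strands, generators $\tau_\pm$, mapping to $SL(2,\mathbb{Z})$ by $\tau_+\mapsto\begin{pmatrix}1&1\\0&1\end{pmatrix}$, $\tau_-\mapsto\begin{pmatrix}1&0\\1&1\end{pmatrix}$) acts on $\mathcal{H}_N$ by automorphisms fixing all $T_i$, with $\tau_+$: $X_i\mapsto X_i$, $Y_i\mapsto Y_iX_iT_{i-1}\cdots T_1T_1\cdots T_{i-1}$, and $\tau_-$: $Y_i\mapsto Y_i$, $X_i\mapsto X_iY_iT_{i-1}^{-1}\cdots T_1^{-1}T_1^{-1}\cdots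 T_{i-1}^{-1}$. Let $m,m'$ be the integers with $nm'-n'm=1$, $0\le m<n$. There is $\sigma\in\widetilde{SL}(2,\mathbb{Z})$ (a product of $\tau_+^{-1}$'s and $\tau_-^{-1}$'s lifting $\begin{pmatrix}n&-m\\-n'&m'\end{pmatrix}$) whose action is given by $T_i\mapsto T_i$, $X_i^{-1}\mapsto\mathbf{B}_i$, $Y_i\mapsto\mathbf{A}_i$, where $\mathbf{B}_{i+1}=T_i\cdots T_1\mathbf{B}_1T_1\cdots T_i$, $\mathbf{A}_{i+1}=T_i\cdots T_1\mathbf{A}_1T_1\cdots T_i$, $\mathbf{B}_1=Z_1\cdots Z_{n+n'}$, $\mathbf{A}_1=W_1\cdots W_{m+m'}$, with $Z_j=Y_1$ if $\lfloor\frac{jn}{n+n'}\rfloor=\lfloor\frac{(j-1)n}{n+n'}\rfloor$ and $Z_j=X_1^{-1}$ otherwise, and $W_j=Y_1$ if $\lfloor\frac{jm}{m+m'}\rfloor=\lfloor\frac{(j-1)m}{m+m'}\rfloor$ and $W_j=X_1^{-1}$ otherwise. For an $\mathcal{H}_N$-module $M$ with action $\rho_M$, $M^\sigma$ is the same space with action $\rho_M\circ\sigma^{-1}$. *)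

theory Defs
  imports
    "HOL-Algebra.QuotRing"
    "HOL-Algebra.Module"
    "HOL-Algebra.Generated_Groups"
    "HOL-Algebra.Generated_Rings"
    "HOL-Analysis.Cartesian_Space"
    "HOL-Library.Poly_Mapping"
begin

section \<open>Left modules over a ring that need not be commutative\<close>

locale left_module = R?: ring R + M?: abelian_group M
  for R :: "('a, 'r) ring_scheme" (structure) and M :: "('a, 'b) module" (structure) +
  assumes smult_closed:
      "\<lbrakk>a \<in> carrier R; x \<in> carrier M\<rbrakk> \<Longrightarrow> a \<odot>\<^bsub>M\<^esub> x \<in> carrier M"
    and smult_l_distr:
      "\<lbrakk>a \<in> carrier R; b \<in> carrier R; x \<in> carrier M\<rbrakk> \<Longrightarrow>
        (a \<oplus>\<^bsub>R\<^esub> b) \<odot>\<^bsub>M\<^esub> x = a \<odot>\<^bsub>M\<^esub> x \<oplus>\<^bsub>M\<^esub> b \<odot>\<^bsub>M\<^esub> x"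
    and smult_r_distr:
      "\<lbrakk>a \<in> carrier R; x \<in> carrier M; y \<in> carrier M\<rbrakk> \<Longrightarrow>
        a \<odot>\<^bsub>M\<^esub> (x \<oplus>\<^bsub>M\<^esub> y) = a \<odot>\<^bsub>M\<^esub> x \<oplus>\<^bsub>M\<^esub> a \<odot>\<^bsub>M\<^esub> y"
    and smult_assoc1:
      "\<lbrakk>a \<in> carrier R; b \<in> carrier R; x \<in> carrier M\<rbrakk> \<Longrightarrow>
        (a \<otimes>\<^bsub>R\<^esub> b) \<odot>\<^bsub>M\<^esub> x = a \<odot>\<^bsub>M\<^esub> (b \<odot>\<^bsub>M\<^esub> x)"
    and smult_one:
      "x \<in> carrier M \<Longrightarrow> \<one>\<^bsub>R\<^esub> \<odot>\<^bsub>M\<^esub> x = x"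

definition isomorphic_modules ::
    "('a, 'r) ring_scheme \<Rightarrow> ('a, 'b) module \<Rightarrow> ('a, 'c) module \<Rightarrow> bool" where
  "isomorphic_modules R M M' \<longleftrightarrow>
    (\<exists>\<Phi>. bij_betw \<Phi> (carrier M) (carrier M') \<and>
      (\<forall>x \<in> carrier M. \<forall>y \<in> carrier M. \<Phi> (x \<oplus>\<^bsub>M\<^esub> y) = \<Phi> x \<oplus>\<^bsub>M'\<^esub> \<Phi> y) \<and>
      (\<forall>a \<in> carrier R. \<forall>x \<in> carrier M. \<Phi> (a \<odot>\<^bsub>M\<^esub> x) = a \<odot>\<^bsub>M'\<^esub> \<Phi> x))"


section \<open>The double affine Hecke algebra\<close>

text \<open>With concatenation as addition on words, the convolution product of
  \<open>'g list \<Rightarrow>\<^sub>0 complex\<close> is that of the free associative algebra.\<close>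

instantiation list :: (type) monoid_add
begin
definition zero_list :: "'a list" where "zero_list = []"
definition plus_list :: "'a list \<Rightarrow> 'a list \<Rightarrow> 'a list" where "plus_list xs ys = xs @ ys"
instance by standard (simp_all add: zero_list_def plus_list_def)
end

type_synonym 'g free_poly = "'g list \<Rightarrow>\<^sub>0 complex"

definition free_alg :: "'g set \<Rightarrow> 'g free_poly ring" where
  "free_alg A =
    \<lparr>carrier = {p. Poly_Mapping.keys p \<subseteq> lists A}, mult = (*), one = 1, zero = 0, add = (+)\<rparr>"

datatype gen = TG nat | PiG | PiInvG | YG nat | YInvG nat

definition gens :: "nat \<Rightarrow> gen set" where
  "gens N = TG ` {1..<N} \<union> {PiG, PiInvG} \<union> YG ` {1..N} \<union> YInvG ` {1..N}"

abbreviation gp :: "gen \<Rightarrow> gen free_poly" where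
  "gp g \<equiv> Poly_Mapping.single [g] 1"

abbreviation cp :: "complex \<Rightarrow> gen free_poly" where
  "cp c \<equiv> Poly_Mapping.single [] c"

text \<open>Each element \<open>l - r\<close> stands for the relation \<open>l = r\<close>.\<close>

definition daha_rels :: "nat \<Rightarrow> complex \<Rightarrow> complex \<Rightarrow> gen free_poly set" where
  "daha_rels N q v =
     {gp PiG * gp PiInvG - 1, gp PiInvG * gp PiG - 1}
   \<union> {gp (YG i) * gp (YInvG i) - 1 |i. i \<in> {1..N}}
   \<union> {gp (YInvG i) * gp (YG i) - 1 |i. i \<in> {1..N}}
   \<union> {(gp (TG i) - cp v) * (gp (TG i) + cp (inverse v)) |i. i \<in> {1..<N}}
   \<union> {gp (TG i) * gp (TG (i+1)) * gp (TG i) - gp (TG (i+1)) * gp (TG i) * gp (TG (i+1))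
        |i. i \<in> {1..<N} \<and> i + 1 \<in> {1..<N}}
   \<union> {gp (TG i) * gp (TG j) - gp (TG j) * gp (TG i)
        |i j. i \<in> {1..<N} \<and> j \<in> {1..<N} \<and> \<bar>int i - int j\<bar> > 1}
   \<union> {gp (TG i) * gp (YG i) * gp (TG i) - gp (YG (i+1)) |i. i \<in> {1..<N}}
   \<union> {gp (TG i) * gp (YG j) - gp (YG j) * gp (TG i)
        |i j. i \<in> {1..<N} \<and> j \<in> {1..N} \<and> j \<noteq> i \<and> j \<noteq> i + 1}
   \<union> {gp (YG i) * gp (YG j) - gp (YG j) * gp (YG i) |i j. i \<in> {1..N} \<and> j \<in> {1..N}}
   \<union> {gp PiG * gp (YG i) * gp PiInvG
        - cp (if i = N then q else 1) * gp (YG (if i = N then 1 else i + 1)) |i. i \<in> {1..N}}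
   \<union> {gp PiG * gp (TG i) * gp PiInvG - gp (TG (i+1)) |i. i \<in> {1..<N} \<and> i + 1 \<in> {1..<N}}
   \<union> {gp PiG ^ N * gp (TG i) - gp (TG i) * gp PiG ^ N |i. i \<in> {1..<N}}"

definition daha_ideal :: "nat \<Rightarrow> complex \<Rightarrow> complex \<Rightarrow> gen free_poly set" where
  "daha_ideal N q v = Idl\<^bsub>free_alg (gens N)\<^esub> (daha_rels N q v)"

type_synonym daha_elt = "gen free_poly set"

definition daha :: "nat \<Rightarrow> complex \<Rightarrow> complex \<Rightarrow> daha_elt ring" where
  "daha N q v = free_alg (gens N) Quot daha_ideal N q v"

definition daha_class :: "nat \<Rightarrow> complex \<Rightarrow> complex \<Rightarrow> gen free_poly \<Rightarrow> daha_elt" where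
  "daha_class N q v p = daha_ideal N q v +>\<^bsub>free_alg (gens N)\<^esub> p"

definition scal :: "nat \<Rightarrow> complex \<Rightarrow> complex \<Rightarrow> complex \<Rightarrow> daha_elt" where
  "scal N q v c = daha_class N q v (cp c)"

definition dT :: "nat \<Rightarrow> complex \<Rightarrow> complex \<Rightarrow> nat \<Rightarrow> daha_elt" where
  "dT N q v i = daha_class N q v (gp (TG i))"

definition dPi :: "nat \<Rightarrow> complex \<Rightarrow> complex \<Rightarrow> daha_elt" where
  "dPi N q v = daha_class N q v (gp PiG)"

definition dY :: "nat \<Rightarrow> complex \<Rightarrow> complex \<Rightarrow> nat \<Rightarrow> daha_elt" where
  "dY N q v i = daha_class N q v (gp (YG i))"

definition lprod :: "('a, 'm) monoid_scheme \<Rightarrow> 'a list \<Rightarrow> 'a" where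
  "lprod G xs = foldr (\<otimes>\<^bsub>G\<^esub>) xs \<one>\<^bsub>G\<^esub>"

text \<open>\<open>T_up i\<close> is \<open>T\<^sub>1 \<cdots> T\<^sub>i\<^sub>-\<^sub>1\<close> and \<open>T_down i\<close> is \<open>T\<^sub>i\<^sub>-\<^sub>1 \<cdots> T\<^sub>1\<close>.\<close>

definition T_up :: "nat \<Rightarrow> complex \<Rightarrow> complex \<Rightarrow> nat \<Rightarrow> daha_elt" where
  "T_up N q v i = lprod (daha N q v) (map (dT N q v) [1..<i])"

definition T_down :: "nat \<Rightarrow> complex \<Rightarrow> complex \<Rightarrow> nat \<Rightarrow> daha_elt" where
  "T_down N q v i = lprod (daha N q v) (map (dT N q v) (rev [1..<i]))"

definition dX :: "nat \<Rightarrow> complex \<Rightarrow> complex \<Rightarrow> nat \<Rightarrow> daha_elt" where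
  "dX N q v i = (let H = daha N q v in
     lprod H (map (dT N q v) [i..<N]) \<otimes>\<^bsub>H\<^esub> inv\<^bsub>H\<^esub> (dPi N q v)
       \<otimes>\<^bsub>H\<^esub> lprod H (map (\<lambda>j. inv\<^bsub>H\<^esub> (dT N q v j)) [1..<i]))"


section \<open>Twisting by the braid group on three strands\<close>

definition daha_aut :: "nat \<Rightarrow> complex \<Rightarrow> complex \<Rightarrow> (daha_elt \<Rightarrow> daha_elt) set" where
  "daha_aut N q v =
    {\<tau> \<in> ring_iso (daha N q v) (daha N q v). \<forall>c. \<tau> (scal N q v c) = scal N q v c}"

definition is_tau_plus :: "nat \<Rightarrow> complex \<Rightarrow> complex \<Rightarrow> (daha_elt \<Rightarrow> daha_elt) \<Rightarrow> bool" where
  "is_tau_plus N q v \<tau> \<longleftrightarrow> (let H = daha N q v in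
     \<tau> \<in> daha_aut N q v \<and>
     (\<forall>i \<in> {1..<N}. \<tau> (dT N q v i) = dT N q v i) \<and>
     (\<forall>i \<in> {1..N}. \<tau> (dX N q v i) = dX N q v i) \<and>
     (\<forall>i \<in> {1..N}. \<tau> (dY N q v i) =
        dY N q v i \<otimes>\<^bsub>H\<^esub> dX N q v i \<otimes>\<^bsub>H\<^esub> T_down N q v i \<otimes>\<^bsub>H\<^esub> T_up N q v i))"

text \<open>Below, \<open>inv (T_up i)\<close> is \<open>T\<^sub>i\<^sub>-\<^sub>1\<inverse> \<cdots> T\<^sub>1\<inverse>\<close> and
  \<open>inv (T_down i)\<close> is \<open>T\<^sub>1\<inverse> \<cdots> T\<^sub>i\<^sub>-\<^sub>1\<inverse>\<close>.\<close>

definition is_tau_minus :: "nat \<Rightarrow> complex \<Rightarrow> complex \<Rightarrow> (daha_elt \<Rightarrow> daha_elt) \<Rightarrow> bool" where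
  "is_tau_minus N q v \<tau> \<longleftrightarrow> (let H = daha N q v in
     \<tau> \<in> daha_aut N q v \<and>
     (\<forall>i \<in> {1..<N}. \<tau> (dT N q v i) = dT N q v i) \<and>
     (\<forall>i \<in> {1..N}. \<tau> (dY N q v i) = dY N q v i) \<and>
     (\<forall>i \<in> {1..N}. \<tau> (dX N q v i) =
        dX N q v i \<otimes>\<^bsub>H\<^esub> dY N q v i
          \<otimes>\<^bsub>H\<^esub> inv\<^bsub>H\<^esub> (T_up N q v i) \<otimes>\<^bsub>H\<^esub> inv\<^bsub>H\<^esub> (T_down N q v i)))"

definition mat2 :: "int \<Rightarrow> int \<Rightarrow> int \<Rightarrow> int \<Rightarrow> int^2^2" where
  "mat2 a b c d = vector [vector [a, b], vector [c, d]]"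

text \<open>The pairs (action of \<open>g\<close> on the algebra, image of \<open>g\<close> in \<open>SL(2,\<int>)\<close>) for the braids \<open>g\<close>
  that are products of the inverses of \<open>\<tau>\<^sub>+\<close> and \<open>\<tau>\<^sub>-\<close>; the two matrices are the inverses of
  \<open>(1 1; 0 1)\<close> and \<open>(1 0; 1 1)\<close>.\<close>

inductive neg_tau_product ::
    "nat \<Rightarrow> complex \<Rightarrow> complex \<Rightarrow> (daha_elt \<Rightarrow> daha_elt) \<Rightarrow> int^2^2 \<Rightarrow> bool"
  for N :: nat and q v :: complex where
  unit: "neg_tau_product N q v id (mat 1)"
| plus: "is_tau_plus N q v \<tau> \<Longrightarrow> neg_tau_product N q v \<sigma> A \<Longrightarrow>
    neg_tau_product N q v (inv_into (carrier (daha N q v)) \<tau> \<circ> \<sigma>) (mat2 1 (-1) 0 1 ** A)"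
| minus: "is_tau_minus N q v \<tau> \<Longrightarrow> neg_tau_product N q v \<sigma> A \<Longrightarrow>
    neg_tau_product N q v (inv_into (carrier (daha N q v)) \<tau> \<circ> \<sigma>) (mat2 1 0 (-1) 1 ** A)"

text \<open>\<open>slope_word a b\<close> has letters at \<open>j = 1, \<dots>, a + b\<close>; it gives \<open>B\<^sub>1\<close> for \<open>(a, b) = (n, n')\<close>
  and \<open>A\<^sub>1\<close> for \<open>(a, b) = (m, m')\<close>. The recursion \<open>B\<^sub>i\<^sub>+\<^sub>1 = T\<^sub>i \<cdots> T\<^sub>1 B\<^sub>1 T\<^sub>1 \<cdots> T\<^sub>i\<close>
  is \<open>slope_elt\<close>.\<close>

definition slope_word :: "nat \<Rightarrow> complex \<Rightarrow> complex \<Rightarrow> nat \<Rightarrow> nat \<Rightarrow> daha_elt" where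
  "slope_word N q v a b = lprod (daha N q v)
     (map (\<lambda>j. if \<lfloor>real (j * a) / real (a + b)\<rfloor> = \<lfloor>real ((j - 1) * a) / real (a + b)\<rfloor>
               then dY N q v 1 else inv\<^bsub>daha N q v\<^esub> (dX N q v 1)) [1..<a + b + 1])"

definition slope_elt :: "nat \<Rightarrow> complex \<Rightarrow> complex \<Rightarrow> nat \<Rightarrow> nat \<Rightarrow> nat \<Rightarrow> daha_elt" where
  "slope_elt N q v a b i = (let H = daha N q v in
     T_down N q v i \<otimes>\<^bsub>H\<^esub> slope_word N q v a b \<otimes>\<^bsub>H\<^esub> T_up N q v i)"

definition is_sigma :: "nat \<Rightarrow> complex \<Rightarrow> complex \<Rightarrow> nat \<Rightarrow> nat \<Rightarrow> nat \<Rightarrow> nat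
    \<Rightarrow> (daha_elt \<Rightarrow> daha_elt) \<Rightarrow> bool" where
  "is_sigma N q v n n' m m' \<sigma> \<longleftrightarrow> (let H = daha N q v in
     neg_tau_product N q v \<sigma> (mat2 (int n) (- int m) (- int n') (int m')) \<and>
     \<sigma> \<in> daha_aut N q v \<and>
     (\<forall>i \<in> {1..<N}. \<sigma> (dT N q v i) = dT N q v i) \<and>
     (\<forall>i \<in> {1..N}. \<sigma> (inv\<^bsub>H\<^esub> (dX N q v i)) = slope_elt N q v n n' i) \<and>
     (\<forall>i \<in> {1..N}. \<sigma> (dY N q v i) = slope_elt N q v m m' i))"

definition twisted_module ::
    "('a, 'r) ring_scheme \<Rightarrow> ('a \<Rightarrow> 'a) \<Rightarrow> ('a, 'b) module \<Rightarrow> ('a, 'b) module" where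
  "twisted_module R \<sigma> M = M\<lparr>smult := \<lambda>a x. inv_into (carrier R) \<sigma> a \<odot>\<^bsub>M\<^esub> x\<rparr>"


section \<open>The Cherednik representation\<close>

definition fin_subalg :: "nat \<Rightarrow> complex \<Rightarrow> complex \<Rightarrow> daha_elt set" where
  "fin_subalg N q v = generate_ring (daha N q v)
     (dT N q v ` {1..<N} \<union> {dPi N q v, inv\<^bsub>daha N q v\<^esub> (dPi N q v)} \<union> range (scal N q v))"

definition is_character ::
    "('a, 'r) ring_scheme \<Rightarrow> (complex \<Rightarrow> 'a) \<Rightarrow> 'a set \<Rightarrow> ('a \<Rightarrow> complex) \<Rightarrow> bool" where
  "is_character R sc S \<psi> \<longleftrightarrow>
     (\<forall>c. \<psi> (sc c) = c) \<and>
     (\<forall>x \<in> S. \<forall>y \<in> S. \<psi> (x \<oplus>\<^bsub>R\<^esub> y) = \<psi> x + \<psi> y \<and> \<psi> (x \<otimes>\<^bsub>R\<^esub> y) = \<psi> x * \<psi> y)"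

text \<open>\<open>R \<otimes>\<^sub>S \<complex>\<^sub>\<psi>\<close>, written as the quotient of \<open>R \<otimes> \<complex> = R\<close> by the
  tensor relations \<open>h s \<otimes> 1 = h \<otimes> \<psi>(s)\<close>. The argument \<open>sc\<close> is the embedding of the scalars.
  The fields \<open>mult\<close> and \<open>one\<close> of a module record carry no information.\<close>

definition induced_module ::
    "('a, 'r) ring_scheme \<Rightarrow> (complex \<Rightarrow> 'a) \<Rightarrow> 'a set \<Rightarrow> ('a \<Rightarrow> complex) \<Rightarrow> ('a, 'a set) module"
  where
  "induced_module R sc S \<psi> =
    (let K = generate (add_monoid R)
               {(h \<otimes>\<^bsub>R\<^esub> s) \<ominus>\<^bsub>R\<^esub> (sc (\<psi> s) \<otimes>\<^bsub>R\<^esub> h) |h s. h \<in> carrier R \<and> s \<in> S}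
     in \<lparr>carrier = a_rcosets\<^bsub>R\<^esub> K, mult = undefined, one = undefined,
         zero = K, add = set_add R, smult = \<lambda>h C. K <+>\<^bsub>R\<^esub> (h <#\<^bsub>R\<^esub> C)\<rparr>)"

text \<open>The choice is unique on \<open>fin_subalg\<close>, and only the values there matter.\<close>

definition cherednik_character ::
    "nat \<Rightarrow> complex \<Rightarrow> complex \<Rightarrow> complex \<Rightarrow> daha_elt \<Rightarrow> complex" where
  "cherednik_character N q v u =
    (SOME \<psi>. is_character (daha N q v) (scal N q v) (fin_subalg N q v) \<psi> \<and>
       (\<forall>i \<in> {1..<N}. \<psi> (dT N q v i) = v) \<and> \<psi> (dPi N q v) = u)"

definition cherednik_module ::
    "nat \<Rightarrow> complex \<Rightarrow> complex \<Rightarrow> complex \<Rightarrow> (daha_elt, daha_elt set) module" where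
  "cherednik_module N q v u =
    induced_module (daha N q v) (scal N q v) (fin_subalg N q v) (cherednik_character N q v u)"


section \<open>The representation on \<open>(\<complex>\<^sup>n[Y\<^sup>\<plusminus>\<^sup>1])\<^sup>\<otimes>\<^sup>N\<close>\<close>

text \<open>The basis vector \<open>e(k\<^sub>1) \<otimes> \<cdots> \<otimes> e(k\<^sub>N)\<close> is indexed by the function \<open>k\<close>, extended by \<open>0\<close>
  outside \<open>{1..N}\<close>. As \<open>e(n j + a) = Y\<^sup>j e(a)\<close>, the \<open>i\<close>-th tensor factor has exponent
  \<open>k i div n\<close> of \<open>Y\<^sub>i\<close> and component \<open>k i mod n\<close> in \<open>\<complex>\<^sup>n\<close>.\<close>

type_synonym tensor = "(nat \<Rightarrow> int) \<Rightarrow>\<^sub>0 complex"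

definition tensor_space :: "nat \<Rightarrow> tensor set" where
  "tensor_space N = {f. \<forall>k \<in> Poly_Mapping.keys f. \<forall>i. i \<notin> {1..N} \<longrightarrow> k i = 0}"

abbreviation basis :: "(nat \<Rightarrow> int) \<Rightarrow> tensor" where
  "basis k \<equiv> Poly_Mapping.single k 1"

definition scale :: "complex \<Rightarrow> tensor \<Rightarrow> tensor" where
  "scale c f = Poly_Mapping.map ((*) c) f"

definition lin_ext :: "((nat \<Rightarrow> int) \<Rightarrow> tensor) \<Rightarrow> tensor \<Rightarrow> tensor" where
  "lin_ext \<phi> f = (\<Sum>k \<in> Poly_Mapping.keys f. scale (Poly_Mapping.lookup f k) (\<phi> k))"

definition Ypow_op :: "nat \<Rightarrow> nat \<Rightarrow> int \<Rightarrow> tensor \<Rightarrow> tensor" where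
  "Ypow_op n i j = lin_ext (\<lambda>k. basis (k(i := k i + int n * j)))"

definition sY_op :: "nat \<Rightarrow> nat \<Rightarrow> tensor \<Rightarrow> tensor" where
  "sY_op n i = lin_ext (\<lambda>k. basis (k(
     i := int n * (k (i+1) div int n) + k i mod int n,
     i+1 := int n * (k i div int n) + k (i+1) mod int n)))"

definition s_op :: "nat \<Rightarrow> tensor \<Rightarrow> tensor" where
  "s_op i = lin_ext (\<lambda>k. basis (k(i := k (i+1), i+1 := k i)))"

text \<open>The matrix unit \<open>E\<^sub>a\<^sub>b\<close>, sending \<open>e(b)\<close> to \<open>e(a)\<close>, on the \<open>i\<close>-th factor.\<close>

definition E_op :: "nat \<Rightarrow> nat \<Rightarrow> nat \<Rightarrow> nat \<Rightarrow> tensor \<Rightarrow> tensor" where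
  "E_op n i a b = lin_ext (\<lambda>k. if k i mod int n = int b
     then basis (k(i := int n * (k i div int n) + int a)) else 0)"

definition R_op :: "nat \<Rightarrow> complex \<Rightarrow> nat \<Rightarrow> tensor \<Rightarrow> tensor" where
  "R_op n v i f =
     scale v (\<Sum>a<n. E_op n i a a (E_op n (i+1) a a f)) +
     (\<Sum>b<n. \<Sum>a<b. E_op n i a b (E_op n (i+1) b a f) + E_op n i b a (E_op n (i+1) a b f)
        + scale (v - inverse v) (E_op n i a a (E_op n (i+1) b b f)))"

text \<open>The quotient of \<open>(s\<^sub>i\<^sup>Y - 1) f\<close> by \<open>Y\<^sub>i / Y\<^sub>i\<^sub>+\<^sub>1 - 1\<close>; multiplication by the latter is
  injective and the division is exact.\<close>

definition ddiff_op :: "nat \<Rightarrow> nat \<Rightarrow> tensor \<Rightarrow> tensor" where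
  "ddiff_op n i f =
    (THE g. Ypow_op n i 1 (Ypow_op n (i+1) (-1) g) - g = sY_op n i f - f)"

definition T_op :: "nat \<Rightarrow> complex \<Rightarrow> nat \<Rightarrow> tensor \<Rightarrow> tensor" where
  "T_op n v i f = sY_op n i (R_op n v i f) + scale (v - inverse v) (ddiff_op n i f)"

definition kappa_op :: "nat \<Rightarrow> tensor \<Rightarrow> tensor" where
  "kappa_op i = lin_ext (\<lambda>k. basis (k(i := k i - 1)))"

definition D_op :: "nat \<Rightarrow> complex \<Rightarrow> (nat \<Rightarrow> complex) \<Rightarrow> nat \<Rightarrow> tensor \<Rightarrow> tensor" where
  "D_op n q u i =
    lin_ext (\<lambda>k. scale (u (nat (k i mod int n)) * q powi (k i div int n)) (basis k))"

definition Pi_op :: "nat \<Rightarrow> nat \<Rightarrow> nat \<Rightarrow> complex \<Rightarrow> (nat \<Rightarrow> complex) \<Rightarrow> tensor \<Rightarrow> tensor" where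
  "Pi_op N n n' q u = (kappa_op 1 ^^ n') \<circ> D_op n q u 1 \<circ> foldr (\<circ>) (map s_op [1..<N]) id"

text \<open>\<open>M\<close> is determined by these conditions (up to values outside the carriers), since the
  \<open>T\<^sub>i\<close>, \<open>\<pi>\<^sup>\<plusminus>\<^sup>1\<close>, \<open>Y\<^sub>i\<^sup>\<plusminus>\<^sup>1\<close> generate the algebra.\<close>

definition is_C_module :: "nat \<Rightarrow> nat \<Rightarrow> nat \<Rightarrow> complex \<Rightarrow> complex \<Rightarrow> (nat \<Rightarrow> complex)
    \<Rightarrow> (daha_elt, tensor) module \<Rightarrow> bool" where
  "is_C_module N n n' q v u M \<longleftrightarrow>
     left_module (daha N q v) M \<and>
     carrier M = tensor_space N \<and> \<zero>\<^bsub>M\<^esub> = 0 \<and>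
     (\<forall>f \<in> tensor_space N. \<forall>g \<in> tensor_space N. f \<oplus>\<^bsub>M\<^esub> g = f + g) \<and>
     (\<forall>c. \<forall>f \<in> tensor_space N. scal N q v c \<odot>\<^bsub>M\<^esub> f = scale c f) \<and>
     (\<forall>i \<in> {1..<N}. \<forall>f \<in> tensor_space N. dT N q v i \<odot>\<^bsub>M\<^esub> f = T_op n v i f) \<and>
     (\<forall>f \<in> tensor_space N. dPi N q v \<odot>\<^bsub>M\<^esub> f = Pi_op N n n' q u f) \<and>
     (\<forall>i \<in> {1..N}. \<forall>f \<in> tensor_space N. dY N q v i \<odot>\<^bsub>M\<^esub> f = Ypow_op n i 1 f)"

end

theory Submission
  imports Defs
begin

text \<open>The vector \<open>w0 = e\<^sub>0 \<otimes> \<cdots> \<otimes> e\<^sub>0\<close> satisfies \<open>T\<^sub>i w0 = v w0\<close>. As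
  \<open>\<sigma>(\<pi>) = B\<^sub>1 T\<^sub>1 \<cdots> T\<^sub>N\<^sub>-\<^sub>1\<close>, it is also an eigenvector of \<open>\<sigma>(\<pi>)\<close>: along the word \<open>B\<^sub>1\<close>
  the first factor runs through vectors \<open>e(-d)\<close>, the letter \<open>X\<^sub>1\<inverse>\<close> is applied exactly once for
  each \<open>0 \<le> d < n\<close>, and no correction terms occur; the scalars multiply to
  \<open>u = u\<^sub>0 \<cdots> u\<^sub>n\<^sub>-\<^sub>1 q\<^sup>1\<^sup>-\<^sup>n\<close>. Hence \<open>h \<mapsto> \<sigma>(h) w0\<close> factors through the Cherednik module.

  For bijectivity, \<open>A\<^sub>1 T\<^sub>1 \<cdots> T\<^sub>N\<^sub>-\<^sub>1\<close> moves the last factor of a basis vector to the front and raises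
  its index by one, up to a nonzero scalar and terms with fewer factors of maximal index. By induction,
  the image of the span of the \<open>Y\<^sup>k\<close> with all exponents in an interval \<open>[a, b]\<close> contains all basis
  vectors with indices in \<open>[a, b]\<close>. This gives surjectivity, and injectivity by comparing dimensions.

  The vectors on which the braid relation for the \<open>T\<^sub>i\<close> holds form a subspace stable under the \<open>T\<^sub>i\<close>
  and the \<open>Y\<^sub>i\<close>, so that it needs to be checked on constants only.\<close>

section \<open>Linear operators on the tensor space\<close>

text \<open>That the monomials Y^k form a basis of the Cherednik module is not taken for granted.
  Rewriting with the relations shows only that they span it. Their independence comes out of the
  dimension count: a box of exponents has as many images of monomials as indices, and these images
  span all basis vectors of the box. The Cherednik character exists for a similar reason: its values
  are read off from the action on w0.

  The obstacle is triangularity. On a factor displaced by -d, the inverses T_i^-1 inside X_1^-1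
  could create indices beyond the bound b when d >= n. Here n m' - n' m = 1 and m < n enter: they
  confine d to 0, ..., n - 2 at each letter X_1^-1 of A_1.

  The induction over intervals [a, b] has to start at [a, a] for every integer a. There N rounds of
  A_1 T_1 ... T_{N-1} carry the vector with all indices a to a multiple of the vector with all
  indices a + 1, with no correction terms at all; negative a are reached by going back along this
  map, using its injectivity.\<close>

definition pm_ext :: "('k \<Rightarrow> tensor) \<Rightarrow> ('k \<Rightarrow>\<^sub>0 complex) \<Rightarrow> tensor" where
  "pm_ext \<phi> f = (\<Sum>k \<in> Poly_Mapping.keys f. scale (Poly_Mapping.lookup f k) (\<phi> k))"

text \<open>The index type of \<open>pm_ext\<close> is arbitrary, so the same lemmas serve for
  tensors, indexed by exponents, and in \<open>evalp\<close> for noncommutative polynomials, indexed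
  by words.\<close>

lemma lin_ext_eq_pm_ext: "lin_ext = pm_ext"
  by (intro ext) (simp add: lin_ext_def pm_ext_def)

lemma lookup_scale [simp]: "Poly_Mapping.lookup (scale c f) k = c * Poly_Mapping.lookup f k"
  by (simp add: scale_def Poly_Mapping.map.rep_eq when_def)

lemma scale_add: "scale c (f + g) = scale c f + scale c g"
  and scale_add_left: "scale (c + d) f = scale c f + scale d f"
  and scale_scale [simp]: "scale c (scale d f) = scale (c * d) f"
  and scale_one [simp]: "scale 1 f = f"
  and scale_zero [simp]: "scale 0 f = 0"
  and scale_zero_right [simp]: "scale c 0 = 0"
  and scale_minus: "scale c (- f) = - scale c f"
  and scale_minus_left: "scale (- c) f = - scale c f"
  and scale_diff: "scale c (f - g) = scale c f - scale c g"
  and scale_diff_left: "scale (c - d) f = scale c f - scale d f"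
  by (rule poly_mapping_eqI; simp add: lookup_add lookup_minus algebra_simps)+

lemma scale_single: "scale c (Poly_Mapping.single k d) = Poly_Mapping.single k (c * d)"
  by (rule poly_mapping_eqI) (simp add: lookup_single when_def)

lemma pm_expand: "(f :: 'k \<Rightarrow>\<^sub>0 complex) = (\<Sum>k\<in>Poly_Mapping.keys f. Poly_Mapping.single k (Poly_Mapping.lookup f k))"
proof (rule poly_mapping_eqI)
  fix k
  have "(\<Sum>l\<in>Poly_Mapping.keys f.
      Poly_Mapping.lookup (Poly_Mapping.single l (Poly_Mapping.lookup f l)) k)
    = (\<Sum>l\<in>Poly_Mapping.keys f. if l = k then Poly_Mapping.lookup f k else 0)"
    by (rule sum.cong) (auto simp: lookup_single when_def)
  then show "Poly_Mapping.lookup f k = Poly_Mapping.lookup (\<Sum>k\<in>Poly_Mapping.keys f.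
      Poly_Mapping.single k (Poly_Mapping.lookup f k)) k"
    by (simp add: lookup_sum in_keys_iff)
qed

lemma pm_induct_keys [consumes 1, case_names zero single add]:
  fixes f :: "'k \<Rightarrow>\<^sub>0 complex"
  assumes "Poly_Mapping.keys f \<subseteq> S" "P 0"
    "\<And>k c. k \<in> S \<Longrightarrow> P (Poly_Mapping.single k c)"
    "\<And>f g. P f \<Longrightarrow> P g \<Longrightarrow> P (f + g)"
  shows "P f"
proof -
  have "P (\<Sum>k\<in>A. Poly_Mapping.single k (Poly_Mapping.lookup f k))" if "finite A" "A \<subseteq> S" for A
    using that by (induct A rule: finite_induct) (use assms in auto)
  then show ?thesis using assms(1) pm_expand[of f] by (metis finite_keys)
qed

lemma pm_induct [case_names zero single add]:
  fixes f :: "'k \<Rightarrow>\<^sub>0 complex"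
  assumes "P 0" "\<And>k c. P (Poly_Mapping.single k c)" "\<And>f g. P f \<Longrightarrow> P g \<Longrightarrow> P (f + g)"
  shows "P f"
  using pm_induct_keys[of f UNIV P] assms by auto

lemma pm_ext_superset:
  assumes "finite A" "Poly_Mapping.keys f \<subseteq> A"
  shows "pm_ext \<phi> f = (\<Sum>k \<in> A. scale (Poly_Mapping.lookup f k) (\<phi> k))"
  unfolding pm_ext_def
  by (rule sum.mono_neutral_left) (use assms in \<open>auto simp: in_keys_iff\<close>)

lemma pm_ext_add [simp]: "pm_ext \<phi> (f + g) = pm_ext \<phi> f + pm_ext \<phi> g"
proof -
  let ?A = "Poly_Mapping.keys f \<union> Poly_Mapping.keys g"
  show ?thesis
    using Poly_Mapping.keys_add[of f g]
    by (simp add: pm_ext_superset[of ?A] lookup_add scale_add_left sum.distrib)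
qed

lemma pm_ext_single [simp]: "pm_ext \<phi> (Poly_Mapping.single k c) = scale c (\<phi> k)"
  by (cases "c = 0") (simp_all add: pm_ext_def)

lemma pm_ext_zero [simp]: "pm_ext \<phi> 0 = 0"
  by (simp add: pm_ext_def)

lemma pm_ext_scale [simp]: "pm_ext \<phi> (scale c f) = scale c (pm_ext \<phi> f)"
  by (induct f rule: pm_induct) (simp_all add: scale_add scale_single)

lemma lin_ext_basis [simp]: "lin_ext \<phi> (basis k) = \<phi> k"
  by (simp add: lin_ext_eq_pm_ext)

section \<open>Linear maps of the tensor space\<close>

definition lin :: "(tensor \<Rightarrow> tensor) \<Rightarrow> bool" where
  "lin L \<longleftrightarrow> (\<forall>f g. L (f + g) = L f + L g) \<and> (\<forall>c f. L (scale c f) = scale c (L f))"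

lemma lin_add: "lin L \<Longrightarrow> L (f + g) = L f + L g"
  and lin_scale: "lin L \<Longrightarrow> L (scale c f) = scale c (L f)"
  by (simp_all add: lin_def)

lemma lin_zero: "lin L \<Longrightarrow> L 0 = 0"
  using lin_scale[of L 0 0] by simp

lemma lin_minus: "lin L \<Longrightarrow> L (- f) = - L f"
  using lin_scale[of L "-1" f] by (simp add: scale_minus_left)

lemma lin_diff: "lin L \<Longrightarrow> L (f - g) = L f - L g"
  using lin_add[of L f "- g"] by (simp add: lin_minus)

lemmas lin_simps = lin_add lin_scale lin_zero lin_minus lin_diff

lemma lin_lin_ext [simp]: "lin (lin_ext \<phi>)"
  by (simp add: lin_def lin_ext_eq_pm_ext)

lemma lin_id: "lin (\<lambda>f. f)"
  and lin_comp: "lin L \<Longrightarrow> lin L' \<Longrightarrow> lin (\<lambda>f. L (L' f))"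
  and lin_plus: "lin L \<Longrightarrow> lin L' \<Longrightarrow> lin (\<lambda>f. L f + L' f)"
  and lin_minus': "lin L \<Longrightarrow> lin L' \<Longrightarrow> lin (\<lambda>f. L f - L' f)"
  and lin_smult: "lin L \<Longrightarrow> lin (\<lambda>f. scale c (L f))"
  by (simp_all add: lin_def scale_add scale_diff mult.commute)

lemma lin_const_zero: "lin (\<lambda>f. 0)"
  by (simp add: lin_def)

lemma lin_sum': "(\<And>x. x \<in> A \<Longrightarrow> lin (L x)) \<Longrightarrow> lin (\<lambda>f. \<Sum>x\<in>A. L x f)"
  by (induct A rule: infinite_finite_induct) (simp_all add: lin_plus lin_const_zero)

lemma lin_foldr: "(\<And>x. x \<in> set xs \<Longrightarrow> lin (L x)) \<Longrightarrow> lin (foldr (\<circ>) (map L xs) id)"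
  by (induct xs) (auto simp: o_def id_def intro: lin_comp lin_id)

lemma lin_pow: "lin L \<Longrightarrow> lin (L ^^ m)"
  by (induct m) (auto simp: o_def id_def intro: lin_comp lin_id)

lemmas lin_intros = lin_id lin_plus lin_minus' lin_smult lin_sum' lin_const_zero

lemma lin_eqI:
  assumes "lin A" "lin B" "\<And>k. A (basis k) = B (basis k)"
  shows "A f = B f"
proof (induct f rule: pm_induct)
  case (single k c)
  show ?case using lin_scale[OF assms(1), of c "basis k"] lin_scale[OF assms(2), of c "basis k"] assms(3)
    by (simp add: scale_single)
qed (use assms in \<open>auto simp: lin_simps\<close>)

section \<open>Spans of sets of basis vectors\<close>

definition bspan :: "(nat \<Rightarrow> int) set \<Rightarrow> tensor set" where
  "bspan S = {f. Poly_Mapping.keys f \<subseteq> S}"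

lemma bspan_zero [simp]: "0 \<in> bspan S"
  and bspan_basis: "k \<in> S \<Longrightarrow> basis k \<in> bspan S"
  and bspan_mono: "S \<subseteq> S' \<Longrightarrow> bspan S \<subseteq> bspan S'"
  by (auto simp: bspan_def)

lemma bspan_add: "f \<in> bspan S \<Longrightarrow> g \<in> bspan S \<Longrightarrow> f + g \<in> bspan S"
  using Poly_Mapping.keys_add[of f g] by (auto simp: bspan_def)

lemma bspan_scale: "f \<in> bspan S \<Longrightarrow> scale c f \<in> bspan S"
  by (auto simp: bspan_def in_keys_iff)

lemma bspan_minus: "f \<in> bspan S \<Longrightarrow> - f \<in> bspan S"
  by (auto simp: bspan_def in_keys_iff)

lemma bspan_diff: "f \<in> bspan S \<Longrightarrow> g \<in> bspan S \<Longrightarrow> f - g \<in> bspan S"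
  using bspan_add[of f S "- g"] bspan_minus by simp

lemma bspan_sum: "(\<And>x. x \<in> A \<Longrightarrow> h x \<in> bspan S) \<Longrightarrow> sum h A \<in> bspan S"
  by (induct A rule: infinite_finite_induct) (auto intro: bspan_add)

lemmas bspan_intros = bspan_zero bspan_basis bspan_add bspan_scale bspan_minus bspan_diff bspan_sum

lemma bspan_empty [simp]: "bspan {} = {0}"
  by (auto simp: bspan_def)

lemma bspan_induct [consumes 1, case_names zero basis add scale]:
  assumes "f \<in> bspan S" "P 0" "\<And>k. k \<in> S \<Longrightarrow> P (basis k)" "\<And>f g. P f \<Longrightarrow> P g \<Longrightarrow> P (f + g)"
    "\<And>c f. P f \<Longrightarrow> P (scale c f)"
  shows "P f"
proof -
  have "Poly_Mapping.keys f \<subseteq> S" using assms(1) by (simp add: bspan_def)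
  then show ?thesis
  proof (induct f rule: pm_induct_keys)
    case (single k c)
    show ?case using assms(5)[OF assms(3)[OF single], of c] by (simp add: scale_single)
  qed (use assms in auto)
qed

lemma lin_bspan:
  assumes "lin L" "f \<in> bspan S" "\<And>k. k \<in> S \<Longrightarrow> L (basis k) \<in> bspan S'"
  shows "L f \<in> bspan S'"
  using assms(2) by (induct f rule: bspan_induct) (use assms in \<open>auto simp: lin_simps intro: bspan_intros\<close>)

lemma tensor_space_eq: "tensor_space N = bspan {k. \<forall>i. i \<notin> {1..N} \<longrightarrow> k i = 0}"
  by (auto simp: tensor_space_def bspan_def)


section \<open>The operators \<open>T\<^sub>i\<close> and \<open>Y\<^sub>i\<close>\<close>

lemma lin_Ypow [simp]: "lin (Ypow_op n i j)"
  by (simp add: Ypow_op_def)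

lemma lin_Ypow_comp [simp, intro]: "lin L \<Longrightarrow> lin (\<lambda>f. Ypow_op n i j (L f))"
  by (rule lin_comp[OF lin_Ypow])

lemma Ypow_basis [simp]: "Ypow_op n i j (basis k) = basis (k(i := k i + int n * j))"
  by (simp add: Ypow_op_def)

lemma lin_sY [simp]: "lin (sY_op n i)"
  by (simp add: sY_op_def)

lemma lin_sY_comp [simp, intro]: "lin L \<Longrightarrow> lin (\<lambda>f. sY_op n i (L f))"
  by (rule lin_comp[OF lin_sY])

lemma sY_basis: "sY_op n i (basis k) = basis (k(
     i := int n * (k (i+1) div int n) + k i mod int n,
     i+1 := int n * (k i div int n) + k (i+1) mod int n))"
  by (simp add: sY_op_def)

lemma lin_E [simp]: "lin (E_op n i a b)"
  by (simp add: E_op_def)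

lemma lin_E_comp [simp, intro]: "lin L \<Longrightarrow> lin (\<lambda>f. E_op n i a b (L f))"
  by (rule lin_comp[OF lin_E])

lemma E_basis: "E_op n i a b (basis k) = (if k i mod int n = int b
     then basis (k(i := int n * (k i div int n) + int a)) else 0)"
  by (simp add: E_op_def)

lemma lin_R [simp]: "lin (R_op n v i)"
  unfolding R_op_def[abs_def] by (intro lin_intros lin_E_comp)

lemma lin_R_comp [simp, intro]: "lin L \<Longrightarrow> lin (\<lambda>f. R_op n v i (L f))"
  by (rule lin_comp[OF lin_R])

lemma Ypow_add: "Ypow_op n i j (Ypow_op n i l f) = Ypow_op n i (j + l) f"
  by (rule lin_eqI[of "\<lambda>f. Ypow_op n i j (Ypow_op n i l f)"])
     (auto intro!: lin_intros simp: algebra_simps)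

lemma Ypow_zero [simp]: "Ypow_op n i 0 f = f"
  by (rule lin_eqI[of "Ypow_op n i 0" "\<lambda>f. f"]) (auto intro!: lin_intros)

lemma Ypow_inv [simp]: "Ypow_op n i (-1) (Ypow_op n i 1 f) = f" "Ypow_op n i 1 (Ypow_op n i (-1) f) = f"
  by (simp_all add: Ypow_add)

lemma Ypow_commute: "Ypow_op n i j (Ypow_op n i' l f) = Ypow_op n i' l (Ypow_op n i j f)"
  by (rule lin_eqI[of "\<lambda>f. Ypow_op n i j (Ypow_op n i' l f)"])
     (auto intro!: lin_intros simp: fun_upd_twist algebra_simps)

definition swap_at :: "nat \<Rightarrow> (nat \<Rightarrow> int) \<Rightarrow> (nat \<Rightarrow> int)" where
  "swap_at i k = k(i := k (i+1), i+1 := k i)"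

text \<open>Exchanges the components in C^n and leaves the exponents of the Y_j in place, as the
  off-diagonal terms of R do; \<open>swap_at\<close> exchanges whole tensor factors.\<close>

definition swap_comp :: "nat \<Rightarrow> nat \<Rightarrow> (nat \<Rightarrow> int) \<Rightarrow> (nat \<Rightarrow> int)" where
  "swap_comp n i k = k(i := int n * (k i div int n) + k (i+1) mod int n,
                 i+1 := int n * (k (i+1) div int n) + k i mod int n)"

lemma R_basis:
  assumes n: "n \<ge> 1"
  shows "R_op n v i (basis k) =
    (if k i mod int n = k (i+1) mod int n then scale v (basis k)
     else basis (swap_comp n i k) + (if k i mod int n < k (i+1) mod int n
            then scale (v - inverse v) (basis k) else 0))"
proof -
  define p where "p = nat (k i mod int n)"
  define r where "r = nat (k (i+1) mod int n)"
  have pr: "k i mod int n = int p" "k (i+1) mod int n = int r" "p < n" "r < n"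
    using n by (auto simp: p_def r_def nat_less_iff)
  have self: "int n * (k j div int n) + k j mod int n = k j" for j by simp
  have 1: "E_op n i a b (E_op n (i+1) b a (basis k)) = (if p = b \<and> r = a then basis (swap_comp n i k) else 0)" for a b
    using pr by (auto simp: E_basis lin_zero[OF lin_E] swap_comp_def fun_upd_twist)
  have 2: "E_op n i a a (E_op n (i+1) b b (basis k)) = (if p = a \<and> r = b then basis k else 0)" for a b
    using pr self[of i] self[of "i+1"] by (auto simp: E_basis lin_zero[OF lin_E])
  have "R_op n v i (basis k) = scale v (\<Sum>a<n. if p = a \<and> r = a then basis k else 0)
    + (\<Sum>b<n. \<Sum>a<b. (if p = b \<and> r = a then basis (swap_comp n i k) else 0)
        + (if p = a \<and> r = b then basis (swap_comp n i k) else 0)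
        + scale (v - inverse v) (if p = a \<and> r = b then basis k else 0))"
    unfolding R_op_def 2 unfolding 1 by (rule refl)
  also have "(\<Sum>a<n. if p = a \<and> r = a then basis k else 0) = (\<Sum>a<n. if a = p then (if p = r then basis k else 0) else 0)"
    by (rule sum.cong) auto
  also have "\<dots> = (if p = r then basis k else 0)" using pr by simp
  also have "(\<Sum>b<n. \<Sum>a<b. (if p = b \<and> r = a then basis (swap_comp n i k) else 0)
        + (if p = a \<and> r = b then basis (swap_comp n i k) else 0)
        + scale (v - inverse v) (if p = a \<and> r = b then basis k else 0))
     = (\<Sum>b<n. \<Sum>a<b. (if a = r then (if p = b then basis (swap_comp n i k) else 0) else 0))
     + (\<Sum>b<n. \<Sum>a<b. (if a = p then (if r = b then basis (swap_comp n i k) 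
         + scale (v - inverse v) (basis k) else 0) else 0))"
    unfolding sum.distrib[symmetric] by (intro sum.cong) auto
  also have "(\<Sum>b<n. \<Sum>a<b. (if a = r then (if p = b then basis (swap_comp n i k) else 0) else 0))
     = (\<Sum>b<n. if b = p then (if r < p then basis (swap_comp n i k) else 0) else 0)"
    by (intro sum.cong) auto
  also have "\<dots> = (if r < p then basis (swap_comp n i k) else 0)" using pr by simp
  also have "(\<Sum>b<n. \<Sum>a<b. (if a = p then (if r = b then basis (swap_comp n i k) 
         + scale (v - inverse v) (basis k) else 0) else 0))
     = (\<Sum>b<n. if b = r then (if p < r then basis (swap_comp n i k) 
         + scale (v - inverse v) (basis k) else 0) else 0)"
    by (intro sum.cong) auto
  also have "\<dots> = (if p < r then basis (swap_comp n i k) + scale (v - inverse v) (basis k) else 0)" using pr by simp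
  finally show ?thesis using pr by auto
qed

lemma sY_sY: "n \<ge> 1 \<Longrightarrow> sY_op n i (sY_op n i f) = f"
  by (rule lin_eqI[of "\<lambda>f. sY_op n i (sY_op n i f)" "\<lambda>f. f"])
     (auto intro!: lin_intros simp: sY_basis fun_upd_twist)

lemma sY_Y: "n \<ge> 1 \<Longrightarrow> sY_op n i (Ypow_op n i j f) = Ypow_op n (i+1) j (sY_op n i f)"
  by (rule lin_eqI[of "\<lambda>f. sY_op n i (Ypow_op n i j f)"])
     (auto intro!: lin_intros simp: sY_basis fun_upd_twist algebra_simps)

lemma sY_Y': "n \<ge> 1 \<Longrightarrow> sY_op n i (Ypow_op n (Suc i) j f) = Ypow_op n i j (sY_op n i f)"
  by (rule lin_eqI[of "\<lambda>f. sY_op n i (Ypow_op n (Suc i) j f)"])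
     (auto intro!: lin_intros simp: sY_basis fun_upd_twist algebra_simps)

lemma sY_Y_far: "n \<ge> 1 \<Longrightarrow> l \<noteq> i \<Longrightarrow> l \<noteq> Suc i \<Longrightarrow> sY_op n i (Ypow_op n l j f) = Ypow_op n l j (sY_op n i f)"
  by (rule lin_eqI[of "\<lambda>f. sY_op n i (Ypow_op n l j f)"])
     (auto intro!: lin_intros simp: sY_basis fun_upd_twist)

text \<open>R acts on the components in C^n only, so it commutes with what acts on the Laurent
  polynomials: here multiplication by Y_l, below \<open>sY_op\<close>.\<close>

lemma R_Y: "n \<ge> 1 \<Longrightarrow> R_op n v i (Ypow_op n l j f) = Ypow_op n l j (R_op n v i f)"
  by (rule lin_eqI[of "\<lambda>f. R_op n v i (Ypow_op n l j f)"])
     (auto intro!: lin_intros simp: R_basis lin_simps swap_comp_def fun_eq_iff algebra_simps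
       simp flip: One_nat_def intro!: arg_cong[of _ _ basis])

lemma sY_R: "n \<ge> 1 \<Longrightarrow> sY_op n i (R_op n v i f) = R_op n v i (sY_op n i f)"
  by (rule lin_eqI[of "\<lambda>f. sY_op n i (R_op n v i f)"])
     (auto intro!: lin_intros simp: R_basis lin_simps swap_comp_def sY_basis fun_eq_iff algebra_simps
       intro!: arg_cong[of _ _ basis])

lemma R_R: "n \<ge> 1 \<Longrightarrow> v \<noteq> 0 \<Longrightarrow> R_op n v i (R_op n v i f) = scale (v - inverse v) (R_op n v i f) + f"
proof (rule lin_eqI[of "\<lambda>f. R_op n v i (R_op n v i f)" "\<lambda>f. scale (v - inverse v) (R_op n v i f) + f"])
  fix k assume n: "n \<ge> 1" and v: "v \<noteq> 0"
  have sw: "swap_comp n i (swap_comp n i k) = k" "swap_comp n i k i mod int n = k (i+1) mod int n" 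
    "swap_comp n i k (i+1) mod int n = k i mod int n"
    using n by (auto simp: swap_comp_def)
  have vv: "v * v = (v - inverse v) * v + 1" using v by (simp add: field_simps)
  have sc: "scale v (scale v f) = scale (v - inverse v) (scale v f) + f" for f
    using vv by (metis scale_add_left scale_one scale_scale)
  show "R_op n v i (R_op n v i (basis k)) = scale (v - inverse v) (R_op n v i (basis k)) + basis k"
    using n sc by (auto simp: R_basis lin_simps sw scale_add simp del: One_nat_def scale_scale)
qed (auto intro!: lin_intros)

section \<open>Divided differences\<close>

abbreviation Yratio :: "nat \<Rightarrow> nat \<Rightarrow> tensor \<Rightarrow> tensor" where
  "Yratio n i f \<equiv> Ypow_op n i 1 (Ypow_op n (i+1) (-1) f)"

lemma lookup_Ypow: "Poly_Mapping.lookup (Ypow_op n i j f) k = Poly_Mapping.lookup f (k(i := k i - int n * j))"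
proof (induct f rule: pm_induct)
  case (single l c)
  have "l(i := l i + int n * j) = k \<longleftrightarrow> l = k(i := k i - int n * j)" by auto
  moreover have "Ypow_op n i j (Poly_Mapping.single l c) = scale c (basis (l(i := l i + int n * j)))"
    using lin_scale[OF lin_Ypow, of n i j c "basis l"] by (simp add: scale_single)
  ultimately show ?case by (simp only: lookup_scale lookup_single when_def mult_1_right split: if_split) auto
qed (simp_all add: lin_simps lookup_add)

text \<open>A finite nonempty support has a smallest i-th entry, and invariance under Y_i/Y_{i+1}
  would produce a smaller one.\<close>

lemma Yratio_fixed:
  assumes n: "n \<ge> 1" and fx: "Yratio n i f = f"
  shows "f = 0"
proof (rule ccontr)
  assume "f \<noteq> 0"
  then have ne: "Poly_Mapping.keys f \<noteq> {}" by (simp add: poly_mapping_eq_iff fun_eq_iff in_keys_iff set_eq_iff)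
  define m where "m = Min ((\<lambda>k. k i) ` Poly_Mapping.keys f)"
  have "m \<in> (\<lambda>k. k i) ` Poly_Mapping.keys f" unfolding m_def using ne by (intro Min_in) auto
  then obtain k where k: "k \<in> Poly_Mapping.keys f" "k i = m" by auto
  define l where "l = (k(i := k i - int n))(i+1 := k (i+1) + int n)"
  have "Poly_Mapping.lookup f k = Poly_Mapping.lookup f l"
    by (subst fx[symmetric]) (simp add: lookup_Ypow l_def)
  then have "l \<in> Poly_Mapping.keys f" using k by (simp add: in_keys_iff)
  then have "m \<le> l i" unfolding m_def by (intro Min_le) auto
  moreover have "l i = m - int n" using k by (simp add: l_def)
  ultimately show False using n by simp
qed

lemma Yratio_eqI:
  assumes "n \<ge> 1" "Yratio n i g - g = Yratio n i h - h"
  shows "g = h"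
proof -
  have "Yratio n i (g - h) = g - h"
    using assms(2) by (simp add: lin_simps algebra_simps)
  then show ?thesis using Yratio_fixed[OF assms(1)] by fastforce
qed

definition agree_off :: "nat \<Rightarrow> (nat \<Rightarrow> int) \<Rightarrow> (nat \<Rightarrow> int) set" where
  "agree_off i k = {l. \<forall>j. j \<noteq> i \<and> j \<noteq> i+1 \<longrightarrow> l j = k j}"

text \<open>With x = Y_i/Y_{i+1} this divides x^t - 1 by x - 1, telescoping upwards and downwards
  from t = 0. The control of the support is what later shows that T_i preserves
  \<open>tensor_space N\<close>.\<close>

lemma Yratio_power_quotient:
  "\<exists>g \<in> bspan (agree_off i k). Yratio n i g - g = basis (k(i := k i + int n * t, i+1 := k (i+1) - int n * t)) - basis k"
proof (induct t rule: int_induct[of _ 0])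
  case base show ?case by (intro bexI[of _ 0]) (auto simp: lin_simps)
next
  case (step1 t)
  let ?b = "basis (k(i := k i + int n * t, i+1 := k (i+1) - int n * t))"
  from step1 obtain g where g: "g \<in> bspan (agree_off i k)"
    "Yratio n i g - g = ?b - basis k" by blast
  have "?b \<in> bspan (agree_off i k)" by (auto simp: agree_off_def intro: bspan_intros)
  moreover have "Yratio n i (g + ?b) - (g + ?b) =
    basis (k(i := k i + int n * (t+1), i+1 := k (i+1) - int n * (t+1))) - basis k"
  proof -
    have "Yratio n i ?b = basis (k(i := k i + int n * (t+1), i+1 := k (i+1) - int n * (t+1)))"
      by (simp add: algebra_simps fun_upd_twist)
    then show ?thesis using g(2) by (simp only: lin_add[OF lin_Ypow]) (simp add: algebra_simps)
  qed
  ultimately show ?case using g(1) by (meson bspan_add)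
next
  case (step2 t)
  let ?b = "basis (k(i := k i + int n * (t-1), i+1 := k (i+1) - int n * (t-1)))"
  from step2 obtain g where g: "g \<in> bspan (agree_off i k)"
    "Yratio n i g - g = basis (k(i := k i + int n * t, i+1 := k (i+1) - int n * t)) - basis k" by blast
  have "?b \<in> bspan (agree_off i k)" by (auto simp: agree_off_def intro: bspan_intros)
  moreover have "Yratio n i (g - ?b) - (g - ?b) = ?b - basis k"
  proof -
    have "Yratio n i ?b = basis (k(i := k i + int n * t, i+1 := k (i+1) - int n * t))"
      by (simp add: algebra_simps fun_upd_twist)
    then show ?thesis using g(2) by (simp only: lin_diff[OF lin_Ypow]) (simp add: algebra_simps)
  qed
  ultimately show ?case using g(1) by (meson bspan_diff)
qed

lemma ddiff_exists:
  assumes n: "n \<ge> 1"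
  shows "\<exists>D. lin D \<and> (\<forall>f. Yratio n i (D f) - D f = sY_op n i f - f) \<and> (\<forall>k. D (basis k) \<in> bspan (agree_off i k))"
proof -
  have "\<exists>g. g \<in> bspan (agree_off i k) \<and> Yratio n i g - g = sY_op n i (basis k) - basis k" for k
  proof -
    \<comment> \<open>For x = Y_i/Y_{i+1}, exchanging the two exponents multiplies the basis vector
      by x^t with this t.\<close>
    let ?t = "k (i+1) div int n - k i div int n"
    have 1: "k i + int n * ?t = int n * (k (i+1) div int n) + k i mod int n"
      and 2: "k (i+1) - int n * ?t = int n * (k i div int n) + k (i+1) mod int n"
      using mult_div_mod_eq[of "int n" "k i"] mult_div_mod_eq[of "int n" "k (i+1)"]
      unfolding right_diff_distrib by linarith+
    have "sY_op n i (basis k) = basis (k(i := k i + int n * ?t, i+1 := k (i+1) - int n * ?t))"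
      unfolding sY_basis 1 2 ..
    then show ?thesis using Yratio_power_quotient[of i k n ?t] by metis
  qed
  then obtain g where g: "\<And>k. g k \<in> bspan (agree_off i k)"
     "\<And>k. Yratio n i (g k) - g k = sY_op n i (basis k) - basis k" by metis
  have "Yratio n i (lin_ext g f) - lin_ext g f = sY_op n i f - f" for f
    by (rule lin_eqI[of "\<lambda>f. Yratio n i (lin_ext g f) - lin_ext g f" "\<lambda>f. sY_op n i f - f"])
       ((intro lin_intros lin_Ypow_comp lin_lin_ext lin_sY)+, simp only: lin_ext_basis g(2))
  then show ?thesis using g(1) by (intro exI[of _ "lin_ext g"]) auto
qed

lemma ddiff_unique:
  assumes "n \<ge> 1" "Yratio n i g - g = sY_op n i f - f"
  shows "ddiff_op n i f = g"
  unfolding ddiff_op_def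
  by (intro the_equality assms(2)) (metis Yratio_eqI assms)

lemma ddiff_props:
  assumes n: "n \<ge> 1"
  shows lin_ddiff: "lin (ddiff_op n i)"
    and Yratio_ddiff: "Yratio n i (ddiff_op n i f) - ddiff_op n i f = sY_op n i f - f"
    and ddiff_local: "ddiff_op n i (basis k) \<in> bspan (agree_off i k)"
proof -
  obtain D where D: "lin D" "\<And>f. Yratio n i (D f) - D f = sY_op n i f - f"
    "\<And>k. D (basis k) \<in> bspan (agree_off i k)" using ddiff_exists[OF n] by blast
  have "ddiff_op n i = D" using ddiff_unique[OF n] D(2) by blast
  with D show "lin (ddiff_op n i)" "Yratio n i (ddiff_op n i f) - ddiff_op n i f = sY_op n i f - f"
    "ddiff_op n i (basis k) \<in> bspan (agree_off i k)" by auto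
qed

text \<open>By uniqueness of the quotient, a linear map that commutes with s_i^Y and with
  Y_i/Y_{i+1} commutes with the divided difference.\<close>

lemma ddiff_commute:
  assumes n: "n \<ge> 1" and L: "lin L" and s: "\<And>f. L (sY_op n i f) = sY_op n i (L f)"
    and Y: "\<And>f. L (Yratio n i f) = Yratio n i (L f)"
  shows "ddiff_op n i (L f) = L (ddiff_op n i f)"
proof (rule ddiff_unique[OF n])
  have "Yratio n i (L (ddiff_op n i f)) - L (ddiff_op n i f) = L (Yratio n i (ddiff_op n i f) - ddiff_op n i f)"
    by (simp only: Y lin_diff[OF L])
  also have "\<dots> = sY_op n i (L f) - L f" by (simp only: Yratio_ddiff[OF n] s lin_diff[OF L])
  finally show "Yratio n i (L (ddiff_op n i f)) - L (ddiff_op n i f) = sY_op n i (L f) - L f" .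
qed

lemma ddiff_R: "n \<ge> 1 \<Longrightarrow> ddiff_op n i (R_op n v i f) = R_op n v i (ddiff_op n i f)"
  by (rule ddiff_commute) (simp_all add: sY_R R_Y)

lemma ddiff_Y:
  assumes n: "n \<ge> 1"
  shows "ddiff_op n i (Ypow_op n i 1 f) = Ypow_op n (i+1) 1 (ddiff_op n i f) - Ypow_op n (i+1) 1 f"
proof (rule ddiff_unique[OF n])
  let ?d = "ddiff_op n i f" let ?Y = "Ypow_op n (i+1) 1"
  have "Yratio n i (?Y ?d - ?Y f) - (?Y ?d - ?Y f) = ?Y (Yratio n i ?d - ?d) - (Ypow_op n i 1 f - ?Y f)"
    by (simp add: lin_simps Ypow_commute[of n "Suc i" 1 i] Ypow_add)
  also have "\<dots> = sY_op n i (Ypow_op n i 1 f) - Ypow_op n i 1 f"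
    unfolding Yratio_ddiff[OF n] by (simp add: lin_simps sY_Y[OF n])
  finally show "Yratio n i (?Y ?d - ?Y f) - (?Y ?d - ?Y f) = sY_op n i (Ypow_op n i 1 f) - Ypow_op n i 1 f" .
qed

lemma ddiff_Y':
  assumes n: "n \<ge> 1"
  shows "ddiff_op n i (Ypow_op n (i+1) 1 f) = Ypow_op n i 1 (ddiff_op n i f) + Ypow_op n (i+1) 1 f"
proof (rule ddiff_unique[OF n])
  let ?d = "ddiff_op n i f" let ?Y = "Ypow_op n (i+1) 1"
  have "Yratio n i (Ypow_op n i 1 ?d + ?Y f) - (Ypow_op n i 1 ?d + ?Y f)
      = Ypow_op n i 1 (Yratio n i ?d - ?d) + (Ypow_op n i 1 f - ?Y f)"
    by (simp add: lin_simps Ypow_commute[of n "Suc i" "-1" i] Ypow_add)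
  also have "\<dots> = sY_op n i (?Y f) - ?Y f"
    unfolding Yratio_ddiff[OF n] by (simp add: lin_simps sY_Y'[OF n])
  finally show "Yratio n i (Ypow_op n i 1 ?d + ?Y f) - (Ypow_op n i 1 ?d + ?Y f) = sY_op n i (?Y f) - ?Y f" .
qed

text \<open>Write s for s_i^Y, x = Y_i/Y_{i+1} and D = (s - 1)/(x - 1). Since s sends x to x^-1, s D
  = x D = D + s - 1. The proof checks this after multiplication by x - 1.\<close>

lemma sY_ddiff:
  assumes n: "n \<ge> 1"
  shows "sY_op n i (ddiff_op n i f) = ddiff_op n i f + sY_op n i f - f"
proof (rule Yratio_eqI[OF n])
  let ?d = "ddiff_op n i f"
  let ?h = "sY_op n i ?d"
  have "Ypow_op n (i+1) 1 (Ypow_op n i (-1) ?h) - ?h = sY_op n i (Yratio n i ?d - ?d)"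
    by (simp add: lin_simps sY_Y[OF n] sY_Y'[OF n])
  also have "\<dots> = f - sY_op n i f" unfolding Yratio_ddiff[OF n] by (simp add: lin_simps sY_sY[OF n])
  finally have "Yratio n i (Ypow_op n (i+1) 1 (Ypow_op n i (-1) ?h) - ?h) = Yratio n i (f - sY_op n i f)" by simp
  then have "?h - Yratio n i ?h = Yratio n i f - Yratio n i (sY_op n i f)"
    by (simp add: lin_simps Ypow_commute[of n "Suc i" "-1" i] Ypow_add)
  then have "Yratio n i ?h - ?h = Yratio n i (sY_op n i f) - Yratio n i f"
    by (metis minus_diff_eq)
  moreover have "Yratio n i (?d + sY_op n i f - f) - (?d + sY_op n i f - f)
     = (Yratio n i ?d - ?d) + (Yratio n i (sY_op n i f) - Yratio n i f) - (sY_op n i f - f)"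
    by (simp add: lin_simps)
  ultimately show "Yratio n i ?h - ?h = Yratio n i (?d + sY_op n i f - f) - (?d + sY_op n i f - f)"
    unfolding Yratio_ddiff[OF n] by simp
qed

lemma ddiff_sY:
  assumes n: "n \<ge> 1"
  shows "ddiff_op n i (sY_op n i f) = - ddiff_op n i f"
  using Yratio_ddiff[OF n, of i f]
  by (intro ddiff_unique[OF n]) (simp add: lin_simps sY_sY[OF n] algebra_simps)

text \<open>By \<open>sY_ddiff\<close>, (s - 1) D f = (s - 1) f, so f and D f have the same quotient
  by x - 1.\<close>

lemma ddiff_ddiff:
  assumes n: "n \<ge> 1"
  shows "ddiff_op n i (ddiff_op n i f) = ddiff_op n i f"
  by (intro ddiff_unique[OF n]) (simp only: Yratio_ddiff[OF n] sY_ddiff[OF n], simp)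

section \<open>The quadratic relation and the relations with the Y_i\<close>

lemma lin_T: "n \<ge> 1 \<Longrightarrow> lin (T_op n v i)"
  unfolding T_op_def[abs_def] by (intro lin_intros lin_sY_comp lin_R lin_ddiff)

lemma lin_T_comp: "n \<ge> 1 \<Longrightarrow> lin L \<Longrightarrow> lin (\<lambda>f. T_op n v i (L f))"
  by (rule lin_comp[OF lin_T])

text \<open>With c = v - v^-1 and D the divided difference, T = s R + c D. The cross terms c (s R D
  + D s R) equal c (s R - R), and their part - c R cancels the c R in R^2 = c R + 1.\<close>

lemma T_quadratic:
  assumes n: "n \<ge> 1" and v: "v \<noteq> 0"
  shows "T_op n v i (T_op n v i f) = scale (v - inverse v) (T_op n v i f) + f"
proof -
  note l = lin_simps[OF lin_ddiff[OF n, of i]]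
  show ?thesis unfolding T_op_def
    by (simp add: lin_simps l sY_R[OF n, symmetric] sY_sY[OF n] R_R[OF n v] ddiff_ddiff[OF n]
      sY_ddiff[OF n] ddiff_sY[OF n] ddiff_R[OF n] scale_add scale_diff scale_minus)
     (simp add: lin_simps l sY_R[OF n] sY_sY[OF n] R_R[OF n v] 
      sY_ddiff[OF n] scale_add scale_diff scale_minus)
qed

text \<open>The right-hand side is Y_{i+1} T_i^-1, because T_i - (v - v^-1) is the inverse of
  T_i.\<close>

lemma T_Y: "n \<ge> 1 \<Longrightarrow> T_op n v i (Ypow_op n i 1 f) =
    Ypow_op n (i+1) 1 (T_op n v i f) - scale (v - inverse v) (Ypow_op n (i+1) 1 f)"
  unfolding T_op_def by (simp add: lin_simps R_Y sY_Y ddiff_Y scale_diff)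

lemma T_Y': "n \<ge> 1 \<Longrightarrow> T_op n v i (Ypow_op n (i+1) 1 f) =
    Ypow_op n i 1 (T_op n v i f) + scale (v - inverse v) (Ypow_op n (i+1) 1 f)"
  unfolding T_op_def using ddiff_Y'[of n i f] by (simp add: lin_simps R_Y sY_Y' scale_add)

lemma T_Y_far:
  assumes n: "n \<ge> 1" and l: "l \<noteq> i" "l \<noteq> i + 1"
  shows "T_op n v i (Ypow_op n l j f) = Ypow_op n l j (T_op n v i f)"
proof -
  have "ddiff_op n i (Ypow_op n l j f) = Ypow_op n l j (ddiff_op n i f)"
    by (rule ddiff_commute) (use l n in \<open>simp_all add: sY_Y_far Ypow_commute[of n l j]\<close>)
  then show ?thesis unfolding T_op_def using n l by (simp add: lin_simps R_Y sY_Y_far)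
qed

lemma T_Y_T: "n \<ge> 1 \<Longrightarrow> v \<noteq> 0 \<Longrightarrow> T_op n v i (Ypow_op n i 1 (T_op n v i f)) = Ypow_op n (i+1) 1 f"
  by (simp add: T_Y T_quadratic lin_simps)

lemma T_YY:
  assumes n: "n \<ge> 1"
  shows "T_op n v i (Ypow_op n i 1 (Ypow_op n (i+1) 1 f)) = Ypow_op n i 1 (Ypow_op n (i+1) 1 (T_op n v i f))"
  by (simp only: T_Y[OF n] T_Y'[OF n]) (simp add: lin_simps Ypow_commute[of n "Suc i" 1 i])

lemma T_YY_inv:
  assumes n: "n \<ge> 1"
  shows "T_op n v i (Ypow_op n i (-1) (Ypow_op n (i+1) (-1) f)) = Ypow_op n i (-1) (Ypow_op n (i+1) (-1) (T_op n v i f))"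
proof -
  let ?g = "Ypow_op n i (-1) (Ypow_op n (i+1) (-1) f)"
  have "T_op n v i f = T_op n v i (Ypow_op n i 1 (Ypow_op n (i+1) 1 ?g))"
    by (simp add: Ypow_commute[of n "Suc i" 1 i] Ypow_add)
  also have "\<dots> = Ypow_op n i 1 (Ypow_op n (i+1) 1 (T_op n v i ?g))" by (rule T_YY[OF n])
  finally show ?thesis by (simp add: Ypow_commute[of n "Suc i" "-1" i] Ypow_add)
qed

lemma sY_local: "sY_op n i (basis k) \<in> bspan (agree_off i k)"
  by (auto simp: sY_basis agree_off_def intro: bspan_intros)

lemma R_local: "n \<ge> 1 \<Longrightarrow> R_op n v i (basis k) \<in> bspan (agree_off i k)"
  by (auto simp: R_basis swap_comp_def agree_off_def intro!: bspan_intros)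

lemma T_local:
  assumes n: "n \<ge> 1"
  shows "T_op n v i (basis k) \<in> bspan (agree_off i k)"
proof -
  have "sY_op n i (R_op n v i (basis k)) \<in> bspan (agree_off i k)"
  proof (rule lin_bspan[OF lin_sY R_local[OF n]])
    fix l assume "l \<in> agree_off i k"
    then have "agree_off i l = agree_off i k" by (auto simp: agree_off_def)
    then show "sY_op n i (basis l) \<in> bspan (agree_off i k)" using sY_local[of n i l] by simp
  qed
  then show ?thesis unfolding T_op_def by (intro bspan_add bspan_scale ddiff_local[OF n])
qed

lemma T_far_commute:
  assumes n: "n \<ge> 1" and ij: "j \<noteq> i" "j \<noteq> i + 1" "i \<noteq> j + 1"
  shows "T_op n v i (T_op n v j f) = T_op n v j (T_op n v i f)"
proof -
  have ss: "sY_op n i (sY_op n j f) = sY_op n j (sY_op n i f)" for f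
    by (rule lin_eqI[of "\<lambda>f. sY_op n i (sY_op n j f)"])
       (use ij in \<open>auto intro!: lin_intros arg_cong[of _ _ basis] simp: sY_basis fun_eq_iff\<close>)
  have sR: "sY_op n i (R_op n v j f) = R_op n v j (sY_op n i f)"
    if "j \<noteq> i" "j \<noteq> i + 1" "i \<noteq> j + 1" for f i j
    by (rule lin_eqI[of "\<lambda>f. sY_op n i (R_op n v j f)"])
       (use that in \<open>auto intro!: lin_intros arg_cong[of _ _ basis] simp: R_basis[OF n] lin_simps swap_comp_def sY_basis fun_eq_iff\<close>)
  have RR: "R_op n v i (R_op n v j f) = R_op n v j (R_op n v i f)" for f
    by (rule lin_eqI[of "\<lambda>f. R_op n v i (R_op n v j f)"])
       (use ij in \<open>auto intro!: lin_intros arg_cong[of _ _ basis] simp: R_basis[OF n] lin_simps scale_add swap_comp_def fun_eq_iff mult.commute\<close>)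
  have sd: "ddiff_op n j (sY_op n i f) = sY_op n i (ddiff_op n j f)"
    if "j \<noteq> i" "j \<noteq> i + 1" "i \<noteq> j + 1" "\<And>f. sY_op n i (sY_op n j f) = sY_op n j (sY_op n i f)" for f i j
    by (rule ddiff_commute[OF n]) (use that n in \<open>simp_all add: sY_Y_far\<close>)
  have Rd: "ddiff_op n j (R_op n v i f) = R_op n v i (ddiff_op n j f)"
    if "j \<noteq> i" "j \<noteq> i + 1" "i \<noteq> j + 1" for f i j
    by (rule ddiff_commute[OF n]) (use that n in \<open>simp_all add: R_Y sR\<close>)
  have Yd: "ddiff_op n j (Ypow_op n l e f) = Ypow_op n l e (ddiff_op n j f)"
    if "j \<noteq> l" "l \<noteq> j + 1" for f l e
    by (rule ddiff_commute[OF n]) (use that n in \<open>simp_all add: Ypow_commute[of n l] sY_Y_far\<close>)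
  have dd: "ddiff_op n i (ddiff_op n j f) = ddiff_op n j (ddiff_op n i f)" for f
    by (rule ddiff_commute[OF n]) (use ij n in \<open>simp_all add: lin_ddiff sd ss Yd\<close>)
  note l = lin_simps[OF lin_ddiff[OF n, of i]] lin_simps[OF lin_ddiff[OF n, of j]]
  show ?thesis unfolding T_op_def
    using ij by (simp add: lin_simps l ss sR[symmetric] RR sd Rd dd scale_add mult.commute)
qed

section \<open>The braid relation\<close>

lemma T_window:
  assumes n: "n \<ge> 1" and d: "k i div int n = k (i+1) div int n"
  shows "T_op n v i (basis k) = (if k i = k (i+1) then scale v (basis k)
     else basis (swap_at i k) + (if k i < k (i+1) then scale (v - inverse v) (basis k) else 0))"
proof -
  have eq: "k j = int n * (k j div int n) + k j mod int n" for j by simp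
  have sw: "swap_comp n i k = swap_at i k" using d by (simp add: swap_comp_def swap_at_def fun_upd_twist) (metis mult_div_mod_eq)
  have lt: "k i mod int n < k (i+1) mod int n \<longleftrightarrow> k i < k (i+1)"
    using eq[of i] eq[of "i+1"] unfolding d by linarith
  have e: "k i mod int n = k (i+1) mod int n \<longleftrightarrow> k i = k (i+1)"
    using eq[of i] eq[of "i+1"] unfolding d by linarith
  have s: "sY_op n i (basis k) = basis k" "sY_op n i (basis (swap_at i k)) = basis (swap_at i k)"
    using d by (auto simp: sY_basis swap_at_def fun_eq_iff intro!: arg_cong[of _ _ basis]) (metis mult_div_mod_eq)+
  \<comment> \<open>For equal exponents s_i^Y fixes the vector, so the divided difference vanishes
    and only R is left.\<close>
  have dd: "ddiff_op n i (basis k) = 0" by (rule ddiff_unique[OF n]) (simp add: s lin_simps)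
  show ?thesis unfolding T_op_def R_basis[OF n] lt e sw dd by (auto simp: lin_simps s)
qed

text \<open>Stability under T_i and T_{i+1} follows from the quadratic relation and extends to their
  inverses \<open>T'\<close> and \<open>U'\<close>. Y_{i+1} and Y_{i+2} are obtained from Y_i by
  multiplication with T's on both sides. Negative exponents are reached through the inverse of Y_i
  Y_{i+1} Y_{i+2}, which commutes with both operators.\<close>

lemma T_braid_closed:
  fixes n i :: nat and v :: complex
  assumes n: "n \<ge> 1" and v: "v \<noteq> 0"
  defines "P \<equiv> \<lambda>f. T_op n v i (T_op n v (i+1) (T_op n v i f)) = T_op n v (i+1) (T_op n v i (T_op n v (i+1) f))"
  shows T_braid_add: "P f \<Longrightarrow> P g \<Longrightarrow> P (f + g)" and T_braid_scale: "P f \<Longrightarrow> P (scale c f)"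
    and T_braid_T: "P f \<Longrightarrow> P (T_op n v i f)" and T_braid_T': "P f \<Longrightarrow> P (T_op n v (i+1) f)"
    and T_braid_Y: "P f \<Longrightarrow> P (Ypow_op n i 1 f)" and T_braid_Y': "P f \<Longrightarrow> P (Ypow_op n (i+1) 1 f)"
    and T_braid_Y'': "P f \<Longrightarrow> P (Ypow_op n (i+2) 1 f)"
    and T_braid_inv: "P f \<Longrightarrow> P (Ypow_op n i (-1) (Ypow_op n (i+1) (-1) (Ypow_op n (i+2) (-1) f)))"
proof -
  let ?T = "T_op n v i" let ?U = "T_op n v (i+1)" let ?c = "v - inverse v"
  note lT = lin_simps[OF lin_T[OF n, of v i]] note lU = lin_simps[OF lin_T[OF n, of v "i+1"]]
  have TT: "?T (?T f) = scale ?c (?T f) + f" for f by (rule T_quadratic[OF n v])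
  have UU: "?U (?U f) = scale ?c (?U f) + f" for f by (rule T_quadratic[OF n v])
  have Padd: "P (f + g)" if "P f" "P g" for f g using that unfolding P_def by (simp only: lT lU)
  have Pscale: "P (scale c f)" if "P f" for c f using that unfolding P_def by (simp only: lT lU)
  have PT: "P (?T f)" if "P f" for f
    using that unfolding P_def by (simp only: TT UU lT lU)
  have PU: "P (?U f)" if "P f" for f
  proof -
    have e: "?T (?U (?T (?U f))) = scale ?c (?T (?U (?T f))) + ?U (?T f)"
      using TT[of "?U (?T f)"] that[unfolded P_def] by simp
    show ?thesis unfolding P_def by (simp only: UU lT lU e that[unfolded P_def])
  qed
  define T' where "T' = (\<lambda>f. ?T f - scale ?c f)"
  define U' where "U' = (\<lambda>f. ?U f - scale ?c f)"
  have inv: "?T (T' f) = f" "T' (?T f) = f" "?U (U' f) = f" "U' (?U f) = f" for f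
    by (simp_all add: T'_def U'_def TT[simplified] UU[simplified] lT[simplified] lU[simplified])
  have minus: "f - g = f + scale (-1) g" for f g by (simp add: scale_minus_left)
  have PT': "P (T' f)" if "P f" for f unfolding T'_def minus by (intro Padd PT Pscale that)
  have PU': "P (U' f)" if "P f" for f unfolding U'_def minus by (intro Padd PU Pscale that)
  have TY: "?T (Ypow_op n i 1 f) = Ypow_op n (i+1) 1 (T' f)" for f
    unfolding T'_def by (simp only: T_Y[OF n] lin_simps[OF lin_Ypow])
  have UY: "?U (Ypow_op n (i+1) 1 f) = Ypow_op n (i+2) 1 (U' f)" for f
    unfolding U'_def using T_Y[OF n, of v "i+1" f] by (simp add: lin_simps)
  have TY3: "?T (Ypow_op n (i+2) j f) = Ypow_op n (i+2) j (?T f)" for j f by (rule T_Y_far[OF n]) auto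
  have UY1: "?U (Ypow_op n i j f) = Ypow_op n i j (?U f)" for j f by (rule T_Y_far[OF n]) auto
  have PY: "P (Ypow_op n i 1 f)" if "P f" for f
  proof -
    \<comment> \<open>On Y_i f the two sides of the braid relation are Y_{i+2} times
      \<open>T_op n v i (U' (T' f))\<close> and Y_{i+2} times
      \<open>U' (T' (T_op n v (i+1) f))\<close>. Writing f as T_i T_{i+1} h turns their equality
      into the braid relation at h.\<close>
    define h where "h = U' (T' f)"
    have f: "f = ?T (?U h)" by (simp only: h_def inv)
    have "P h" unfolding h_def by (intro PT' PU' that)
    have "?T (U' (T' f)) = U' (T' (?U f))"
      by (simp only: f inv) (metis \<open>P h\<close> P_def inv)
    then show ?thesis unfolding P_def by (simp only: TY UY TY3 UY1)
  qed
  have TYT: "Ypow_op n (i+1) 1 f = ?T (Ypow_op n i 1 (?T f))" for f by (simp only: T_Y_T[OF n v])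
  have UYU: "Ypow_op n (i+2) 1 f = ?U (Ypow_op n (i+1) 1 (?U f))" for f
    using T_Y_T[OF n v, of "i+1" f] by simp
  have PY': "P (Ypow_op n (i+1) 1 f)" if "P f" for f unfolding TYT by (intro PT PY that)
  have PY'': "P (Ypow_op n (i+2) 1 f)" if "P f" for f unfolding UYU by (intro PU PY' that)
  let ?Z = "\<lambda>f. Ypow_op n i (-1) (Ypow_op n (i+1) (-1) (Ypow_op n (i+2) (-1) f))"
  have TZ: "?T (?Z f) = ?Z (?T f)" for f by (simp only: T_YY_inv[OF n] TY3)
  have UZ: "?U (?Z f) = ?Z (?U f)" for f
    using T_YY_inv[OF n, of v "i+1" f] by (simp add: UY1[simplified])
  show "P f \<Longrightarrow> P g \<Longrightarrow> P (f + g)" "P f \<Longrightarrow> P (scale c f)" "P f \<Longrightarrow> P (T_op n v i f)"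
    "P f \<Longrightarrow> P (T_op n v (i+1) f)" "P f \<Longrightarrow> P (Ypow_op n i 1 f)"
    "P f \<Longrightarrow> P (Ypow_op n (i+1) 1 f)" "P f \<Longrightarrow> P (Ypow_op n (i+2) 1 f)"
    by (fact Padd Pscale PT PU PY PY' PY'')+
  show "P f \<Longrightarrow> P (?Z f)" unfolding P_def by (simp only: TZ UZ)
qed

lemma T_braid_window:
  assumes n: "n \<ge> 1" and v: "v \<noteq> 0"
    and d: "k i div int n = 0" "k (i+1) div int n = 0" "k (i+2) div int n = 0"
  shows "T_op n v i (T_op n v (i+1) (T_op n v i (basis k)))
       = T_op n v (i+1) (T_op n v i (T_op n v (i+1) (basis k)))"
proof -
  define x y z where xyz: "x = k i" "y = k (i+1)" "z = k (i+2)"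
  define b where "b = (\<lambda>x y z. basis (k(i := x, i+1 := y, i+2 := z)))"
  have T: "T_op n v i (b x y z) = (if x = y then scale v (b x y z)
     else b y x z + (if x < y then scale (v - inverse v) (b x y z) else 0))"
    if "x div int n = 0" "y div int n = 0" "z div int n = 0" for x y z
    unfolding b_def using that
    by (subst T_window[OF n]) (auto simp: swap_at_def fun_upd_twist)
  have U: "T_op n v (i+1) (b x y z) = (if y = z then scale v (b x y z)
     else b x z y + (if y < z then scale (v - inverse v) (b x y z) else 0))"
    if "x div int n = 0" "y div int n = 0" "z div int n = 0" for x y z
    unfolding b_def using that
    by (subst T_window[OF n]) (auto simp: swap_at_def fun_upd_twist)
  have bk: "basis k = b x y z" by (simp add: b_def xyz fun_upd_idem_iff)
  have d: "x div int n = 0" "y div int n = 0" "z div int n = 0" using d by (simp_all add: xyz)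
  \<comment> \<open>With c = v - v^-1 treated as an atom, the case check needs v^2 = v c + 1 and its
    multiple v^2 c = v c^2 + c.\<close>
  have sc: "scale (v * v) f = scale (v * (v - inverse v)) f + f" for f
    unfolding right_diff_distrib using v by (simp add: scale_diff_left)
  have "v * (v * (v - inverse v)) = v * ((v - inverse v) * (v - inverse v)) + (v - inverse v)"
    using v by (simp add: field_simps)
  then have sc2: "scale (v * (v * (v - inverse v))) f
      = scale (v * ((v - inverse v) * (v - inverse v))) f + scale (v - inverse v) f" for f
    by (metis scale_add_left)
  define Ti Ui where TU: "Ti = T_op n v i" "Ui = T_op n v (i+1)"
  note l = lin_simps[OF lin_T[OF n, of v i], folded TU] lin_simps[OF lin_T[OF n, of v "i+1"], folded TU]
  note T = T[folded TU] and U = U[folded TU]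
  show ?thesis unfolding bk TU[symmetric] using d
    by (cases x y rule: linorder_cases; cases y z rule: linorder_cases; cases x z rule: linorder_cases)
       (simp_all add: T U l scale_add sc sc2 mult.commute mult.left_commute add_ac)
qed

text \<open>Nonnegative exponents are stripped off one Y_j at a time until only a constant is left.
  An index with negative exponents is the image of a raised one under the inverse of Y_i Y_{i+1}
  Y_{i+2}.\<close>

lemma T_braid:
  assumes n: "n \<ge> 1" and v: "v \<noteq> 0"
  shows "T_op n v i (T_op n v (i+1) (T_op n v i f)) = T_op n v (i+1) (T_op n v i (T_op n v (i+1) f))"
proof (rule lin_eqI[of "\<lambda>f. T_op n v i (T_op n v (i+1) (T_op n v i f))"])
  let ?P = "\<lambda>f. T_op n v i (T_op n v (i+1) (T_op n v i f)) = T_op n v (i+1) (T_op n v i (T_op n v (i+1) f))"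
  note cl = T_braid_closed[OF n v, of i]
  have nonneg: "?P (basis k)" if "k i div int n \<ge> 0" "k (i+1) div int n \<ge> 0" "k (i+2) div int n \<ge> 0" for k
    using that
  proof (induct "nat (k i div int n + k (i+1) div int n + k (i+2) div int n)" arbitrary: k rule: less_induct)
    case less
    have n0: "int n \<noteq> 0" using n by simp
    have down: "(a - int n) div int n = a div int n - 1" for a
      using div_mult_self2[OF n0, of a "-1"] by simp
    have step: "?P (basis k)" if j: "j \<in> {i, i+1, i+2}" and pos: "k j div int n > 0" for j
    proof -
      let ?k = "k(j := k j - int n)"
      have "?P (basis ?k)"
        using less.prems j pos n0 by (intro less.hyps) (auto simp: down)
      then have "?P (Ypow_op n j 1 (basis ?k))" using j cl(5)[of "basis ?k"] cl(6)[of "basis ?k"] cl(7)[of "basis ?k"] by auto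
      then show ?thesis by simp
    qed
    show ?case
    proof (cases "k i div int n > 0 \<or> k (i+1) div int n > 0 \<or> k (i+2) div int n > 0")
      case True then show ?thesis using step by blast
    next
      case False then show ?thesis using less.prems by (intro T_braid_window[OF n v]) auto
    qed
  qed
  have "?P (basis k)" if "m \<ge> 0" "k i div int n \<ge> - int m" "k (i+1) div int n \<ge> - int m" "k (i+2) div int n \<ge> - int m" for k m
    using that
  proof (induct m arbitrary: k)
    case 0 then show ?case by (intro nonneg) auto
  next
    case (Suc m)
    have n0: "int n \<noteq> 0" using n by simp
    have up: "(a + int n) div int n = a div int n + 1" for a using n0 by simp
    let ?k = "k(i := k i + int n, i+1 := k (i+1) + int n, i+2 := k (i+2) + int n)"
    have "?P (basis ?k)" by (rule Suc.hyps) (use Suc.prems up in auto)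
    from cl(8)[OF this] show ?case by (simp add: fun_upd_twist fun_upd_idem_iff)
  qed
  note neg = this
  show "?P (basis k)" for k
    by (rule neg[of "nat (\<bar>k i div int n\<bar> + \<bar>k (i+1) div int n\<bar> + \<bar>k (i+2) div int n\<bar>)"]) auto
qed (intro lin_T_comp lin_T n)+

section \<open>The operator \<open>\<pi>\<close> and leading terms of \<open>T\<^sub>i\<close>\<close>

text \<open>Both changed entries keep their residue modulo n and lie strictly between k i and k
  (i+1). These are the indices that the divided difference contributes besides k and its
  swap.\<close>

definition T_inner :: "nat \<Rightarrow> nat \<Rightarrow> (nat \<Rightarrow> int) \<Rightarrow> (nat \<Rightarrow> int) set" where
  "T_inner n i k = {k(i := k i + int n * j, i+1 := k (i+1) - int n * j) |j.
     (j \<ge> 1 \<and> k i + int n * j < k (i+1)) \<or> (j \<le> -1 \<and> k i + int n * j > k (i+1))}"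

lemma T_innerI:
  "(j \<ge> 1 \<and> k i + int n * j < k (i+1)) \<or> (j \<le> -1 \<and> k i + int n * j > k (i+1)) \<Longrightarrow>
   l = k(i := k i + int n * j, i+1 := k (i+1) - int n * j) \<Longrightarrow> l \<in> T_inner n i k"
  unfolding T_inner_def by blast

lemma T_inner_empty:
  assumes "n \<ge> 1" "\<bar>k i - k (i+1)\<bar> \<le> int n" shows "T_inner n i k = {}"
proof -
  have False if "j \<ge> 1 \<and> k i + int n * j < k (i+1)" for j
  proof -
    have "int n * 1 \<le> int n * j" using that by (intro mult_left_mono) auto
    then show False using that assms by linarith
  qed
  moreover have False if "j \<le> -1 \<and> k i + int n * j > k (i+1)" for j
  proof -
    have "int n * j \<le> int n * (-1)" using that by (intro mult_left_mono) auto
    then show False using that assms by linarith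
  qed
  ultimately show ?thesis unfolding T_inner_def by blast
qed

lemma div_minus_self: "n \<ge> 1 \<Longrightarrow> (a - int n) div int n = a div int n - 1"
  using div_mult_self2[of "int n" a "-1"] by simp

text \<open>Induction on the distance of the two exponents: if they differ, the vector is Y_i or
  Y_{i+1} times one at smaller distance, and \<open>T_Y\<close> or \<open>T_Y'\<close> transports
  the formula. The base case is the action of R.\<close>

lemma T_formula:
  assumes n: "n \<ge> 1" and v: "v \<noteq> 0"
  shows "\<exists>\<gamma>. \<gamma> \<noteq> 0 \<and> (\<not> int n dvd k i - k (i+1) \<longrightarrow> \<gamma> = 1) \<and> (k i = k (i+1) \<longrightarrow> \<gamma> = v) \<and>
    (\<exists>r \<in> bspan (T_inner n i k). T_op n v i (basis k) = scale \<gamma> (basis (swap_at i k)) +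
      (if k i < k (i+1) then scale (v - inverse v) (basis k) else 0) + r)"
    (is "?P k")
proof (induct "nat \<bar>k i div int n - k (i+1) div int n\<bar>" arbitrary: k rule: less_induct)
  case less
  let ?c = "v - inverse v"
  consider "k i div int n = k (i+1) div int n" | "k (i+1) div int n < k i div int n"
    | "k i div int n < k (i+1) div int n" by linarith
  then show ?case
  proof cases
    case 1
    have s: "swap_at i k = k" if "k i = k (i+1)" using that by (auto simp: swap_at_def fun_eq_iff)
    have "0 \<in> bspan (T_inner n i k)" by simp
    then show ?thesis unfolding T_window[OF n 1] using v s
      by (cases "k i = k (i+1)") (force intro!: exI[of _ v], force intro!: exI[of _ 1])
  next
    case 2
    have xy: "k i > k (i+1)" using 2 n zdiv_mono1[of "k i" "k (i+1)" "int n"] by linarith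
    define k' where "k' = k(i := k i - int n)"
    have k': "k' i = k i - int n" "k' (i+1) = k (i+1)" by (auto simp: k'_def)
    note k' = k' k'[simplified]
    have "?P k'" using 2 by (intro less.hyps) (simp add: k' div_minus_self[OF n])
    then obtain g r where g: "g \<noteq> 0" "\<not> int n dvd k' i - k' (i+1) \<Longrightarrow> g = 1" "k' i = k' (i+1) \<Longrightarrow> g = v"
      and r: "r \<in> bspan (T_inner n i k')"
      and T: "T_op n v i (basis k') = scale g (basis (swap_at i k')) + (if k' i < k' (i+1) then scale ?c (basis k') else 0) + r"
      by blast
    have dvd: "int n dvd k' i - k' (i+1) \<longleftrightarrow> int n dvd k i - k (i+1)"
    proof -
      have "k' i - k' (i+1) = (k i - k (i+1)) + int n * (-1)" by (simp add: k')
      then show ?thesis by (metis dvd_add_times_triv_right_iff mult.commute)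
    qed
    have "basis k = Ypow_op n i 1 (basis k')" by (simp add: k'_def)
    then have Tk: "T_op n v i (basis k) = Ypow_op n (i+1) 1 (T_op n v i (basis k')) - scale ?c (Ypow_op n (i+1) 1 (basis k'))"
      by (simp only: T_Y[OF n])
    have sw: "Ypow_op n (i+1) 1 (basis (swap_at i k')) = basis (swap_at i k)"
      by (simp add: swap_at_def k'_def fun_upd_twist)
    have rr: "Ypow_op n (i+1) 1 r \<in> bspan (T_inner n i k)"
    proof (rule lin_bspan[OF lin_Ypow r])
      fix l assume "l \<in> T_inner n i k'"
      then obtain j where l: "l = k'(i := k' i + int n * j, i+1 := k' (i+1) - int n * j)"
        and j: "(j \<ge> 1 \<and> k' i + int n * j < k' (i+1)) \<or> (j \<le> -1 \<and> k' i + int n * j > k' (i+1))"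
        unfolding T_inner_def by blast
      have "l(i+1 := l (i+1) + int n * 1) \<in> T_inner n i k"
      proof (rule T_innerI[of "j - 1"])
        show "(j - 1 \<ge> 1 \<and> k i + int n * (j-1) < k (i+1)) \<or> (j - 1 \<le> -1 \<and> k i + int n * (j-1) > k (i+1))"
        proof -
          have e: "int n * (j-1) = int n * j - int n" by (simp add: algebra_simps)
          have "int n * 1 \<le> int n * j" if "j \<ge> 1" using that by (intro mult_left_mono) auto
          then have "\<not> j \<ge> 1" using j xy unfolding k' by linarith
          then show ?thesis using j unfolding e k' by linarith
        qed
        show "l(i+1 := l (i+1) + int n * 1) = k(i := k i + int n * (j-1), i+1 := k (i+1) - int n * (j-1))"
          by (auto simp: l k'_def algebra_simps)
      qed
      then show "Ypow_op n (i+1) 1 (basis l) \<in> bspan (T_inner n i k)" by (simp add: bspan_basis)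
    qed
    show ?thesis
    proof (cases "k' i = k' (i+1)")
      case True
      \<comment> \<open>Here k i = k (i+1) + n, and the coefficient v of the equal case becomes v -
        (v - v^-1) = v^-1.\<close>
      have "swap_at i k' = k'" using True by (auto simp: swap_at_def fun_eq_iff)
      then have "T_op n v i (basis k) = scale (inverse v) (basis (swap_at i k)) + Ypow_op n (i+1) 1 r"
        unfolding Tk T using True g(3) sw
        by (simp add: lin_simps scale_diff_left algebra_simps)
      moreover have "int n dvd k i - k (i+1)" "k i \<noteq> k (i+1)" using dvd True xy by auto
      ultimately show ?thesis using rr xy v by (intro exI[of _ "inverse v"]) auto
    next
      case ne: False
      show ?thesis
      proof (cases "k' i < k' (i+1)")
        case True
        then have "T_op n v i (basis k) = scale g (basis (swap_at i k)) + Ypow_op n (i+1) 1 r"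
          unfolding Tk T using sw by (simp add: lin_simps)
        then show ?thesis using rr xy g dvd by (intro exI[of _ g]) auto
      next
        case False
        \<comment> \<open>The extra term of \<open>T_Y\<close> is the inner term with j = -1. In the
          case before, it cancelled the diagonal term of k'.\<close>
        have "basis (k'(i+1 := k' (i+1) + int n)) \<in> bspan (T_inner n i k)"
          using ne False by (intro bspan_basis T_innerI[of "-1"]) (auto simp: k'_def)
        then have "Ypow_op n (i+1) 1 r - scale ?c (Ypow_op n (i+1) 1 (basis k')) \<in> bspan (T_inner n i k)"
          using rr by (auto intro!: bspan_diff bspan_scale)
        moreover have "T_op n v i (basis k) = scale g (basis (swap_at i k)) + (Ypow_op n (i+1) 1 r - scale ?c (Ypow_op n (i+1) 1 (basis k')))"
          unfolding Tk T using sw False by (simp add: lin_simps)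
        ultimately show ?thesis using xy g dvd by (intro exI[of _ g]) auto
      qed
    qed
  next
    case 3
    have xy: "k i < k (i+1)" using 3 n zdiv_mono1[of "k (i+1)" "k i" "int n"] by linarith
    define k' where "k' = k(i+1 := k (i+1) - int n)"
    have k': "k' i = k i" "k' (i+1) = k (i+1) - int n" by (auto simp: k'_def)
    note k' = k' k'[simplified]
    have "?P k'" using 3 by (intro less.hyps) (simp add: k' div_minus_self[OF n])
    then obtain g r where g: "g \<noteq> 0" "\<not> int n dvd k' i - k' (i+1) \<Longrightarrow> g = 1" "k' i = k' (i+1) \<Longrightarrow> g = v"
      and r: "r \<in> bspan (T_inner n i k')"
      and T: "T_op n v i (basis k') = scale g (basis (swap_at i k')) + (if k' i < k' (i+1) then scale ?c (basis k') else 0) + r"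
      by blast
    have dvd: "int n dvd k' i - k' (i+1) \<longleftrightarrow> int n dvd k i - k (i+1)"
    proof -
      have "k' i - k' (i+1) = (k i - k (i+1)) + int n * 1" by (simp add: k')
      then show ?thesis by (metis dvd_add_times_triv_right_iff mult.commute)
    qed
    have bk: "basis k = Ypow_op n (i+1) 1 (basis k')" by (simp add: k'_def)
    then have Tk: "T_op n v i (basis k) = Ypow_op n i 1 (T_op n v i (basis k')) + scale ?c (basis k)"
      by (simp only: T_Y'[OF n])
    have sw: "Ypow_op n i 1 (basis (swap_at i k')) = basis (swap_at i k)"
      by (simp add: swap_at_def k'_def fun_upd_twist)
    have rr: "Ypow_op n i 1 r \<in> bspan (T_inner n i k)"
    proof (rule lin_bspan[OF lin_Ypow r])
      fix l assume "l \<in> T_inner n i k'"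
      then obtain j where l: "l = k'(i := k' i + int n * j, i+1 := k' (i+1) - int n * j)"
        and j: "(j \<ge> 1 \<and> k' i + int n * j < k' (i+1)) \<or> (j \<le> -1 \<and> k' i + int n * j > k' (i+1))"
        unfolding T_inner_def by blast
      have "l(i := l i + int n * 1) \<in> T_inner n i k"
      proof (rule T_innerI[of "j + 1"])
        show "(j + 1 \<ge> 1 \<and> k i + int n * (j+1) < k (i+1)) \<or> (j + 1 \<le> -1 \<and> k i + int n * (j+1) > k (i+1))"
        proof -
          have e: "int n * (j+1) = int n * j + int n" by (simp add: algebra_simps)
          have "int n * j \<le> int n * (-1)" if "j \<le> -1" using that by (intro mult_left_mono) auto
          then have "\<not> j \<le> -1" using j xy unfolding k' by linarith
          then show ?thesis using j unfolding e k' by linarith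
        qed
        show "l(i := l i + int n * 1) = k(i := k i + int n * (j+1), i+1 := k (i+1) - int n * (j+1))"
          by (auto simp: l k'_def algebra_simps fun_eq_iff)
      qed
      then show "Ypow_op n i 1 (basis l) \<in> bspan (T_inner n i k)" by (simp add: bspan_basis)
    qed
    show ?thesis
    proof (cases "k' i < k' (i+1)")
      case False
      have "T_op n v i (basis k) = scale g (basis (swap_at i k)) + scale ?c (basis k) + Ypow_op n i 1 r"
        unfolding Tk T using False sw by (simp add: lin_simps)
      then show ?thesis using rr xy g dvd by (intro exI[of _ g]) auto
    next
      case True
      have "basis (k'(i := k' i + int n)) \<in> bspan (T_inner n i k)"
        using True by (intro bspan_basis T_innerI[of "1"]) (auto simp: k'_def fun_eq_iff)
      then have "Ypow_op n i 1 r + scale ?c (Ypow_op n i 1 (basis k')) \<in> bspan (T_inner n i k)"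
        using rr by (auto intro!: bspan_add bspan_scale)
      moreover have "T_op n v i (basis k) = scale g (basis (swap_at i k)) + scale ?c (basis k) + (Ypow_op n i 1 r + scale ?c (Ypow_op n i 1 (basis k')))"
        unfolding Tk T using sw True by (simp add: lin_simps)
      ultimately show ?thesis using xy g dvd by (intro exI[of _ g]) auto
    qed
  qed
qed

lemma T_near:
  assumes n: "n \<ge> 1" and v: "v \<noteq> 0" and near: "\<bar>k i - k (i+1)\<bar> < int n"
  shows "T_op n v i (basis k) = (if k i = k (i+1) then scale v (basis k)
     else basis (swap_at i k) + (if k i < k (i+1) then scale (v - inverse v) (basis k) else 0))"
proof -
  obtain g r where g: "\<not> int n dvd k i - k (i+1) \<Longrightarrow> g = 1" "k i = k (i+1) \<Longrightarrow> g = v"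
      and r: "r \<in> bspan (T_inner n i k)"
      and T: "T_op n v i (basis k) = scale g (basis (swap_at i k)) + (if k i < k (i+1) then scale (v - inverse v) (basis k) else 0) + r"
    using T_formula[OF n v, of k i] by blast
  have r0: "r = 0" using r T_inner_empty[OF n, of k i] near by simp
  show ?thesis
  proof (cases "k i = k (i+1)")
    case True
    moreover have "swap_at i k = k" using True by (auto simp: swap_at_def fun_eq_iff)
    ultimately show ?thesis using T g r0 by simp
  next
    case False
    then have "\<not> int n dvd k i - k (i+1)" using near dvd_imp_le_int[of "k i - k (i+1)" "int n"] by linarith
    then show ?thesis using T g r0 False by simp
  qed
qed

section \<open>The operator pi and its relations\<close>

definition rot :: "nat \<Rightarrow> (nat \<Rightarrow> int) \<Rightarrow> nat \<Rightarrow> int" where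
  "rot N k = (\<lambda>j. if j = 1 then k N else if 2 \<le> j \<and> j \<le> N then k (j - 1) else k j)"

lemma s_op_basis: "s_op i (basis k) = basis (swap_at i k)"
  by (simp add: s_op_def swap_at_def)

lemma foldr_s_op:
  assumes "a \<le> N"
  shows "foldr (\<circ>) (map s_op [a..<N]) id (basis k)
    = basis (\<lambda>j. if j = a then k N else if a < j \<and> j \<le> N then k (j - 1) else k j)"
  using assms
proof (induct a rule: inc_induct)
  case base show ?case by (auto intro!: arg_cong[of _ _ basis])
next
  case (step a)
  have e: "[a..<N] = a # [Suc a..<N]" using step by (simp add: upt_conv_Cons)
  have "swap_at a (\<lambda>j. if j = Suc a then k N else if Suc a < j \<and> j \<le> N then k (j - 1) else k j)
      = (\<lambda>j. if j = a then k N else if a < j \<and> j \<le> N then k (j - 1) else k j)"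
    using step by (auto simp: swap_at_def fun_eq_iff)
  moreover have "foldr (\<circ>) (map s_op [a..<N]) id (basis k) = s_op a (foldr (\<circ>) (map s_op [Suc a..<N]) id (basis k))"
    unfolding e by simp
  ultimately show ?case by (simp only: step.hyps(3) s_op_basis)
qed

locale daha_params =
  fixes n n' N :: nat and q v :: complex and u :: "nat \<Rightarrow> complex"
  assumes n: "n \<ge> 1" and N: "N \<ge> 1" and q: "q \<noteq> 0" and v: "v \<noteq> 0" and u: "a < n \<Longrightarrow> u a \<noteq> 0"
begin

abbreviation "T \<equiv> T_op n v"
abbreviation "Y i \<equiv> Ypow_op n i 1"
abbreviation "Yi i \<equiv> Ypow_op n i (-1)"
abbreviation "PiM \<equiv> Pi_op N n n' q u"
abbreviation "cc \<equiv> v - inverse v"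

text \<open>The eigenvalue of D on e_x.\<close>

definition Pi_coeff :: "int \<Rightarrow> complex" where
  "Pi_coeff x = u (nat (x mod int n)) * q powi (x div int n)"

lemma Pi_coeff_nz: "Pi_coeff x \<noteq> 0"
proof -
  have "nat (x mod int n) < n" using n by (simp add: nat_less_iff)
  then show ?thesis unfolding Pi_coeff_def using u q by simp
qed

lemma Pi_coeff_add_n: "Pi_coeff (x + int n) = q * Pi_coeff x"
  unfolding Pi_coeff_def using n q by (simp add: power_int_add)

lemma lin_T' [simp]: "lin (T i)" by (rule lin_T[OF n])
lemma lin_Pi [simp]: "lin PiM"
proof -
  have "lin (kappa_op 1 ^^ n')" by (intro lin_pow) (simp add: kappa_op_def)
  moreover have "lin (D_op n q u 1)" by (simp add: D_op_def)
  moreover have "lin (foldr (\<circ>) (map s_op [1..<N]) id)" by (intro lin_foldr) (simp add: s_op_def)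
  ultimately show ?thesis unfolding Pi_op_def by (auto simp: lin_def o_def)
qed

lemma kappa_pow: "(kappa_op i ^^ m) (basis k) = basis (k(i := k i - int m))"
  by (induct m) (auto simp: kappa_op_def algebra_simps fun_eq_iff intro!: arg_cong[of _ _ basis])

lemma lin_kappa_pow: "lin (kappa_op i ^^ m)"
  by (intro lin_pow) (simp add: kappa_op_def)

lemma Pi_basis: "PiM (basis k) = scale (Pi_coeff (k N)) (basis ((rot N k)(1 := k N - int n')))"
proof -
  have r: "foldr (\<circ>) (map s_op [1..<N]) id (basis k) = basis (rot N k)"
    using foldr_s_op[of 1 N k] N by (auto simp: rot_def intro!: arg_cong[of _ _ basis])
  have "D_op n q u 1 (basis (rot N k)) = scale (Pi_coeff (k N)) (basis (rot N k))"
    by (simp add: D_op_def Pi_coeff_def rot_def)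
  then show ?thesis unfolding Pi_op_def o_apply r
    by (simp add: lin_scale[OF lin_kappa_pow] kappa_pow rot_def)
qed

definition rotinv :: "(nat \<Rightarrow> int) \<Rightarrow> nat \<Rightarrow> int" where
  "rotinv k = (\<lambda>j. if j = N then k 1 + int n' else if 1 \<le> j \<and> j < N then k (j + 1) else k j)"

definition PiM_inv :: "tensor \<Rightarrow> tensor" where
  "PiM_inv = lin_ext (\<lambda>k. scale (inverse (Pi_coeff (k 1 + int n'))) (basis (rotinv k)))"

lemma lin_PiInv [simp]: "lin PiM_inv" by (simp add: PiM_inv_def)

lemma PiInv_basis: "PiM_inv (basis k) = scale (inverse (Pi_coeff (k 1 + int n'))) (basis (rotinv k))"
  by (simp add: PiM_inv_def)

lemma rotinv_rot: "rotinv ((rot N k)(1 := k N - int n')) = k"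
  using N by (auto simp: rotinv_def rot_def fun_eq_iff)

lemma rot_rotinv: "(rot N (rotinv k))(1 := rotinv k N - int n') = k"
  using N by (auto simp: rotinv_def rot_def fun_eq_iff)

lemma PiInv_Pi [simp]: "PiM_inv (PiM f) = f"
  by (rule lin_eqI[of "\<lambda>f. PiM_inv (PiM f)" "\<lambda>f. f"])
     (auto intro: lin_id lin_comp[OF lin_PiInv lin_Pi] simp: Pi_basis PiInv_basis lin_simps rotinv_rot[simplified] Pi_coeff_nz)

lemma Pi_PiInv [simp]: "PiM (PiM_inv f) = f"
proof (rule lin_eqI[of "\<lambda>f. PiM (PiM_inv f)" "\<lambda>f. f"])
  fix k
  have "rotinv k N = k 1 + int n'" by (simp add: rotinv_def)
  then show "PiM (PiM_inv (basis k)) = basis k"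
    unfolding PiInv_basis lin_scale[OF lin_Pi] Pi_basis rot_rotinv by (simp add: Pi_coeff_nz)
qed (auto intro: lin_id lin_comp[OF lin_Pi lin_PiInv])

lemma Pi_Y:
  assumes "i \<in> {1..N}"
  shows "PiM (Y i f) = scale (if i = N then q else 1) (Y (if i = N then 1 else i + 1) (PiM f))"
proof (rule lin_eqI[of "\<lambda>f. PiM (Y i f)" "\<lambda>f. scale (if i = N then q else 1) (Y (if i = N then 1 else i + 1) (PiM f))"])
  fix k
  show "PiM (Y i (basis k)) = scale (if i = N then q else 1) (Y (if i = N then 1 else i + 1) (PiM (basis k)))"
    using assms by (auto simp: Pi_basis lin_simps Pi_coeff_add_n rot_def fun_eq_iff intro!: arg_cong[of _ _ basis] arg_cong2[of _ _ _ _ scale])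
qed (intro lin_intros lin_Ypow_comp lin_comp[OF lin_Pi lin_Ypow] lin_Pi)+

lemma Pi_inverse_Y: "i \<in> {1..N} \<Longrightarrow>
    PiM (Y i (PiM_inv f)) = scale (if i = N then q else 1) (Y (if i = N then 1 else i + 1) f)"
  by (simp add: Pi_Y)

lemma Pi_Yi:
  assumes "i \<in> {1..<N}"
  shows "PiM (Yi i f) = Yi (i + 1) (PiM f)"
proof -
  have "PiM f = Y (i+1) (PiM (Yi i f))" using Pi_Y[of i "Yi i f"] assms by simp
  then show ?thesis by (metis Ypow_inv(1))
qed

text \<open>pi relabels the factors i, i+1 as i+1, i+2, and its scalar depends on the last factor
  alone, which T_i does not touch because i + 1 < N.\<close>

lemma Pi_T:
  assumes i: "i \<in> {1..<N}" "i + 1 \<in> {1..<N}"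
  shows "PiM (T i f) = T (i+1) (PiM f)"
proof -
  have Py: "PiM (Ypow_op n i 1 f) = Ypow_op n (Suc i) 1 (PiM f)"
    "PiM (Ypow_op n (Suc i) (-1) f) = Ypow_op n (Suc (Suc i)) (-1) (PiM f)" for f
    using Pi_Y[of i f] Pi_Yi[of "i+1" f] i by auto
  have ru: "(rot N (k(i := a, i+1 := b)))(1 := c) = ((rot N k)(1 := c))(i+1 := a, i+1+1 := b)" for a b c k
    using i by (auto simp: rot_def fun_eq_iff)
  have r1: "((rot N k)(1 := c)) (i+1) = k i" "((rot N k)(1 := c)) (i+1+1) = k (i+1)"
    "(k(i := a, i+1 := b)) N = k N" for a b c k
    using i by (auto simp: rot_def)
  have Ps: "PiM (sY_op n i f) = sY_op n (i+1) (PiM f)" for f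
    by (rule lin_eqI[of "\<lambda>f. PiM (sY_op n i f)"])
       ((intro lin_comp[OF lin_Pi lin_sY] lin_sY_comp lin_Pi)+,
        simp only: Pi_basis sY_basis lin_scale[OF lin_sY] r1 ru)
  have rots: "(rot N (swap_comp n i k))(1 := k N - int n') = swap_comp n (i+1) ((rot N k)(1 := k N - int n'))" for k
    using i by (auto simp: rot_def swap_comp_def fun_eq_iff)
  have PR: "PiM (R_op n v i f) = R_op n v (i+1) (PiM f)" for f
  proof (rule lin_eqI[of "\<lambda>f. PiM (R_op n v i f)"])
    fix k
    have 1: "((rot N k)(1 := k N - int n')) (i+1) = k i" "((rot N k)(1 := k N - int n')) (i+1+1) = k (i+1)"
       "swap_comp n i k N = k N"
      using i by (auto simp: rot_def swap_comp_def)
    show "PiM (R_op n v i (basis k)) = R_op n v (i+1) (PiM (basis k))"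
      unfolding Pi_basis R_basis[OF n] lin_scale[OF lin_R] 1
      by (auto simp: Pi_basis lin_simps 1 rots[simplified] scale_add mult.commute simp flip: Suc_eq_plus1)
  qed (auto intro: lin_comp[OF lin_Pi lin_R] lin_R_comp)
  have Pd: "PiM (ddiff_op n i f) = ddiff_op n (i+1) (PiM f)"
  proof (rule ddiff_unique[OF n, symmetric])
    have "Yratio n (i+1) (PiM (ddiff_op n i f)) - PiM (ddiff_op n i f) = PiM (Yratio n i (ddiff_op n i f) - ddiff_op n i f)"
      by (simp add: lin_simps Py)
    also have "\<dots> = sY_op n (i+1) (PiM f) - PiM f" by (simp only: Yratio_ddiff[OF n] lin_diff[OF lin_Pi] Ps)
    finally show "Yratio n (i+1) (PiM (ddiff_op n i f)) - PiM (ddiff_op n i f) = sY_op n (i+1) (PiM f) - PiM f" .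
  qed
  show ?thesis unfolding T_op_def by (simp only: lin_simps[OF lin_Pi] Ps PR Pd)
qed

lemma Pi_pow_basis:
  "m \<le> N \<Longrightarrow> (PiM ^^ m) (basis k) = scale (\<Prod>j\<in>{N-m<..N}. Pi_coeff (k j))
     (basis (\<lambda>j. if 1 \<le> j \<and> j \<le> m then k (N - m + j) - int n' else if m < j \<and> j \<le> N then k (j - m) else k j))"
proof (induct m)
  case 0 then show ?case by (auto intro!: arg_cong[of _ _ basis])
next
  case (Suc m)
  let ?k = "\<lambda>j. if 1 \<le> j \<and> j \<le> m then k (N - m + j) - int n' else if m < j \<and> j \<le> N then k (j - m) else k j"
  have "{N - Suc m<..N} = insert (N - m) {N-m<..N}" using Suc.prems by auto
  then have pr: "(\<Prod>j\<in>{N - Suc m<..N}. Pi_coeff (k j)) = Pi_coeff (k (N - m)) * (\<Prod>j\<in>{N-m<..N}. Pi_coeff (k j))" by simp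
  have kN: "?k N = k (N - m)" using Suc.prems by auto
  have "(rot N ?k)(1 := k (N-m) - int n') = (\<lambda>j. if 1 \<le> j \<and> j \<le> Suc m then k (N - Suc m + j) - int n'
      else if Suc m < j \<and> j \<le> N then k (j - Suc m) else k j)"
  proof
    fix j
    consider "j = 0" | "j = 1" | "2 \<le> j" "j \<le> Suc m" | "Suc m < j" "j \<le> N" "j \<ge> 2" | "j > N" "j \<ge> 2" by linarith
    then show "((rot N ?k)(1 := k (N-m) - int n')) j = (if 1 \<le> j \<and> j \<le> Suc m then k (N - Suc m + j) - int n'
      else if Suc m < j \<and> j \<le> N then k (j - Suc m) else k j)"
      by cases (use Suc.prems in \<open>auto simp: rot_def intro!: arg_cong[of _ _ k]\<close>)
  qed
  then have "PiM (basis ?k) = scale (Pi_coeff (k (N - m))) (basis (\<lambda>j. if 1 \<le> j \<and> j \<le> Suc m then k (N - Suc m + j) - int n'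
      else if Suc m < j \<and> j \<le> N then k (j - Suc m) else k j))"
    unfolding Pi_basis kN by simp
  then show ?case using Suc by (simp add: lin_simps pr mult.commute)
qed

text \<open>pi^N shifts every index by -n' and so mixes exponents with components in C^n; it need
  not respect s_i^Y and R separately. But \<open>T_near\<close> depends only on the difference of
  the two indices. Larger differences are reduced by stripping Y_i or Y_{i+1}, with which pi^N
  commutes up to the factor q.\<close>

lemma Pi_powN_T:
  assumes i: "i \<in> {1..<N}"
  shows "(PiM ^^ N) (T i f) = T i ((PiM ^^ N) f)"
proof -
  define Q where "Q = PiM ^^ N"
  define h where "h = (\<lambda>k::nat \<Rightarrow> int. \<lambda>j. if 1 \<le> j \<and> j \<le> N then k j - int n' else k j)"
  define C where "C = (\<lambda>k::nat \<Rightarrow> int. \<Prod>j\<in>{1..N}. Pi_coeff (k j))"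
  have linQ: "lin Q" unfolding Q_def by (rule lin_pow[OF lin_Pi])
  have Qb: "Q (basis k) = scale (C k) (basis (h k))" for k
  proof -
    have "{N-N<..N} = {1..N}" by auto
    moreover have "(\<lambda>j. if 1 \<le> j \<and> j \<le> N then k (N - N + j) - int n'
       else if N < j \<and> j \<le> N then k (j - N) else k j) = h k"
      by (auto simp: h_def fun_eq_iff)
    ultimately show ?thesis unfolding Q_def C_def Pi_pow_basis[OF order_refl] by simp
  qed
  have QY: "Q (Y j f) = scale q (Y j (Q f))" if j: "j \<in> {1..N}" for j f
  proof (rule lin_eqI[of "\<lambda>f. Q (Y j f)" "\<lambda>f. scale q (Y j (Q f))"])
    fix k
    have "C (k(j := k j + int n)) = q * C k"
      unfolding C_def using j by (subst (1 2) prod.remove[of _ j]) (auto simp: Pi_coeff_add_n intro!: prod.cong)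
    moreover have "h (k(j := k j + int n)) = (h k)(j := h k j + int n)" using j by (auto simp: h_def)
    ultimately show "Q (Y j (basis k)) = scale q (Y j (Q (basis k)))" by (simp add: Qb lin_simps)
  qed (intro lin_intros lin_comp[OF linQ lin_Ypow] lin_Ypow_comp linQ)+
  have stepY: "Q (T i (Y i g)) = T i (Q (Y i g))" if "Q (T i g) = T i (Q g)" for g
    using i that by (simp add: T_Y[OF n] lin_simps lin_simps[OF linQ] QY scale_diff mult.commute)
  have stepY': "Q (T i (Y (i+1) g)) = T i (Q (Y (i+1) g))" if "Q (T i g) = T i (Q g)" for g
    using i that by (simp add: T_Y'[OF n, simplified] lin_simps lin_simps[OF linQ] QY scale_add mult.commute)
  have "Q (T i (basis k)) = T i (Q (basis k))" for k
  proof (induct "nat \<bar>k i - k (i+1)\<bar>" arbitrary: k rule: less_induct)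
    case less
    consider "\<bar>k i - k (i+1)\<bar> < int n" | "k i - k (i+1) \<ge> int n" | "k (i+1) - k i \<ge> int n" by linarith
    then show ?case
    proof cases
      case 1
      have h: "h k i = k i - int n'" "h k (i+1) = k (i+1) - int n'" "h (swap_at i k) = swap_at i (h k)"
        using i by (auto simp: h_def swap_at_def fun_eq_iff)
      have "C (swap_at i k) = C k"
      proof -
        have "{1..N} = insert i (insert (i+1) ({1..N} - {i,i+1}))" using i by auto
        then have e: "C k' = Pi_coeff (k' i) * Pi_coeff (k' (i+1)) * (\<Prod>j\<in>{1..N} - {i,i+1}. Pi_coeff (k' j))" for k'
          unfolding C_def by (metis (no_types, lifting) Diff_iff finite_Diff finite_atLeastAtMost finite_insert insertCI insertE mult.assoc n_not_Suc_n prod.insert Suc_eq_plus1)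
        show ?thesis unfolding e by (auto simp: swap_at_def intro!: prod.cong)
      qed
      moreover have "\<bar>h k i - h k (i+1)\<bar> < int n" using 1 h by simp
      ultimately show ?thesis using T_near[OF n v 1] T_near[OF n v, of "h k" i] h
        by (simp add: Qb lin_simps linQ lin_simps[OF linQ] scale_add mult.commute)
    next
      case 2
      let ?k = "k(i := k i - int n)"
      have IH: "Q (T i (basis ?k)) = T i (Q (basis ?k))" by (rule less) (use 2 n in auto)
      have "basis k = Y i (basis ?k)" by simp
      then show ?thesis using stepY[OF IH] by simp
    next
      case 3
      let ?k = "k(i+1 := k (i+1) - int n)"
      have IH: "Q (T i (basis ?k)) = T i (Q (basis ?k))" by (rule less) (use 3 n in auto)
      have "basis k = Y (i+1) (basis ?k)" by simp
      then show ?thesis using stepY'[OF IH] by simp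
    qed
  qed
  then have "Q (T i f) = T i (Q f)"
    by (rule lin_eqI[of "\<lambda>f. Q (T i f)", rotated 2]) (auto intro: lin_comp[OF linQ lin_T'] lin_comp[OF lin_T' linQ])
  then show ?thesis by (simp add: Q_def)
qed

end

section \<open>The free algebra and its quotient\<close>

definition car :: "'g set \<Rightarrow> 'g free_poly set" where
  "car A = {p. Poly_Mapping.keys p \<subseteq> lists A}"

lemma car_zero: "0 \<in> car A" by (simp add: car_def)

lemma car_one: "1 \<in> car A" by (simp add: zero_list_def car_def)

lemma car_add: "p \<in> car A \<Longrightarrow> r \<in> car A \<Longrightarrow> p + r \<in> car A"
  using Poly_Mapping.keys_add[of p r] by (auto simp: car_def)

lemma car_uminus: "p \<in> car A \<Longrightarrow> - p \<in> car A"
  by (auto simp: in_keys_iff subset_iff car_def)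

lemma car_diff: "p \<in> car A \<Longrightarrow> r \<in> car A \<Longrightarrow> p - r \<in> car A"
  using car_add[of p A "- r"] car_uminus by auto

lemma car_mult: "p \<in> car A \<Longrightarrow> r \<in> car A \<Longrightarrow> p * r \<in> car A"
  using keys_mult[of p r] by (fastforce simp: plus_list_def car_def)

lemma car_power: "p \<in> car A \<Longrightarrow> p ^ k \<in> car A"
  by (induct k) (simp_all add: car_one car_mult)

lemma car_single: "w \<in> lists A \<Longrightarrow> Poly_Mapping.single w c \<in> car A"
  by (cases "c = 0") (auto simp: car_def)

lemmas car_intros = car_zero car_one car_add car_uminus car_diff car_mult car_power

lemma free_alg_simps [simp]:
  "carrier (free_alg A) = car A" "x \<otimes>\<^bsub>free_alg A\<^esub> y = x * y" "\<one>\<^bsub>free_alg A\<^esub> = 1"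
  "\<zero>\<^bsub>free_alg A\<^esub> = 0" "x \<oplus>\<^bsub>free_alg A\<^esub> y = x + y"
  by (simp_all add: free_alg_def car_def)

lemma ring_free_alg: "ring (free_alg A)"
proof (rule ringI)
  show "abelian_group (free_alg A)"
  proof (rule abelian_groupI)
    fix x assume "x \<in> carrier (free_alg A)"
    then show "\<exists>y\<in>carrier (free_alg A). y \<oplus>\<^bsub>free_alg A\<^esub> x = \<zero>\<^bsub>free_alg A\<^esub>"
      using car_uminus[of x A] by (intro bexI[of _ "- x"]) (simp_all only: free_alg_simps, simp)
  qed (simp_all only: free_alg_simps car_intros add_ac add_0_left add_0_right)
  show "monoid (free_alg A)"
    by (rule monoidI) (simp_all only: free_alg_simps car_intros mult.assoc mult_1_left mult_1_right)
qed (simp_all only: free_alg_simps distrib_left distrib_right)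

lemma free_alg_minus: "x \<in> car A \<Longrightarrow> \<ominus>\<^bsub>free_alg A\<^esub> x = - x"
proof -
  assume x: "x \<in> car A"
  interpret ring "free_alg A" by (rule ring_free_alg)
  show ?thesis by (rule minus_equality) (use x car_uminus[OF x] in \<open>simp_all only: free_alg_simps add.left_inverse\<close>)
qed

lemma cp_mult: "cp c * p = p * cp c"
proof -
  have "Poly_Mapping.single [] c * Poly_Mapping.single w d = Poly_Mapping.single w d * Poly_Mapping.single [] c" for w d
    by (simp add: mult_single plus_list_def mult.commute)
  note this[simp]
  show ?thesis by (induct p rule: pm_induct) (simp_all add: distrib_left distrib_right)
qed

lemma cp_add: "cp (c + d) = cp c + cp d" by (rule single_add)
lemma cp_times: "cp (c * d) = cp c * cp d" by (simp add: mult_single plus_list_def)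
lemma cp_one: "cp 1 = 1" by (metis single_one zero_list_def)
lemma cp_uminus: "cp (- c) = - cp c" by (rule single_uminus)
lemma cp_minus: "cp (c - d) = cp c - cp d" by (rule single_diff)

lemma gp_mult_single: "gp g * Poly_Mapping.single w c = Poly_Mapping.single (g # w) c"
  by (simp add: mult_single plus_list_def)

section \<open>The quotient algebra\<close>

context
  fixes N :: nat and q v :: complex
begin

lemma gp_car: "g \<in> gens N \<Longrightarrow> gp g \<in> car (gens N)"
  and cp_car: "cp c \<in> car (gens N)"
  by (rule car_single; simp)+

lemma gens_simps [simp]: "TG i \<in> gens N \<longleftrightarrow> i \<in> {1..<N}" "PiG \<in> gens N" "PiInvG \<in> gens N"
  "YG i \<in> gens N \<longleftrightarrow> i \<in> {1..N}" "YInvG i \<in> gens N \<longleftrightarrow> i \<in> {1..N}"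
  by (auto simp: gens_def)

lemma daha_rels_car: "daha_rels N q v \<subseteq> car (gens N)"
  unfolding daha_rels_def
  by (auto intro!: car_intros gp_car cp_car)

lemma daha_rels_mem:
  "gp PiG * gp PiInvG - 1 \<in> daha_rels N q v" "gp PiInvG * gp PiG - 1 \<in> daha_rels N q v"
  "i \<in> {1..N} \<Longrightarrow> gp (YG i) * gp (YInvG i) - 1 \<in> daha_rels N q v"
  "i \<in> {1..N} \<Longrightarrow> gp (YInvG i) * gp (YG i) - 1 \<in> daha_rels N q v"
  "l \<in> {1..<N} \<Longrightarrow> (gp (TG l) - cp v) * (gp (TG l) + cp (inverse v)) \<in> daha_rels N q v"
  "l \<in> {1..<N} \<Longrightarrow> gp (TG l) * gp (YG l) * gp (TG l) - gp (YG (l+1)) \<in> daha_rels N q v"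
  "l \<in> {1..<N} \<Longrightarrow> j \<in> {1..N} \<Longrightarrow> j \<noteq> l \<Longrightarrow> j \<noteq> l + 1 \<Longrightarrow>
     gp (TG l) * gp (YG j) - gp (YG j) * gp (TG l) \<in> daha_rels N q v"
  "i \<in> {1..N} \<Longrightarrow> j \<in> {1..N} \<Longrightarrow> gp (YG i) * gp (YG j) - gp (YG j) * gp (YG i) \<in> daha_rels N q v"
  "i \<in> {1..N} \<Longrightarrow> gp PiG * gp (YG i) * gp PiInvG
        - cp (if i = N then q else 1) * gp (YG (if i = N then 1 else i + 1)) \<in> daha_rels N q v"
  unfolding daha_rels_def Un_iff mem_Collect_eq
  by ((rule disjI1)+, rule insertI1)
     ((rule disjI1)+, rule insertI2, rule singletonI,
      metis, metis, metis, metis, metis, metis, metis)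

lemma ideal_daha: "ideal (daha_ideal N q v) (free_alg (gens N))"
  unfolding daha_ideal_def by (intro ring.genideal_ideal ring_free_alg) (simp only: free_alg_simps daha_rels_car)

lemma ring_daha: "ring (daha N q v)"
  unfolding daha_def by (rule ideal.quotient_is_ring[OF ideal_daha])

lemma class_hom: "daha_class N q v \<in> ring_hom (free_alg (gens N)) (daha N q v)"
proof -
  have "daha_class N q v = (+>\<^bsub>free_alg (gens N)\<^esub>) (daha_ideal N q v)"
    by (rule ext) (simp add: daha_class_def)
  then show ?thesis unfolding daha_def using ideal.rcos_ring_hom[OF ideal_daha] by simp
qed

lemma class_add: "p \<in> car (gens N) \<Longrightarrow> r \<in> car (gens N) \<Longrightarrow>
    daha_class N q v (p + r) = daha_class N q v p \<oplus>\<^bsub>daha N q v\<^esub> daha_class N q v r"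
  using ring_hom_add[OF class_hom, of p r] by (simp only: free_alg_simps)

lemma class_mult: "p \<in> car (gens N) \<Longrightarrow> r \<in> car (gens N) \<Longrightarrow>
    daha_class N q v (p * r) = daha_class N q v p \<otimes>\<^bsub>daha N q v\<^esub> daha_class N q v r"
  using ring_hom_mult[OF class_hom, of p r] by (simp only: free_alg_simps)

lemma class_one: "daha_class N q v 1 = \<one>\<^bsub>daha N q v\<^esub>"
  using ring_hom_one[OF class_hom] by (simp only: free_alg_simps)

lemma class_closed: "p \<in> car (gens N) \<Longrightarrow> daha_class N q v p \<in> carrier (daha N q v)"
  using ring_hom_closed[OF class_hom, of p] by (simp only: free_alg_simps)

lemma carrier_daha: "carrier (daha N q v) = daha_class N q v ` car (gens N)"
  by (auto simp: daha_def FactRing_def A_RCOSETS_def' daha_class_def)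

lemma class_eq_iff:
  assumes "p \<in> car (gens N)" "r \<in> car (gens N)"
  shows "daha_class N q v p = daha_class N q v r \<longleftrightarrow> p - r \<in> daha_ideal N q v"
proof -
  have "p \<ominus>\<^bsub>free_alg (gens N)\<^esub> r = p - r"
    using free_alg_minus[OF assms(2)] by (simp add: a_minus_def)
  then show ?thesis unfolding daha_class_def
    using ring.quotient_eq_iff_same_a_r_cos[OF ring_free_alg ideal_daha, of p r] assms
    by (simp only: free_alg_simps)
qed

lemma rels_in_ideal: "daha_rels N q v \<subseteq> daha_ideal N q v"
  unfolding daha_ideal_def by (intro ring.genideal_self ring_free_alg) (simp only: free_alg_simps daha_rels_car)

lemma class_relI: "p \<in> car (gens N) \<Longrightarrow> r \<in> car (gens N) \<Longrightarrow> p - r \<in> daha_rels N q v \<Longrightarrow>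
    daha_class N q v p = daha_class N q v r"
  using rels_in_ideal by (auto simp only: class_eq_iff)

lemma dT_closed: "i \<in> {1..<N} \<Longrightarrow> dT N q v i \<in> carrier (daha N q v)"
  and dPi_closed: "dPi N q v \<in> carrier (daha N q v)"
  and dY_closed: "i \<in> {1..N} \<Longrightarrow> dY N q v i \<in> carrier (daha N q v)"
  and scal_closed: "scal N q v c \<in> carrier (daha N q v)"
  unfolding dT_def dPi_def dY_def scal_def by (auto intro!: class_closed gp_car cp_car)

end

context daha_params
begin

abbreviation "Fc \<equiv> car (gens N)"
abbreviation "H \<equiv> daha N q v"
abbreviation "cl \<equiv> daha_class N q v"

section \<open>Evaluation of noncommutative polynomials on tensors\<close>

definition gop :: "gen \<Rightarrow> tensor \<Rightarrow> tensor" where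
  "gop g = (case g of TG i \<Rightarrow> T i | PiG \<Rightarrow> PiM | PiInvG \<Rightarrow> PiM_inv | YG i \<Rightarrow> Y i | YInvG i \<Rightarrow> Yi i)"

definition evalp :: "gen free_poly \<Rightarrow> tensor \<Rightarrow> tensor" where
  "evalp p f = pm_ext (\<lambda>w. foldr gop w f) p"

lemma lin_gop: "lin (gop g)"
  by (cases g) (simp_all add: gop_def)

lemma lin_word: "lin (\<lambda>f. foldr gop w f)"
  by (induct w) (auto intro: lin_id lin_comp[OF lin_gop])

lemma evalp_add [simp]: "evalp (p + r) f = evalp p f + evalp r f"
  and evalp_zero [simp]: "evalp 0 f = 0"
  and evalp_single: "evalp (Poly_Mapping.single w c) f = scale c (foldr gop w f)"
  by (simp_all add: evalp_def)

lemma evalp_uminus [simp]: "evalp (- p) f = - evalp p f"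
  using evalp_add[of p "- p" f] by (simp add: eq_neg_iff_add_eq_0 add.commute del: evalp_add)

lemma evalp_diff [simp]: "evalp (p - r) f = evalp p f - evalp r f"
  using evalp_add[of p "- r" f] by simp

lemma lin_evalp: "lin (evalp p)"
proof (induct p rule: pm_induct)
  case zero show ?case using lin_const_zero by (simp add: evalp_def)
next
  case (single w c)
  have "evalp (Poly_Mapping.single w c) = (\<lambda>f. scale c (foldr gop w f))" by (simp add: evalp_single fun_eq_iff)
  then show ?case using lin_smult[OF lin_word] by simp
next
  case (add p r)
  have "evalp (p + r) = (\<lambda>f. evalp p f + evalp r f)" by (simp add: fun_eq_iff)
  then show ?case using lin_plus[OF add] by simp
qed

lemma evalp_mult [simp]: "evalp (p * r) f = evalp p (evalp r f)"
proof (induct p rule: pm_induct)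
  case (single w c)
  show ?case
  proof (induct r rule: pm_induct)
    case (single w' c')
    show ?case by (simp add: mult_single plus_list_def evalp_single lin_scale[OF lin_word])
  qed (simp_all add: distrib_left lin_add[OF lin_evalp] lin_zero[OF lin_evalp])
qed (simp_all add: distrib_right)

lemma evalp_gp: "evalp (gp g) f = gop g f" and evalp_cp [simp]: "evalp (cp c) f = scale c f"
  by (simp_all add: evalp_single)

lemma evalp_one [simp]: "evalp 1 f = f"
  using evalp_cp[of 1] by (simp add: cp_one)

lemma evalp_gens [simp]: "evalp (gp (TG i)) = T i" "evalp (gp PiG) = PiM" "evalp (gp PiInvG) = PiM_inv"
  "evalp (gp (YG i)) = Y i" "evalp (gp (YInvG i)) = Yi i"
  by (simp_all add: evalp_gp gop_def fun_eq_iff)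

lemma evalp_power: "evalp (p ^ m) f = (evalp p ^^ m) f"
  by (induct m) simp_all

lemma T_quad: "T i (T i f) = scale cc (T i f) + f" by (rule T_quadratic[OF n v])

lemma evalp_rels: "r \<in> daha_rels N q v \<Longrightarrow> evalp r f = 0"
  unfolding daha_rels_def
proof (elim UnE CollectE exE conjE insertE emptyE, goal_cases)
  \<comment> \<open>The numbers follow the order of the families in \<open>daha_rels\<close>; the
    first four say that two generators are mutually inverse and are left to the simplifier.\<close>
  case (5 i)
  have "T i (T i f + scale (inverse v) f) - scale v (T i f + scale (inverse v) f) = 0"
    using v by (simp add: lin_simps[OF lin_T'] T_quad scale_diff_left scale_add scale_minus_left)
  then show ?case using 5 by simp
next
  case (6 i)
  then show ?case using T_braid[OF n v, of i f] by simp
next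
  case (7 i j)
  then show ?case using T_far_commute[OF n, of j i v f] by simp
next
  case (8 i)
  then show ?case using T_Y_T[OF n v, of i f] by simp
next
  case (9 i j)
  then show ?case using T_Y_far[OF n, of j i v 1 f] by simp
next
  case (10 i j)
  then show ?case using Ypow_commute[of n i 1 j 1 f] by simp
next
  case (11 i)
  then show ?case using Pi_inverse_Y[of i f] by simp
next
  case (12 i)
  then show ?case using Pi_T[of i "PiM_inv f"] by simp
next
  case (13 i)
  then show ?case using Pi_powN_T[of i f] by (simp add: evalp_power)
qed simp_all

text \<open>The polynomials that act as 0 form a two-sided ideal, which contains the
  relations.\<close>

lemma evalp_ideal:
  assumes "r \<in> daha_ideal N q v" shows "evalp r f = 0"
proof -
  let ?A = "{p \<in> Fc. \<forall>f. evalp p f = 0}"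
  have "ideal ?A (free_alg (gens N))"
  proof (rule idealI)
    show "ring (free_alg (gens N))" by (rule ring_free_alg)
    have "group (add_monoid (free_alg (gens N)))"
      using abelian_group.a_group[OF ring.is_abelian_group[OF ring_free_alg]] .
    then show "subgroup ?A (add_monoid (free_alg (gens N)))"
    proof (rule group.subgroupI)
      fix a assume a: "a \<in> ?A"
      have "inv\<^bsub>add_monoid (free_alg (gens N))\<^esub> a = - a"
        using free_alg_minus[of a "gens N"] a by (simp add: a_inv_def)
      then show "inv\<^bsub>add_monoid (free_alg (gens N))\<^esub> a \<in> ?A" using a car_uminus[of a] by auto
    next
      fix a b assume "a \<in> ?A" "b \<in> ?A"
      then show "a \<otimes>\<^bsub>add_monoid (free_alg (gens N))\<^esub> b \<in> ?A" using car_add[of a _ b] by auto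
    next
      have "0 \<in> ?A" by (simp add: car_zero)
      then show "?A \<noteq> {}" by blast
    qed simp
  next
    fix a x assume "a \<in> ?A" "x \<in> carrier (free_alg (gens N))"
    then show "x \<otimes>\<^bsub>free_alg (gens N)\<^esub> a \<in> ?A" "a \<otimes>\<^bsub>free_alg (gens N)\<^esub> x \<in> ?A"
      using car_mult[of a _ x] car_mult[of x _ a] by (auto simp: lin_zero[OF lin_evalp])
  qed
  then have "daha_ideal N q v \<subseteq> ?A" unfolding daha_ideal_def
    by (intro ring.genideal_minimal[OF ring_free_alg]) (use daha_rels_car evalp_rels in auto)
  then show ?thesis using assms by blast
qed

section \<open>The action of the algebra\<close>

definition act :: "daha_elt \<Rightarrow> tensor \<Rightarrow> tensor" where
  "act h = evalp (SOME p. p \<in> Fc \<and> cl p = h)"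

text \<open>Two representatives differ by an element of \<open>daha_ideal\<close>, which acts as
  0.\<close>

lemma act_cl: "p \<in> Fc \<Longrightarrow> act (cl p) f = evalp p f"
proof -
  assume p: "p \<in> Fc"
  have "\<exists>r. r \<in> Fc \<and> cl r = cl p" using p by blast
  then have "(SOME r. r \<in> Fc \<and> cl r = cl p) \<in> Fc \<and> cl (SOME r. r \<in> Fc \<and> cl r = cl p) = cl p"
    by (rule someI_ex)
  then have "(SOME r. r \<in> Fc \<and> cl r = cl p) - p \<in> daha_ideal N q v"
    using class_eq_iff p by blast
  from evalp_ideal[OF this, of f] show ?thesis unfolding act_def by simp
qed

lemma clE: assumes "h \<in> carrier H" obtains p where "p \<in> Fc" "h = cl p"
  using assms unfolding carrier_daha by blast

lemma lin_act: "lin (act h)" unfolding act_def by (rule lin_evalp)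

lemma act_add: "a \<in> carrier H \<Longrightarrow> b \<in> carrier H \<Longrightarrow> act (a \<oplus>\<^bsub>H\<^esub> b) f = act a f + act b f"
  by (elim clE) (simp only: class_add[symmetric] act_cl car_add evalp_add)

lemma act_mult: "a \<in> carrier H \<Longrightarrow> b \<in> carrier H \<Longrightarrow> act (a \<otimes>\<^bsub>H\<^esub> b) f = act a (act b f)"
  by (elim clE) (simp only: class_mult[symmetric] act_cl car_mult evalp_mult)

lemma act_one: "act \<one>\<^bsub>H\<^esub> f = f"
  using act_cl[OF car_one] by (simp add: class_one)

lemma act_gens: "act (scal N q v c) f = scale c f" "act (dPi N q v) f = PiM f"
  "i \<in> {1..<N} \<Longrightarrow> act (dT N q v i) f = T i f"
  "i \<in> {1..N} \<Longrightarrow> act (dY N q v i) f = Y i f"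
  unfolding scal_def dPi_def dT_def dY_def by (subst act_cl; (rule cp_car gp_car)?; simp)+

lemma gop_tensor_space:
  assumes g: "g \<in> gens N" and f: "f \<in> tensor_space N" shows "gop g f \<in> tensor_space N"
  unfolding tensor_space_eq
proof (rule lin_bspan[OF lin_gop f[unfolded tensor_space_eq]])
  let ?S = "{k. \<forall>i. i \<notin> {1..N} \<longrightarrow> k i = (0::int)}"
  fix k :: "nat \<Rightarrow> int" assume k: "k \<in> ?S"
  show "gop g (basis k) \<in> bspan ?S"
  proof (cases g)
    case (TG i)
    then have "agree_off i k \<subseteq> ?S" using g k by (auto simp: agree_off_def)
    then show ?thesis using TG T_local[OF n, of v i k] bspan_mono[of "agree_off i k"] by (auto simp: gop_def)
  qed (use g k N in \<open>auto simp: gop_def Pi_basis PiM_inv_def rot_def rotinv_def intro!: bspan_scale bspan_basis\<close>)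
qed

lemma evalp_tensor_space:
  assumes "p \<in> Fc" "f \<in> tensor_space N" shows "evalp p f \<in> tensor_space N"
proof -
  have w: "foldr gop w f \<in> tensor_space N" if "w \<in> lists (gens N)" for w
    using that by (induct w) (auto simp: assms gop_tensor_space)
  have "Poly_Mapping.keys p \<subseteq> lists (gens N)" using assms by (simp add: car_def)
  then show ?thesis
    by (induct p rule: pm_induct_keys)
       (use w in \<open>auto simp: evalp_single tensor_space_eq intro: bspan_add bspan_scale\<close>)
qed

lemma act_tensor_space: "h \<in> carrier H \<Longrightarrow> f \<in> tensor_space N \<Longrightarrow> act h f \<in> tensor_space N"
  by (elim clE) (simp only: act_cl evalp_tensor_space)

definition tensor_module :: "(daha_elt, tensor) module" where
  "tensor_module = \<lparr>carrier = tensor_space N, mult = undefined, one = undefined, zero = 0, add = (+), smult = act\<rparr>"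

lemma tensor_module_simps [simp]: "carrier tensor_module = tensor_space N" "\<zero>\<^bsub>tensor_module\<^esub> = 0" "x \<oplus>\<^bsub>tensor_module\<^esub> y = x + y"
  "a \<odot>\<^bsub>tensor_module\<^esub> x = act a x"
  by (simp_all add: tensor_module_def)

lemma is_C_module_tensor_module: "is_C_module N n n' q v u tensor_module"
proof -
  have ab: "abelian_group tensor_module"
  proof (rule abelian_groupI)
    fix x assume "x \<in> carrier tensor_module"
    then show "\<exists>y\<in>carrier tensor_module. y \<oplus>\<^bsub>tensor_module\<^esub> x = \<zero>\<^bsub>tensor_module\<^esub>"
      by (intro bexI[of _ "- x"]) (auto simp: tensor_space_eq bspan_minus)
  qed (auto simp: tensor_space_eq bspan_add add_ac)
  have "left_module H tensor_module"
    unfolding left_module_def left_module_axioms_def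
    using ring_daha ab by (auto simp: act_tensor_space act_add act_mult act_one lin_add[OF lin_act])
  then show ?thesis unfolding is_C_module_def by (auto simp: act_gens)
qed

section \<open>Inverses of T_i and pi\<close>

lemma class_T_inverse:
  assumes i: "i \<in> {1..<N}"
  shows "dT N q v i \<otimes>\<^bsub>H\<^esub> cl (gp (TG i) - cp cc) = \<one>\<^bsub>H\<^esub>"
    "cl (gp (TG i) - cp cc) \<otimes>\<^bsub>H\<^esub> dT N q v i = \<one>\<^bsub>H\<^esub>"
proof -
  let ?t = "gp (TG i)"
  have rel: "(?t - cp v) * (?t + cp (inverse v)) \<in> daha_ideal N q v"
    using rels_in_ideal[of N q v] daha_rels_mem(5)[OF i, of v q] by blast
  have ii: "cp v * cp (inverse v) = 1" using v by (simp add: cp_times[symmetric] cp_one)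
  \<comment> \<open>As v v^-1 = 1, the quadratic relation reads T_i^2 - (v - v^-1) T_i - 1, so T_i -
    (v - v^-1) inverts T_i on both sides.\<close>
  have 1: "?t * (?t - cp cc) - 1 = (?t - cp v) * (?t + cp (inverse v))"
    unfolding cp_minus using cp_mult[of v ?t] by (simp add: right_diff_distrib left_diff_distrib distrib_left distrib_right ii)
  have 2: "(?t - cp cc) * ?t - 1 = (?t - cp v) * (?t + cp (inverse v))"
    unfolding cp_minus using cp_mult[of "inverse v" ?t] by (simp add: right_diff_distrib left_diff_distrib distrib_left distrib_right ii)
  have c: "?t \<in> Fc" "?t - cp cc \<in> Fc" using i by (auto intro!: car_diff gp_car cp_car)
  show "dT N q v i \<otimes>\<^bsub>H\<^esub> cl (?t - cp cc) = \<one>\<^bsub>H\<^esub>"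
    unfolding dT_def class_mult[OF c, symmetric] class_one[symmetric]
    using rel 1 by (subst class_eq_iff) (simp_all only: car_mult c car_one)
  show "cl (?t - cp cc) \<otimes>\<^bsub>H\<^esub> dT N q v i = \<one>\<^bsub>H\<^esub>"
    unfolding dT_def class_mult[OF c(2,1), symmetric] class_one[symmetric]
    using rel 2 by (subst class_eq_iff) (simp_all only: car_mult c car_one)
qed

lemma Units_T: "i \<in> {1..<N} \<Longrightarrow> dT N q v i \<in> Units H"
  unfolding Units_def using class_T_inverse[of i] dT_closed[of i N q v]
    class_closed[of "gp (TG i) - cp cc" N q v] car_diff[OF gp_car cp_car, of "TG i" N cc] by auto

lemma class_Pi_inverse:
  "dPi N q v \<otimes>\<^bsub>H\<^esub> cl (gp PiInvG) = \<one>\<^bsub>H\<^esub>" "cl (gp PiInvG) \<otimes>\<^bsub>H\<^esub> dPi N q v = \<one>\<^bsub>H\<^esub>"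
proof -
  have c: "gp PiG \<in> Fc" "gp PiInvG \<in> Fc" by (rule gp_car, simp)+
  have "cl (gp PiG * gp PiInvG) = cl 1" "cl (gp PiInvG * gp PiG) = cl 1"
    by (rule class_relI[OF car_mult[OF c] car_one] class_relI[OF car_mult[OF c(2,1)] car_one], fact daha_rels_mem)+
  then show "dPi N q v \<otimes>\<^bsub>H\<^esub> cl (gp PiInvG) = \<one>\<^bsub>H\<^esub>" "cl (gp PiInvG) \<otimes>\<^bsub>H\<^esub> dPi N q v = \<one>\<^bsub>H\<^esub>"
    unfolding dPi_def class_mult[OF c, symmetric] class_mult[OF c(2,1), symmetric] class_one[symmetric] by auto
qed

lemma Units_Pi: "dPi N q v \<in> Units H"
  unfolding Units_def using class_Pi_inverse dPi_closed class_closed[OF gp_car, of PiInvG N q v] by auto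

lemma inv_Pi: "inv\<^bsub>H\<^esub> (dPi N q v) = cl (gp PiInvG)"
  using class_Pi_inverse dPi_closed class_closed[OF gp_car, of PiInvG N q v]
  by (intro monoid.inv_char[OF ring.is_monoid[OF ring_daha]]) auto

end

section \<open>Slope words\<close>

lemma floor_letter_iff:
  fixes a s j :: nat
  assumes "s > 0"
  shows "\<lfloor>real (j * a) / real s\<rfloor> = \<lfloor>real ((j - 1) * a) / real s\<rfloor> \<longleftrightarrow> (j * a) div s = ((j - 1) * a) div s"
  by (simp only: floor_divide_of_nat_eq of_nat_eq_iff)

text \<open>Going from j to j - 1 lowers j a by a, so the quotient by s drops exactly when the
  residue is below a. Hence the residue of j a decides the letter at j. Read from its right end, the
  word makes this residue walk by -a at a letter Y_1 and by s - a at a letter X_1^-1.\<close>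

lemma slope_step:
  fixes a s j :: nat
  assumes s: "s > 0" "a \<le> s" and j: "j \<ge> 1"
  shows "(j * a) div s = ((j - 1) * a) div s \<longleftrightarrow> a \<le> (j * a) mod s"
    and "a \<le> (j * a) mod s \<Longrightarrow> ((j - 1) * a) mod s = (j * a) mod s - a"
    and "\<not> a \<le> (j * a) mod s \<Longrightarrow> ((j - 1) * a) mod s = (j * a) mod s + s - a"
    and "\<not> a \<le> (j * a) mod s \<Longrightarrow> (j * a) div s = Suc (((j - 1) * a) div s)"
proof -
  define Q r where Qr: "Q = (j * a) div s" "r = (j * a) mod s"
  have ja: "j * a = s * Q + r" and r: "r < s" using s by (simp_all add: Qr)
  have jm: "(j - 1) * a + a = j * a" using j by (metis Suc_pred' add.commute less_eq_Suc_le One_nat_def mult_Suc)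
  have A: "((j - 1) * a) div s = Q \<and> ((j - 1) * a) mod s = r - a" if "a \<le> r"
  proof -
    have e: "(j - 1) * a = s * Q + (r - a)" using ja jm that by linarith
    have "r - a < s" using r by simp
    then show ?thesis unfolding e by simp
  qed
  have B: "Q = Suc (((j - 1) * a) div s) \<and> ((j - 1) * a) mod s = r + s - a" if "\<not> a \<le> r"
  proof -
    have "Q \<noteq> 0"
    proof
      assume "Q = 0" then have "j * a = r" using ja by simp
      then show False using that jm by linarith
    qed
    then obtain Q' where Q': "Q = Suc Q'" using not0_implies_Suc by blast
    have e: "(j - 1) * a = s * Q' + (r + s - a)" using ja jm that s Q' by (simp add: algebra_simps)
    define t where "t = r + s - a"
    have "t < s" unfolding t_def using that s by simp
    then have "((j - 1) * a) div s = Q'" "((j - 1) * a) mod s = t" unfolding e[folded t_def] using s by simp_all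
    note this[unfolded t_def]
    then have "((j - 1) * a) div s = Q'" "((j - 1) * a) mod s = r + s - a" by auto
    then show ?thesis using Q' by simp
  qed
  show "(j * a) div s = ((j - 1) * a) div s \<longleftrightarrow> a \<le> (j * a) mod s"
    unfolding Qr[symmetric] using A B by (cases "a \<le> r") auto
  show "a \<le> (j * a) mod s \<Longrightarrow> ((j - 1) * a) mod s = (j * a) mod s - a"
    "\<not> a \<le> (j * a) mod s \<Longrightarrow> ((j - 1) * a) mod s = (j * a) mod s + s - a"
    "\<not> a \<le> (j * a) mod s \<Longrightarrow> (j * a) div s = Suc (((j - 1) * a) div s)"
    unfolding Qr[symmetric] using A B by auto
qed

context daha_params
begin

section \<open>The actions of X_1 and of slope words\<close>

lemma monH: "monoid H" by (rule ring.is_monoid[OF ring_daha])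

lemma lprod_closed: "set xs \<subseteq> carrier H \<Longrightarrow> lprod H xs \<in> carrier H"
  unfolding lprod_def
  by (induct xs) (auto intro: monoid.m_closed[OF monH] monoid.one_closed[OF monH])

lemma lprod_Units: "set xs \<subseteq> Units H \<Longrightarrow> lprod H xs \<in> Units H"
  unfolding lprod_def
  by (induct xs) (auto intro: monoid.Units_m_closed[OF monH] monoid.Units_one_closed[OF monH])

lemma act_lprod: "set xs \<subseteq> carrier H \<Longrightarrow> act (lprod H xs) f = foldr act xs f"
proof (induct xs)
  case (Cons x xs)
  have "lprod H (x # xs) = x \<otimes>\<^bsub>H\<^esub> lprod H xs" by (simp add: lprod_def)
  then show ?case using Cons lprod_closed[of xs] by (simp add: act_mult)
qed (simp add: lprod_def act_one)

definition Tinv :: "nat \<Rightarrow> tensor \<Rightarrow> tensor" where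
  "Tinv i f = T i f - scale cc f"

lemma lin_Tinv [simp]: "lin (Tinv i)"
  unfolding Tinv_def[abs_def] by (intro lin_intros lin_T')

lemma T_Tinv [simp]: "T i (Tinv i f) = f" and Tinv_T [simp]: "Tinv i (T i f) = f"
  by (simp_all add: Tinv_def lin_simps[OF lin_T'] T_quad)

definition Tup :: "tensor \<Rightarrow> tensor" where "Tup f = foldr T [1..<N] f"
definition Tdown :: "tensor \<Rightarrow> tensor" where "Tdown f = foldr Tinv (rev [1..<N]) f"
text \<open>X_1^-1 = pi T_{N-1}^-1 ... T_1^-1; that this is the action of the inverse of
  \<open>dX N q v 1\<close> is \<open>act_inv_X1\<close>.\<close>

definition XI :: "tensor \<Rightarrow> tensor" where "XI f = PiM (Tdown f)"

lemma Tup_Tdown: "Tup (Tdown f) = f"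
proof -
  have "foldr T xs (foldr Tinv (rev xs) f) = f" for xs
    by (induct xs arbitrary: f) simp_all
  then show ?thesis by (simp add: Tup_def Tdown_def)
qed

definition dU :: daha_elt where "dU = lprod H (map (dT N q v) [1..<N])"

lemma dU: "dU \<in> Units H" "dU \<in> carrier H" "act dU f = Tup f"
proof -
  have "set (map (dT N q v) [1..<N]) \<subseteq> Units H" using Units_T by auto
  then show "dU \<in> Units H" unfolding dU_def by (rule lprod_Units)
  then show "dU \<in> carrier H" by (rule monoid.Units_closed[OF monH])
  have "foldr act (map (dT N q v) xs) f = foldr T xs f" if "set xs \<subseteq> {1..<N}" for xs
    using that by (induct xs) (auto simp: act_gens)
  moreover have "set (map (dT N q v) [1..<N]) \<subseteq> carrier H" using dT_closed[of _ N q v] by auto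
  ultimately show "act dU f = Tup f" unfolding dU_def Tup_def by (simp add: act_lprod)
qed

lemma dX1: "dX N q v 1 = dU \<otimes>\<^bsub>H\<^esub> inv\<^bsub>H\<^esub> dPi N q v"
proof -
  have "dU \<otimes>\<^bsub>H\<^esub> inv\<^bsub>H\<^esub> dPi N q v \<in> carrier H"
    using dU(2) monoid.Units_inv_closed[OF monH Units_Pi] monoid.m_closed[OF monH] by blast
  then show ?thesis unfolding dX_def Let_def dU_def[symmetric]
    by (simp add: lprod_def monoid.r_one[OF monH])
qed

lemma Units_X: "dX N q v 1 \<in> Units H"
  unfolding dX1 using dU(1) monoid.Units_inv_Units[OF monH Units_Pi] monoid.Units_m_closed[OF monH] by blast

lemma act_inv_left: "x \<in> Units H \<Longrightarrow> act (inv\<^bsub>H\<^esub> x) (act x f) = f"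
  using act_mult[of "inv\<^bsub>H\<^esub> x" x f] monoid.Units_inv_closed[OF monH] monoid.Units_closed[OF monH]
    monoid.Units_l_inv[OF monH] by (simp add: act_one)

lemma act_inv_Pi: "act (inv\<^bsub>H\<^esub> dPi N q v) f = PiM_inv f"
  using act_inv_left[OF Units_Pi, of "PiM_inv f"] by (simp add: act_gens)

lemma act_X1: "act (dX N q v 1) f = Tup (PiM_inv f)"
  unfolding dX1 using dU monoid.Units_inv_closed[OF monH Units_Pi] by (simp add: act_mult act_inv_Pi)

lemma act_inv_X1: "act (inv\<^bsub>H\<^esub> dX N q v 1) f = XI f"
proof -
  have "act (dX N q v 1) (XI f) = f" by (simp only: act_X1 XI_def PiInv_Pi Tup_Tdown)
  then show ?thesis using act_inv_left[OF Units_X, of "XI f"] by simp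
qed

text \<open>sigma is prescribed on the T_i, the Y_i and the X_i^-1, so sigma(pi) has to be computed
  from this expression.\<close>

lemma dPi_eq: "dPi N q v = inv\<^bsub>H\<^esub> dX N q v 1 \<otimes>\<^bsub>H\<^esub> dU"
proof -
  interpret monoid H by (rule monH)
  have c: "dU \<in> carrier H" "dPi N q v \<in> Units H" "dX N q v 1 \<in> Units H" using dU Units_Pi Units_X by auto
  have c': "dPi N q v \<in> carrier H" "inv\<^bsub>H\<^esub> dPi N q v \<in> carrier H" "dX N q v 1 \<in> carrier H"
    "inv\<^bsub>H\<^esub> dX N q v 1 \<in> carrier H" using c by auto
  note c = c c'
  have "dX N q v 1 \<otimes>\<^bsub>H\<^esub> dPi N q v = dU" unfolding dX1 using c by (simp add: m_assoc del: One_nat_def)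
  then have "inv\<^bsub>H\<^esub> dX N q v 1 \<otimes>\<^bsub>H\<^esub> dU = inv\<^bsub>H\<^esub> dX N q v 1 \<otimes>\<^bsub>H\<^esub> (dX N q v 1 \<otimes>\<^bsub>H\<^esub> dPi N q v)" by simp
  also have "\<dots> = dPi N q v" using c by (simp add: m_assoc[symmetric] del: One_nat_def)
  finally show ?thesis ..
qed

definition slope_op :: "nat \<Rightarrow> nat \<Rightarrow> nat \<Rightarrow> tensor \<Rightarrow> tensor" where
  "slope_op a s j = (if a \<le> (j * a) mod s then Y 1 else XI)"

lemma act_slope_word:
  assumes "a + b > 0"
  shows "slope_word N q v a b \<in> carrier H"
    "act (slope_word N q v a b) f = foldr (slope_op a (a + b)) [1..<a + b + 1] f"
proof -
  define h where "h = (\<lambda>j. if \<lfloor>real (j * a) / real (a + b)\<rfloor> = \<lfloor>real ((j - 1) * a) / real (a + b)\<rfloor>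
               then dY N q v 1 else inv\<^bsub>H\<^esub> (dX N q v 1))"
  have sw: "slope_word N q v a b = lprod H (map h [1..<a + b + 1])"
    unfolding slope_word_def h_def ..
  have cc: "dY N q v 1 \<in> carrier H" "inv\<^bsub>H\<^esub> (dX N q v 1) \<in> carrier H"
    using dY_closed[of 1 N q v] N monoid.Units_inv_closed[OF monH Units_X] by auto
  then have c: "h j \<in> carrier H" for j unfolding h_def by presburger
  have h: "act (h j) f = slope_op a (a + b) j f" if j: "j \<ge> 1" for j f
  proof -
    have iff: "\<lfloor>real (j * a) / real (a + b)\<rfloor> = \<lfloor>real ((j - 1) * a) / real (a + b)\<rfloor> \<longleftrightarrow> a \<le> (j * a) mod (a + b)"
      using slope_step(1)[of "a+b" a j] assms j floor_letter_iff[of "a+b" j a] by simp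
    have "act (dY N q v 1) f = Y 1 f" using N by (intro act_gens) auto
    then show ?thesis unfolding h_def slope_op_def iff using act_inv_X1[of f] by presburger
  qed
  show "slope_word N q v a b \<in> carrier H" unfolding sw using c by (intro lprod_closed) auto
  have "foldr act (map h xs) f = foldr (slope_op a (a + b)) xs f" if "\<forall>x\<in>set xs. x \<ge> 1" for xs
    using that h by (induct xs) auto
  then show "act (slope_word N q v a b) f = foldr (slope_op a (a + b)) [1..<a + b + 1] f"
    unfolding sw using c by (subst act_lprod) (auto simp del: upt_Suc)
qed

lemma slope_elt_1: "slope_word N q v a b \<in> carrier H \<Longrightarrow> slope_elt N q v a b 1 = slope_word N q v a b"
  by (simp add: slope_elt_def Let_def T_down_def T_up_def lprod_def monoid.l_one[OF monH] monoid.r_one[OF monH])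

section \<open>The eigenvector w0\<close>

definition w0 :: tensor where "w0 = basis (\<lambda>_. 0)"

lemma T_w0: "T i w0 = scale v w0"
  unfolding w0_def using T_near[OF n v, of "\<lambda>_. 0" i] n by simp

lemma Tinv_w0: "Tinv i w0 = scale (inverse v) w0"
  unfolding Tinv_def T_w0 by (simp add: scale_diff_left[symmetric])

lemma Tup_w0: "Tup w0 = scale (v ^ (N - 1)) w0"
proof -
  have "foldr T xs w0 = scale (v ^ length xs) w0" for xs
    by (induct xs) (simp_all add: lin_simps[OF lin_T'] T_w0 mult.commute)
  then show ?thesis by (simp add: Tup_def)
qed

lemma Tdown_w0: "Tdown w0 = scale (inverse v ^ (N - 1)) w0"
proof -
  have "foldr Tinv xs w0 = scale (inverse v ^ length xs) w0" for xs
    by (induct xs) (simp_all add: lin_simps[OF lin_Tinv] Tinv_w0 mult.commute)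
  then show ?thesis by (simp add: Tdown_def)
qed

definition single_at :: "nat \<Rightarrow> int \<Rightarrow> nat \<Rightarrow> int" where
  "single_at j z = (\<lambda>i. if i = j then z else 0)"

lemma w0_single_at: "w0 = basis (single_at j 0)"
  by (simp add: w0_def single_at_def)

lemma Y_single_at: "Y j (basis (single_at j z)) = basis (single_at j (z + int n))"
proof -
  have "(single_at j z)(j := single_at j z j + int n * 1) = single_at j (z + int n)"
    by (auto simp: single_at_def fun_eq_iff)
  then show ?thesis by (simp only: Ypow_basis)
qed

text \<open>Since -d < 0 and d < n, T_j gives the swapped vector plus v - v^-1 times the original
  one, and subtracting the latter is what T_j^-1 = T_j - (v - v^-1) does.\<close>

lemma Tinv_single_at:
  assumes "0 < d" "d < int n"
  shows "Tinv j (basis (single_at j (-d))) = basis (single_at (j+1) (-d))"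
proof -
  have s: "swap_at j (single_at j (-d)) = single_at (j+1) (-d)" by (auto simp: swap_at_def fun_eq_iff single_at_def)
  have "T j (basis (single_at j (-d))) = basis (swap_at j (single_at j (-d))) + scale cc (basis (single_at j (-d)))"
    using assms by (subst T_near[OF n v]) (auto simp: single_at_def)
  then show ?thesis unfolding Tinv_def s by simp
qed

lemma Tdown_single_at:
  assumes "0 < d" "d < int n"
  shows "Tdown (basis (single_at 1 (-d))) = basis (single_at N (-d))"
proof -
  have "foldr Tinv (rev [1..<Suc k]) (basis (single_at 1 (-d))) = basis (single_at (Suc k) (-d))" for k
  proof (induct k)
    case (Suc k)
    have "rev [1..<Suc (Suc k)] = Suc k # rev [1..<Suc k]" by simp
    then show ?case using Suc Tinv_single_at[OF assms, of "Suc k"] by (simp del: upt_Suc)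
  qed simp
  from this[of "N - 1"] show ?thesis using N by (simp add: Tdown_def)
qed

text \<open>The scalar with which X_1^-1 sends e_{-d} in the first factor to e_{-d-n'}. For d = 0
  all factors are equal, and each of the N - 1 inverses T_i^-1 contributes v^-1.\<close>

definition X_factor :: "nat \<Rightarrow> complex" where
  "X_factor d = Pi_coeff (- int d) * (if d = 0 then inverse v ^ (N - 1) else 1)"

lemma XI_single_at:
  assumes "d < n"
  shows "XI (basis (single_at 1 (- int d))) = scale (X_factor d) (basis (single_at 1 (- int d - int n')))"
proof -
  have r: "(rot N (single_at N z))(1 := z - int n') = single_at 1 (z - int n')" for z
    using N by (auto simp: rot_def fun_eq_iff single_at_def)
  have P: "PiM (basis (single_at N z)) = scale (Pi_coeff z) (basis (single_at 1 (z - int n')))" for z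
    using Pi_basis[of "single_at N z"] r[of z] by (simp add: single_at_def)
  show ?thesis
  proof (cases "d = 0")
    case True
    have "Tdown (basis (single_at 1 0)) = scale (inverse v ^ (N - 1)) (basis (single_at N 0))"
      using Tdown_w0 w0_single_at by metis
    then show ?thesis unfolding XI_def using True P[of 0]
      by (simp add: lin_simps[OF lin_Pi] X_factor_def mult.commute)
  next
    case False
    then have "Tdown (basis (single_at 1 (- int d))) = basis (single_at N (- int d))"
      using assms by (intro Tdown_single_at) auto
    then show ?thesis unfolding XI_def P using False P by (simp add: X_factor_def)
  qed
qed

lemma lin_XI [simp]: "lin XI"
proof -
  have "lin (\<lambda>f. foldr Tinv xs f)" for xs by (induct xs) (auto intro: lin_id lin_comp[OF lin_Tinv])
  then show ?thesis unfolding XI_def[abs_def] Tdown_def[abs_def] by (rule lin_comp[OF lin_Pi])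
qed

lemma lin_slope_op [simp]: "lin (slope_op a s j)" by (simp add: slope_op_def)

text \<open>Once the letters from J + 1 on have acted, the first factor is e_{-r} with r = J n mod
  (n + n'), because a letter Y_1 adds n to the index and X_1^-1 subtracts n'. By
  \<open>slope_step\<close> a letter X_1^-1 meets only r < n, the range of
  \<open>XI_single_at\<close>.\<close>

lemma slope_word_w0:
  defines "s \<equiv> n + n'"
  assumes "J \<le> s"
  shows "foldr (slope_op n s) [J + 1..<s + 1] w0 =
    scale (\<Prod>j\<in>{j \<in> {J+1..s}. (j * n) mod s < n}. X_factor ((j * n) mod s))
      (basis (single_at 1 (- int ((J * n) mod s))))"
  using assms(2)
proof (induct J rule: inc_induct)
  case base
  show ?case using w0_single_at[of 1] by simp
next
  case (step J)
  have s: "s > 0" "n \<le> s" using n by (auto simp: s_def)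
  let ?r = "(Suc J * n) mod s"
  have e: "[J + 1..<s + 1] = Suc J # [Suc J + 1..<s + 1]" using step by (simp add: upt_conv_Cons)
  note st = slope_step[OF s, of "Suc J"]
  have set: "{j \<in> {J+1..s}. (j * n) mod s < n}
     = (if ?r < n then insert (Suc J) {j \<in> {Suc J+1..s}. (j * n) mod s < n} else {j \<in> {Suc J+1..s}. (j * n) mod s < n})"
  proof -
    have "{J+1..s} = insert (Suc J) {Suc J+1..s}" using step(2) by auto
    then show ?thesis by auto
  qed
  show ?case
  proof (cases "?r < n")
    case True
    then have r: "(J * n) mod s = ?r + n'" using st(3) by (simp add: s_def)
    have "slope_op n s (Suc J) (basis (single_at 1 (- int ?r))) = scale (X_factor ?r) (basis (single_at 1 (- int ((J * n) mod s))))"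
    proof -
      have "- int (?r + n') = - int ?r - int n'" by simp
      then show ?thesis using True XI_single_at[OF True] unfolding slope_op_def r by simp
    qed
    then show ?thesis unfolding e foldr.simps o_apply step.hyps(3) set lin_scale[OF lin_slope_op]
      using True by (simp add: mult.commute)
  next
    case False
    then have r: "(J * n) mod s = ?r - n" using st(2) by simp
    have "- int ?r + int n = - int (?r - n)" using False by linarith
    then have "slope_op n s (Suc J) (basis (single_at 1 (- int ?r))) = basis (single_at 1 (- int ((J * n) mod s)))"
    proof -
      have "slope_op n s (Suc J) = Y 1" using False unfolding slope_op_def by auto
      then show ?thesis unfolding r by (simp only: Y_single_at \<open>- int ?r + int n = - int (?r - n)\<close>)
    qed
    then show ?thesis unfolding e foldr.simps o_apply step.hyps(3) set lin_scale[OF lin_slope_op]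
      using False by simp
  qed
qed

definition u_char :: complex where "u_char = (\<Prod>a<n. u a) * q powi (1 - int n)"

lemma u_char_nz: "u_char \<noteq> 0"
  unfolding u_char_def using u q by (simp add: power_int_eq_0_iff)

text \<open>For 0 < d < n, -d = n (-1) + (n - d) contributes u_{n-d} q^-1, and d = 0 contributes
  u_0. This is the origin of q^(1-n).\<close>

lemma prod_Pi_coeff: "(\<Prod>d<n. Pi_coeff (- int d)) = u_char"
proof -
  obtain k where k: "n = Suc k" using n by (cases n) auto
  have c: "Pi_coeff (- int (Suc d)) = u (n - Suc d) * inverse q" if "d < k" for d
  proof -
    have "- int (Suc d) = int n * (-1) + int (n - Suc d)" using that k by simp
    then have "(- int (Suc d)) div int n = -1 \<and> (- int (Suc d)) mod int n = int (n - Suc d)"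
      using that k by (metis (no_types, lifting) int_div_pos_eq int_mod_pos_eq mult.commute of_nat_0_le_iff of_nat_less_iff diff_less zero_less_Suc)
    then show ?thesis unfolding Pi_coeff_def by simp
  qed
  have "(\<Prod>d<n. Pi_coeff (- int d)) = Pi_coeff 0 * (\<Prod>d<k. Pi_coeff (- int (Suc d)))"
    unfolding k by (subst prod.lessThan_Suc_shift) simp
  also have "(\<Prod>d<k. Pi_coeff (- int (Suc d))) = (\<Prod>d<k. u (n - Suc d)) * inverse q ^ k"
    by (subst prod.cong[OF refl c]) (auto simp: prod.distrib)
  also have "(\<Prod>d<k. u (n - Suc d)) = (\<Prod>d<k. u (Suc d))"
    unfolding k using prod.nat_diff_reindex[of "\<lambda>d. u (Suc d)" k]
    by (simp add: Suc_diff_Suc)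
  also have "Pi_coeff 0 = u 0" by (simp add: Pi_coeff_def)
  also have "u 0 * ((\<Prod>d<k. u (Suc d)) * inverse q ^ k) = (\<Prod>a<n. u a) * inverse q ^ k"
    unfolding k by (subst prod.lessThan_Suc_shift) simp
  also have "inverse q ^ k = q powi (1 - int n)" unfolding k by (simp add: power_int_minus power_inverse)
  finally show ?thesis by (simp add: u_char_def)
qed

text \<open>n is coprime to n + n', so j n runs through every residue modulo n + n' once as j does,
  and each d < n is met exactly once. The power of v^-1 comes from d = 0.\<close>

lemma slope_word_eigen:
  assumes co: "coprime n n'"
  shows "foldr (slope_op n (n + n')) [1..<n + n' + 1] w0 = scale (u_char * inverse v ^ (N - 1)) w0"
proof -
  let ?s = "n + n'"
  have s: "?s > 0" using n by simp
  have cs: "coprime n ?s" using co unfolding coprime_iff_gcd_eq_1 by simp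
  let ?f = "\<lambda>j. (j * n) mod ?s"
  have le: "x = y" if xy: "x \<in> {1..?s}" "y \<in> {1..?s}" "x \<le> y" "?f x = ?f y" for x y
  proof -
    have "?s dvd y * n - x * n" using mod_eq_dvd_iff_nat[of "x * n" "y * n" ?s] xy by simp
    then have "?s dvd (y - x) * n" by (simp add: diff_mult_distrib)
    then have "?s dvd y - x" using cs by (simp only: coprime_dvd_mult_left_iff coprime_commute)
    moreover have "y - x < ?s" using xy by auto
    ultimately show ?thesis using xy(3) nat_dvd_not_less[of "y - x" ?s] by fastforce
  qed
  have inj: "inj_on ?f {1..?s}"
    by (rule inj_onI) (metis le nat_le_linear)
  have "?f ` {1..?s} \<subseteq> {..<?s}" using s by auto
  then have img: "?f ` {1..?s} = {..<?s}" using inj by (intro card_subset_eq) (auto simp: card_image)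
  let ?A = "{j \<in> {0+1..?s}. ?f j < n}"
  have im: "?f ` ?A = {..<n}"
  proof
    show "{..<n} \<subseteq> ?f ` ?A"
    proof
      fix d assume d: "d \<in> {..<n}"
      then have "d \<in> ?f ` {1..?s}" unfolding img by auto
      then show "d \<in> ?f ` ?A" using d by auto
    qed
  qed auto
  have "inj_on ?f ?A" using inj by (rule inj_on_subset) auto
  then have "(\<Prod>j\<in>?A. X_factor (?f j)) = (\<Prod>d\<in>?f ` ?A. X_factor d)" by (simp add: prod.reindex)
  also have "\<dots> = (\<Prod>d<n. X_factor d)" unfolding im ..
  also have "\<dots> = (\<Prod>d<n. Pi_coeff (- int d)) * (\<Prod>d<n. if d = 0 then inverse v ^ (N - 1) else 1)"
    unfolding X_factor_def by (rule prod.distrib)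
  also have "(\<Prod>d<n. if d = 0 then inverse v ^ (N - 1) else 1) = inverse v ^ (N - 1)"
    using n by (subst prod.delta) auto
  finally have p: "(\<Prod>j\<in>?A. X_factor (?f j)) = u_char * inverse v ^ (N - 1)" by (simp add: prod_Pi_coeff)
  show ?thesis using slope_word_w0[of 0] w0_single_at[of 1] unfolding p by simp
qed

end

section \<open>The twisted Cherednik module\<close>

locale daha_sigma = daha_params n n' N q v u
  for n n' N :: nat and q v :: complex and u :: "nat \<Rightarrow> complex" +
  fixes m m' :: nat and \<sigma> :: "daha_elt \<Rightarrow> daha_elt"
  assumes n': "n' \<ge> 1" and co: "coprime n n'" and det: "int n * int m' - int n' * int m = 1"
    and mn: "m < n" and sig: "is_sigma N q v n n' m m' \<sigma>"
begin

lemma sig_props: "\<sigma> \<in> ring_hom H H" "bij_betw \<sigma> (carrier H) (carrier H)"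
    "\<sigma> (scal N q v c) = scal N q v c" "i \<in> {1..<N} \<Longrightarrow> \<sigma> (dT N q v i) = dT N q v i"
    "\<sigma> (inv\<^bsub>H\<^esub> (dX N q v 1)) = slope_elt N q v n n' 1" "\<sigma> (dY N q v 1) = slope_elt N q v m m' 1"
proof -
  have 1: "\<sigma> \<in> daha_aut N q v" and 2: "\<forall>i \<in> {1..<N}. \<sigma> (dT N q v i) = dT N q v i"
    and 3: "\<forall>i \<in> {1..N}. \<sigma> (inv\<^bsub>H\<^esub> (dX N q v i)) = slope_elt N q v n n' i"
    and 4: "\<forall>i \<in> {1..N}. \<sigma> (dY N q v i) = slope_elt N q v m m' i"
    using sig unfolding is_sigma_def Let_def by blast+
  have "1 \<in> {1..N}" using N by simp
  then show "\<sigma> (inv\<^bsub>H\<^esub> (dX N q v 1)) = slope_elt N q v n n' 1" "\<sigma> (dY N q v 1) = slope_elt N q v m m' 1"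
    using 3 4 by blast+
  show "i \<in> {1..<N} \<Longrightarrow> \<sigma> (dT N q v i) = dT N q v i" using 2 by blast
  show "\<sigma> \<in> ring_hom H H" "bij_betw \<sigma> (carrier H) (carrier H)" "\<sigma> (scal N q v c) = scal N q v c"
    using 1 unfolding daha_aut_def ring_iso_def by auto
qed

lemma sig_closed: "h \<in> carrier H \<Longrightarrow> \<sigma> h \<in> carrier H"
  and sig_mult: "h \<in> carrier H \<Longrightarrow> k \<in> carrier H \<Longrightarrow> \<sigma> (h \<otimes>\<^bsub>H\<^esub> k) = \<sigma> h \<otimes>\<^bsub>H\<^esub> \<sigma> k"
  and sig_add: "h \<in> carrier H \<Longrightarrow> k \<in> carrier H \<Longrightarrow> \<sigma> (h \<oplus>\<^bsub>H\<^esub> k) = \<sigma> h \<oplus>\<^bsub>H\<^esub> \<sigma> k"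
  and sig_one: "\<sigma> \<one>\<^bsub>H\<^esub> = \<one>\<^bsub>H\<^esub>"
  using sig_props(1) by (auto simp: ring_hom_def)

section \<open>Evaluation at w0\<close>

definition ev :: "daha_elt \<Rightarrow> tensor" where "ev h = act (\<sigma> h) w0"

text \<open>Left multiplication on H corresponds to the action twisted by sigma, so
  \<open>ev\<close> becomes a map of modules once \<open>twisted_module\<close> undoes
  sigma.\<close>

lemma ev_mult: "h \<in> carrier H \<Longrightarrow> k \<in> carrier H \<Longrightarrow> ev (h \<otimes>\<^bsub>H\<^esub> k) = act (\<sigma> h) (ev k)"
  by (simp add: ev_def sig_mult act_mult sig_closed)

lemma ev_add: "h \<in> carrier H \<Longrightarrow> k \<in> carrier H \<Longrightarrow> ev (h \<oplus>\<^bsub>H\<^esub> k) = ev h + ev k"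
  by (simp add: ev_def sig_add act_add sig_closed)

lemma ev_one: "ev \<one>\<^bsub>H\<^esub> = w0"
  by (simp add: ev_def sig_one act_one)

lemma ev_zero: "ev \<zero>\<^bsub>H\<^esub> = 0"
proof -
  interpret ring H by (rule ring_daha)
  show ?thesis using ev_add[of "\<zero>\<^bsub>H\<^esub>" "\<zero>\<^bsub>H\<^esub>"] by simp
qed

lemma ev_uminus: "h \<in> carrier H \<Longrightarrow> ev (\<ominus>\<^bsub>H\<^esub> h) = - ev h"
proof -
  interpret ring H by (rule ring_daha)
  assume h: "h \<in> carrier H"
  have "ev (\<ominus>\<^bsub>H\<^esub> h) + ev h = 0" using ev_add[of "\<ominus>\<^bsub>H\<^esub> h" h] h by (simp add: l_neg ev_zero)
  then show ?thesis by (simp add: eq_neg_iff_add_eq_0)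
qed

lemma ev_diff: "h \<in> carrier H \<Longrightarrow> k \<in> carrier H \<Longrightarrow> ev (h \<ominus>\<^bsub>H\<^esub> k) = ev h - ev k"
proof -
  interpret ring H by (rule ring_daha)
  assume h: "h \<in> carrier H" "k \<in> carrier H"
  then show ?thesis by (simp add: a_minus_def ev_add ev_uminus)
qed

lemma ev_scal: "h \<in> carrier H \<Longrightarrow> ev (scal N q v c \<otimes>\<^bsub>H\<^esub> h) = scale c (ev h)"
  by (simp add: ev_mult scal_closed sig_props act_gens)

lemma w0_tensor_space: "w0 \<in> tensor_space N"
  unfolding w0_def tensor_space_eq by (rule bspan_basis) simp

lemma ev_tensor_space: "h \<in> carrier H \<Longrightarrow> ev h \<in> tensor_space N"
  unfolding ev_def by (intro act_tensor_space sig_closed w0_tensor_space)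

lemma m': "m' \<ge> 1"
proof (rule ccontr)
  assume "\<not> m' \<ge> 1"
  then have "m' = 0" by simp
  then have "- (int n' * int m) = 1" using det by simp
  moreover have "int n' * int m \<ge> 0" by simp
  ultimately show False by linarith
qed

definition Aop :: "tensor \<Rightarrow> tensor" where
  "Aop f = foldr (slope_op m (m + m')) [1..<m + m' + 1] f"

lemma act_sig_Y1: "act (\<sigma> (dY N q v 1)) f = Aop f"
  using m' act_slope_word[of m m'] slope_elt_1 by (simp only: sig_props Aop_def)

lemma act_sig_T: "i \<in> {1..<N} \<Longrightarrow> act (\<sigma> (dT N q v i)) f = T i f"
  by (simp only: sig_props act_gens)

lemma sig_dU: "\<sigma> dU = dU"
proof -
  have "\<sigma> (lprod H (map (dT N q v) xs)) = lprod H (map (dT N q v) xs)" if "set xs \<subseteq> {1..<N}" for xs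
    using that
  proof (induct xs)
    case (Cons x xs)
    have e: "lprod H (map (dT N q v) (x # xs)) = dT N q v x \<otimes>\<^bsub>H\<^esub> lprod H (map (dT N q v) xs)"
      by (simp add: lprod_def)
    have "lprod H (map (dT N q v) xs) \<in> carrier H" using Cons dT_closed[of _ N q v] by (intro lprod_closed) auto
    moreover have "x \<in> {1..<N}" using Cons by simp
    ultimately show ?case unfolding e using Cons by (simp add: sig_mult dT_closed sig_props)
  qed (simp add: lprod_def sig_one)
  then show ?thesis by (simp add: dU_def)
qed

text \<open>The power v^(N-1) with which T_1 ... T_{N-1} acts on w0 cancels the one in
  \<open>slope_word_eigen\<close>.\<close>

lemma ev_Pi: "ev (dPi N q v) = scale u_char w0"
proof -
  have sl: "slope_elt N q v n n' 1 = slope_word N q v n n'" "slope_word N q v n n' \<in> carrier H"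
    "act (slope_word N q v n n') f = foldr (slope_op n (n + n')) [1..<n + n' + 1] f" for f
    using act_slope_word[of n n'] slope_elt_1 n by auto
  have "\<sigma> (dPi N q v) = slope_word N q v n n' \<otimes>\<^bsub>H\<^esub> dU"
    using sig_mult[of "inv\<^bsub>H\<^esub> dX N q v 1" dU] monoid.Units_inv_closed[OF monH Units_X] dU(2)
    by (simp only: dPi_eq[symmetric] sig_props sig_dU sl)
  then have "ev (dPi N q v) = act (slope_word N q v n n') (Tup w0)"
    by (simp only: ev_def act_mult sl dU)
  also have "\<dots> = scale (v ^ (N - 1)) (act (slope_word N q v n n') w0)"
    by (simp only: Tup_w0 lin_scale[OF lin_act])
  also have "\<dots> = scale u_char w0"
  proof -
    have "v ^ (N - 1) * (u_char * inverse v ^ (N - 1)) = u_char" using v by (simp add: power_inverse field_simps)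
    then show ?thesis by (simp only: sl slope_word_eigen[OF co] scale_scale)
  qed
  finally show ?thesis .
qed

lemma ev_T: "i \<in> {1..<N} \<Longrightarrow> ev (dT N q v i) = scale v w0"
  by (simp add: ev_def act_sig_T T_w0)

section \<open>The Cherednik character\<close>

abbreviation "Fin \<equiv> fin_subalg N q v"

lemma Fin_closed: "s \<in> Fin \<Longrightarrow> s \<in> carrier H"
proof -
  have "dT N q v ` {1..<N} \<union> {dPi N q v, inv\<^bsub>H\<^esub> (dPi N q v)} \<union> range (scal N q v) \<subseteq> carrier H"
    using dT_closed dPi_closed scal_closed monoid.Units_inv_closed[OF monH Units_Pi] by auto
  then show "s \<in> Fin \<Longrightarrow> s \<in> carrier H"
    unfolding fin_subalg_def by (rule ring.generate_ring_in_carrier[OF ring_daha])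
qed

lemma Fin_gens: "i \<in> {1..<N} \<Longrightarrow> dT N q v i \<in> Fin" "dPi N q v \<in> Fin" "inv\<^bsub>H\<^esub> (dPi N q v) \<in> Fin"
    "scal N q v c \<in> Fin" "\<one>\<^bsub>H\<^esub> \<in> Fin" "s \<in> Fin \<Longrightarrow> \<ominus>\<^bsub>H\<^esub> s \<in> Fin"
    "s \<in> Fin \<Longrightarrow> t \<in> Fin \<Longrightarrow> s \<oplus>\<^bsub>H\<^esub> t \<in> Fin" "s \<in> Fin \<Longrightarrow> t \<in> Fin \<Longrightarrow> s \<otimes>\<^bsub>H\<^esub> t \<in> Fin"
  unfolding fin_subalg_def by (auto intro: generate_ring.intros)

lemma ev_inv_Pi: "ev (inv\<^bsub>H\<^esub> (dPi N q v)) = scale (inverse u_char) w0"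
proof -
  interpret monoid H by (rule monH)
  have "w0 = ev (inv\<^bsub>H\<^esub> (dPi N q v) \<otimes>\<^bsub>H\<^esub> dPi N q v)" using Units_Pi by (simp add: ev_one)
  also have "\<dots> = act (\<sigma> (inv\<^bsub>H\<^esub> (dPi N q v))) (scale u_char w0)"
    using Units_Pi unfolding ev_Pi[symmetric] by (intro ev_mult) auto
  also have "\<dots> = scale u_char (ev (inv\<^bsub>H\<^esub> (dPi N q v)))" by (simp add: lin_scale[OF lin_act] ev_def)
  finally have "scale (inverse u_char) w0 = scale (inverse u_char) (scale u_char (ev (inv\<^bsub>H\<^esub> (dPi N q v))))" by simp
  then show ?thesis using u_char_nz by simp
qed

text \<open>Stated without the character, whose existence is deduced from it in
  \<open>psi_character\<close>.\<close>

lemma ev_Fin_ex: "s \<in> Fin \<Longrightarrow> \<exists>c. ev s = scale c w0"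
  unfolding fin_subalg_def
proof (induct s rule: generate_ring.induct)
  case one
  show ?case using ev_one by (metis scale_one)
next
  case (incl h)
  moreover have "ev (scal N q v c) = scale c w0" for c by (simp add: ev_def sig_props act_gens)
  ultimately show ?case using ev_T ev_Pi ev_inv_Pi by auto
next
  case (a_inv h)
  then show ?case using ev_uminus[OF Fin_closed, unfolded fin_subalg_def] by (metis scale_minus_left)
next
  case (eng_add h1 h2)
  then show ?case using ev_add[OF Fin_closed Fin_closed, unfolded fin_subalg_def] by (metis scale_add_left)
next
  case (eng_mult h1 h2)
  then obtain c1 c2 where "ev h1 = scale c1 w0" "ev h2 = scale c2 w0" by blast
  then have "ev (h1 \<otimes>\<^bsub>H\<^esub> h2) = scale (c2 * c1) w0"
    using ev_mult[OF Fin_closed Fin_closed, unfolded fin_subalg_def, OF eng_mult(1,3)]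
    by (simp add: lin_scale[OF lin_act] ev_def)
  then show ?case by blast
qed

definition \<psi> :: "daha_elt \<Rightarrow> complex" where "\<psi> = cherednik_character N q v u_char"

text \<open>\<open>cherednik_character\<close> is a choice, so a character with these values has to
  be exhibited. The coefficient of w0 in \<open>ev s\<close> is one, since the subalgebra preserves
  the line of w0.\<close>

lemma psi_character: "is_character H (scal N q v) Fin \<psi>" "i \<in> {1..<N} \<Longrightarrow> \<psi> (dT N q v i) = v" "\<psi> (dPi N q v) = u_char"
proof -
  let ?Q = "\<lambda>\<psi>. is_character H (scal N q v) Fin \<psi> \<and> (\<forall>i \<in> {1..<N}. \<psi> (dT N q v i) = v) \<and> \<psi> (dPi N q v) = u_char"
  define p where "p = (\<lambda>h. Poly_Mapping.lookup (ev h) (\<lambda>_. 0))"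
  have p: "p s = c" if "ev s = scale c w0" for s c using that by (simp add: p_def w0_def)
  have p': "ev s = scale (p s) w0" if "s \<in> Fin" for s using ev_Fin_ex[OF that] p by auto
  have "?Q p"
  proof (intro conjI ballI)
    show "is_character H (scal N q v) Fin p"
      unfolding is_character_def
    proof (intro conjI allI ballI)
      show "p (scal N q v c) = c" for c by (rule p) (simp add: ev_def sig_props act_gens)
      fix x y assume xy: "x \<in> Fin" "y \<in> Fin"
      show "p (x \<oplus>\<^bsub>H\<^esub> y) = p x + p y"
        by (rule p) (use xy p'[of x] p'[of y] in \<open>simp add: ev_add Fin_closed scale_add_left\<close>)
      have "ev (x \<otimes>\<^bsub>H\<^esub> y) = act (\<sigma> x) (scale (p y) w0)"
        using ev_mult[OF Fin_closed Fin_closed, OF xy] p'[OF xy(2)] by simp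
      also have "\<dots> = scale (p x * p y) w0"
        using p'[OF xy(1)] by (simp add: lin_scale[OF lin_act] ev_def mult.commute)
      finally show "p (x \<otimes>\<^bsub>H\<^esub> y) = p x * p y" by (rule p)
    qed
  qed (auto intro: p simp: ev_T ev_Pi)
  then have "?Q \<psi>" unfolding \<psi>_def cherednik_character_def by (rule someI[of ?Q])
  then show "is_character H (scal N q v) Fin \<psi>" "i \<in> {1..<N} \<Longrightarrow> \<psi> (dT N q v i) = v" "\<psi> (dPi N q v) = u_char" by auto
qed

lemma psi_simps: "\<psi> (scal N q v c) = c" "x \<in> Fin \<Longrightarrow> y \<in> Fin \<Longrightarrow> \<psi> (x \<oplus>\<^bsub>H\<^esub> y) = \<psi> x + \<psi> y"
    "x \<in> Fin \<Longrightarrow> y \<in> Fin \<Longrightarrow> \<psi> (x \<otimes>\<^bsub>H\<^esub> y) = \<psi> x * \<psi> y"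
  using psi_character(1) unfolding is_character_def by auto

lemma psi_one: "\<psi> \<one>\<^bsub>H\<^esub> = 1"
  using psi_simps(1)[of 1] by (simp add: scal_def cp_one class_one)

lemma psi_zero: "\<psi> \<zero>\<^bsub>H\<^esub> = 0"
proof -
  interpret ring H by (rule ring_daha)
  have z: "\<zero>\<^bsub>H\<^esub> \<in> Fin" using Fin_gens(5) Fin_gens(6)[OF Fin_gens(5)] Fin_gens(7) by (metis r_neg one_closed)
  show ?thesis using psi_simps(2)[OF z z] by simp
qed

lemma psi_inv_Pi: "\<psi> (inv\<^bsub>H\<^esub> (dPi N q v)) = inverse u_char"
proof -
  interpret monoid H by (rule monH)
  have "\<psi> (inv\<^bsub>H\<^esub> (dPi N q v)) * u_char = 1"
    using psi_simps(3)[OF Fin_gens(3,2)] Units_Pi by (simp add: psi_one psi_character)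
  then show ?thesis using u_char_nz by (simp add: field_simps)
qed

text \<open>The chosen \<psi> is not by definition the eigenvalue on w0, but both respect sums and
  products and agree on the generators.\<close>

lemma ev_Fin: "s \<in> Fin \<Longrightarrow> ev s = scale (\<psi> s) w0"
proof -
  have "s \<in> Fin \<and> ev s = scale (\<psi> s) w0" if "s \<in> Fin"
    using that unfolding fin_subalg_def
  proof (induct s rule: generate_ring.induct)
    case one
    show ?case using ev_one psi_one Fin_gens(5)[unfolded fin_subalg_def] by simp
  next
    case (incl h)
    moreover have "ev (scal N q v c) = scale c w0" for c by (simp add: ev_def sig_props act_gens)
    ultimately show ?case using ev_T ev_Pi ev_inv_Pi psi_character psi_inv_Pi psi_simps(1)
      by (auto intro: generate_ring.incl)
  next
    case (a_inv h)
    interpret ring H by (rule ring_daha)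
    have h: "h \<in> Fin" "ev h = scale (\<psi> h) w0" using a_inv unfolding fin_subalg_def by auto
    have "\<psi> (\<ominus>\<^bsub>H\<^esub> h) + \<psi> h = 0"
      using psi_simps(2)[OF Fin_gens(6)[OF h(1)] h(1)] Fin_closed[OF h(1)] by (simp add: l_neg psi_zero)
    then have "\<psi> (\<ominus>\<^bsub>H\<^esub> h) = - \<psi> h" by (simp add: eq_neg_iff_add_eq_0)
    then show ?case using h ev_uminus[OF Fin_closed[OF h(1)]] Fin_gens(6)[OF h(1)]
      by (simp add: scale_minus_left fin_subalg_def)
  next
    case (eng_add h1 h2)
    then have h: "h1 \<in> Fin" "h2 \<in> Fin" unfolding fin_subalg_def by auto
    then show ?case using eng_add ev_add[OF Fin_closed Fin_closed, OF h] psi_simps(2)[OF h] Fin_gens(7)[OF h]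
      by (simp add: scale_add_left fin_subalg_def)
  next
    case (eng_mult h1 h2)
    then have h: "h1 \<in> Fin" "h2 \<in> Fin" unfolding fin_subalg_def by auto
    have "ev (h1 \<otimes>\<^bsub>H\<^esub> h2) = act (\<sigma> h1) (scale (\<psi> h2) w0)"
      using ev_mult[OF Fin_closed Fin_closed, OF h] eng_mult by simp
    also have "\<dots> = scale (\<psi> (h1 \<otimes>\<^bsub>H\<^esub> h2)) w0"
      using eng_mult psi_simps(3)[OF h] by (simp add: lin_scale[OF lin_act] ev_def mult.commute)
    finally show ?case using Fin_gens(8)[OF h] by (simp add: fin_subalg_def)
  qed
  then show "s \<in> Fin \<Longrightarrow> ev s = scale (\<psi> s) w0" by blast
qed

section \<open>The subgroup of tensor relations\<close>

definition Kgen :: "daha_elt set" where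
  "Kgen = {(h \<otimes>\<^bsub>H\<^esub> s) \<ominus>\<^bsub>H\<^esub> (scal N q v (\<psi> s) \<otimes>\<^bsub>H\<^esub> h) |h s. h \<in> carrier H \<and> s \<in> Fin}"

definition K :: "daha_elt set" where "K = generate (add_monoid H) Kgen"

lemma Kgen_closed: "Kgen \<subseteq> carrier H"
proof -
  interpret ring H by (rule ring_daha)
  show ?thesis unfolding Kgen_def using Fin_closed scal_closed by auto
qed

lemma add_groupH: "group (add_monoid H)"
  using abelian_group.a_group[OF ring.is_abelian_group[OF ring_daha]] .

lemma K_subgroup: "subgroup K (add_monoid H)"
  unfolding K_def by (rule group.generate_is_subgroup[OF add_groupH]) (simp add: Kgen_closed)

lemma K_simps: "x \<in> K \<Longrightarrow> x \<in> carrier H" "\<zero>\<^bsub>H\<^esub> \<in> K" "x \<in> K \<Longrightarrow> y \<in> K \<Longrightarrow> x \<oplus>\<^bsub>H\<^esub> y \<in> K" "x \<in> K \<Longrightarrow> \<ominus>\<^bsub>H\<^esub> x \<in> K"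
  using subgroup.mem_carrier[OF K_subgroup] subgroup.one_closed[OF K_subgroup] subgroup.m_closed[OF K_subgroup]
    subgroup.m_inv_closed[OF K_subgroup] by (auto simp: a_inv_def)

lemma Kgen_in_K: "x \<in> Kgen \<Longrightarrow> x \<in> K" unfolding K_def by (rule generate.incl)

lemma K_induct [consumes 1, case_names zero gen uminus add]:
  assumes "x \<in> K" "P \<zero>\<^bsub>H\<^esub>" "\<And>x. x \<in> Kgen \<Longrightarrow> P x" "\<And>x. x \<in> carrier H \<Longrightarrow> P x \<Longrightarrow> P (\<ominus>\<^bsub>H\<^esub> x)"
    "\<And>x y. x \<in> K \<Longrightarrow> y \<in> K \<Longrightarrow> P x \<Longrightarrow> P y \<Longrightarrow> P (x \<oplus>\<^bsub>H\<^esub> y)"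
  shows "P x"
  using assms(1) unfolding K_def
proof (induct x rule: generate.induct)
  case (inv h)
  have "inv\<^bsub>add_monoid H\<^esub> h = \<ominus>\<^bsub>H\<^esub> h" by (simp add: a_inv_def)
  then show ?case using assms(3,4) inv Kgen_closed by auto
next
  case (eng h1 h2) then show ?case using assms(5) unfolding K_def by simp
qed (use assms in auto)

lemma K_ker: "x \<in> K \<Longrightarrow> ev x = 0"
proof (induct x rule: K_induct)
  case (gen x)
  interpret ring H by (rule ring_daha)
  from gen obtain h s where hs: "h \<in> carrier H" "s \<in> Fin" "x = (h \<otimes>\<^bsub>H\<^esub> s) \<ominus>\<^bsub>H\<^esub> (scal N q v (\<psi> s) \<otimes>\<^bsub>H\<^esub> h)"
    unfolding Kgen_def by blast
  have "ev (h \<otimes>\<^bsub>H\<^esub> s) = scale (\<psi> s) (ev h)"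
    using hs ev_Fin[OF hs(2)] ev_mult[OF hs(1) Fin_closed[OF hs(2)]] by (simp add: lin_scale[OF lin_act] ev_def)
  then show ?case using hs Fin_closed scal_closed by (simp add: ev_diff ev_scal)
qed (use K_simps in \<open>auto simp: ev_zero ev_uminus ev_add\<close>)

lemma scal_central: "h \<in> carrier H \<Longrightarrow> scal N q v c \<otimes>\<^bsub>H\<^esub> h = h \<otimes>\<^bsub>H\<^esub> scal N q v c"
  by (elim clE) (simp only: scal_def class_mult[symmetric] cp_car cp_mult)

text \<open>Scalars are central, so left multiplication by a turns the relation for (h, s) into the
  relation for (a h, s).\<close>

lemma K_left: "a \<in> carrier H \<Longrightarrow> x \<in> K \<Longrightarrow> a \<otimes>\<^bsub>H\<^esub> x \<in> K"
proof -
  interpret ring H by (rule ring_daha)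
  assume a: "a \<in> carrier H" and x: "x \<in> K"
  show ?thesis using x
  proof (induct x rule: K_induct)
    case (gen x)
    then obtain h s where hs: "h \<in> carrier H" "s \<in> Fin" "x = (h \<otimes>\<^bsub>H\<^esub> s) \<ominus>\<^bsub>H\<^esub> (scal N q v (\<psi> s) \<otimes>\<^bsub>H\<^esub> h)"
      unfolding Kgen_def by blast
    have sc: "scal N q v c \<in> carrier H" for c by (rule scal_closed)
    have "a \<otimes>\<^bsub>H\<^esub> (scal N q v (\<psi> s) \<otimes>\<^bsub>H\<^esub> h) = scal N q v (\<psi> s) \<otimes>\<^bsub>H\<^esub> (a \<otimes>\<^bsub>H\<^esub> h)"
      using a hs sc scal_central[OF a, of "\<psi> s"] by (metis m_assoc)
    then have "a \<otimes>\<^bsub>H\<^esub> x = ((a \<otimes>\<^bsub>H\<^esub> h) \<otimes>\<^bsub>H\<^esub> s) \<ominus>\<^bsub>H\<^esub> (scal N q v (\<psi> s) \<otimes>\<^bsub>H\<^esub> (a \<otimes>\<^bsub>H\<^esub> h))"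
      using a hs sc Fin_closed[OF hs(2)] by (simp add: a_minus_def r_distr r_minus m_assoc)
    then have "a \<otimes>\<^bsub>H\<^esub> x \<in> Kgen" unfolding Kgen_def using a hs by blast
    then show ?case by (rule Kgen_in_K)
  qed (use a K_simps in \<open>auto simp: r_minus r_distr\<close>)
qed

text \<open>The preimage of \<open>K\<close> in the free algebra, where the arithmetic is that of a
  type class and not of a record. It contains \<open>daha_ideal\<close>, and the quotient by it is
  the Cherednik module.\<close>

definition L :: "gen free_poly set" where "L = {p \<in> Fc. cl p \<in> K}"

lemma L_car: "p \<in> L \<Longrightarrow> p \<in> Fc" by (simp add: L_def)

lemma L_add: "p \<in> L \<Longrightarrow> r \<in> L \<Longrightarrow> p + r \<in> L"
  by (simp add: L_def car_add class_add K_simps)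

lemma L_left: "r \<in> Fc \<Longrightarrow> p \<in> L \<Longrightarrow> r * p \<in> L"
  by (simp add: L_def car_mult class_mult K_left class_closed)

lemma class_zero: "cl 0 = \<zero>\<^bsub>H\<^esub>"
proof -
  interpret ring H by (rule ring_daha)
  have "cl 0 \<in> carrier H" "cl 0 \<oplus>\<^bsub>H\<^esub> cl 0 = cl 0"
    using class_closed[OF car_zero] class_add[OF car_zero car_zero] by auto
  then show ?thesis by simp
qed

lemma L_zero: "0 \<in> L" by (simp add: L_def car_zero class_zero K_simps)

lemma L_class_eq: "p \<in> Fc \<Longrightarrow> r \<in> Fc \<Longrightarrow> cl p = cl r \<Longrightarrow> p - r \<in> L"
proof -
  assume a: "p \<in> Fc" "r \<in> Fc" "cl p = cl r"
  then have "p - r \<in> daha_ideal N q v" using class_eq_iff by blast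
  then have "cl (p - r) = cl 0" using a by (subst class_eq_iff) (auto intro: car_diff car_zero)
  then show ?thesis using a by (simp add: L_def car_diff class_zero K_simps)
qed

lemma L_Fin:
  assumes "p \<in> Fc" "cl p \<in> Fin" shows "p - cp (\<psi> (cl p)) \<in> L"
proof -
  interpret ring H by (rule ring_daha)
  have c: "p \<in> Fc" "cp (\<psi> (cl p)) \<in> Fc" using assms cp_car by auto
  have "cl (p - cp (\<psi> (cl p))) = cl p \<ominus>\<^bsub>H\<^esub> cl (cp (\<psi> (cl p)))"
  proof -
    define r where "r = cp (\<psi> (cl p))"
    have r: "r \<in> Fc" "p - r \<in> Fc" using c car_diff unfolding r_def by blast+
    have "cl (p - r) \<oplus>\<^bsub>H\<^esub> cl r = cl (p - r + r)" by (rule class_add[OF r(2,1), symmetric])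
    also have "p - r + r = p" by simp
    finally have e: "cl p = cl (p - r) \<oplus>\<^bsub>H\<^esub> cl r" ..
    have "cl (p - r) = (cl (p - r) \<oplus>\<^bsub>H\<^esub> cl r) \<ominus>\<^bsub>H\<^esub> cl r"
      using class_closed[OF r(1), of q v] class_closed[OF r(2), of q v] by (simp add: a_minus_def a_assoc r_neg)
    then show ?thesis unfolding e[symmetric] unfolding r_def .
  qed
  also have "\<dots> = (\<one>\<^bsub>H\<^esub> \<otimes>\<^bsub>H\<^esub> cl p) \<ominus>\<^bsub>H\<^esub> (scal N q v (\<psi> (cl p)) \<otimes>\<^bsub>H\<^esub> \<one>\<^bsub>H\<^esub>)"
    using class_closed[OF c(1)] class_closed[OF c(2)] by (simp add: scal_def)
  \<comment> \<open>The tensor relation with h = 1.\<close>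
  also have "\<dots> \<in> K" by (rule Kgen_in_K) (use assms in \<open>auto simp: Kgen_def\<close>)
  finally show ?thesis using c by (simp add: L_def car_diff)
qed

lemma L_Fin': "p \<in> Fc \<Longrightarrow> cl p = s \<Longrightarrow> s \<in> Fin \<Longrightarrow> \<psi> s = c \<Longrightarrow> p - cp c \<in> L"
  using L_Fin by blast

lemma L_gens: "i \<in> {1..<N} \<Longrightarrow> gp (TG i) - cp v \<in> L" "gp PiG - cp u_char \<in> L" "gp PiInvG - cp (inverse u_char) \<in> L"
proof -
  show "gp (TG i) - cp v \<in> L" if "i \<in> {1..<N}"
    by (rule L_Fin'[of _ "dT N q v i"]) (use that gp_car[of "TG i" N] Fin_gens(1) psi_character(2) in \<open>auto simp only: dT_def[symmetric] gens_simps\<close>)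
  show "gp PiG - cp u_char \<in> L"
    by (rule L_Fin'[of _ "dPi N q v"]) (use gp_car[of PiG N] Fin_gens(2) psi_character(3) in \<open>auto simp only: dPi_def[symmetric] gens_simps\<close>)
  show "gp PiInvG - cp (inverse u_char) \<in> L"
    by (rule L_Fin'[of _ "inv\<^bsub>H\<^esub> (dPi N q v)"]) (intro gp_car gens_simps inv_Pi[symmetric] Fin_gens psi_inv_Pi)+
qed

lemma ev_class_mult: "p \<in> Fc \<Longrightarrow> r \<in> Fc \<Longrightarrow> ev (cl (p * r)) = act (\<sigma> (cl p)) (ev (cl r))"
  by (simp add: class_mult ev_mult class_closed)

lemma ev_class_cp: "r \<in> Fc \<Longrightarrow> ev (cl (cp c * r)) = scale c (ev (cl r))"
  by (simp add: class_mult cp_car ev_scal[unfolded scal_def] class_closed)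

lemma ev_class_add: "p \<in> Fc \<Longrightarrow> r \<in> Fc \<Longrightarrow> ev (cl (p + r)) = ev (cl p) + ev (cl r)"
  by (simp add: class_add ev_add class_closed)

lemma ev_L: "p \<in> L \<Longrightarrow> ev (cl p) = 0"
  by (simp add: L_def K_ker)

end

section \<open>Monomials in the \<open>Y\<^sub>i\<close>\<close>

context daha_params
begin

lemma Fc_gens [simp]: "i \<in> {1..<N} \<Longrightarrow> gp (TG i) \<in> Fc" "gp PiG \<in> Fc" "gp PiInvG \<in> Fc"
    "j \<in> {1..N} \<Longrightarrow> gp (YG j) \<in> Fc" "j \<in> {1..N} \<Longrightarrow> gp (YInvG j) \<in> Fc" "cp c \<in> Fc"
  by (auto intro: gp_car cp_car)

lemmas Fc_intros = car_intros Fc_gens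

section \<open>Equality in H, written on representatives\<close>

definition ceq :: "gen free_poly \<Rightarrow> gen free_poly \<Rightarrow> bool" (infix "\<approx>" 50) where
  "p \<approx> r \<longleftrightarrow> p \<in> Fc \<and> r \<in> Fc \<and> cl p = cl r"

lemma ceq_refl: "p \<in> Fc \<Longrightarrow> p \<approx> p"
  and ceq_sym: "p \<approx> r \<Longrightarrow> r \<approx> p"
  and ceq_trans [trans]: "p \<approx> r \<Longrightarrow> r \<approx> s \<Longrightarrow> p \<approx> s"
  and ceq_mult: "p \<approx> r \<Longrightarrow> p' \<approx> r' \<Longrightarrow> p * p' \<approx> r * r'"
  and ceq_add: "p \<approx> r \<Longrightarrow> p' \<approx> r' \<Longrightarrow> p + p' \<approx> r + r'"
  by (auto simp: ceq_def car_mult class_mult car_add class_add)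

lemma ceq_multL: "s \<in> Fc \<Longrightarrow> p \<approx> r \<Longrightarrow> s * p \<approx> s * r"
  and ceq_multR: "s \<in> Fc \<Longrightarrow> p \<approx> r \<Longrightarrow> p * s \<approx> r * s"
  by (auto intro: ceq_mult ceq_refl)

lemma ceq_uminus: "p \<approx> r \<Longrightarrow> - p \<approx> - r"
  using ceq_multL[OF Fc_gens(6)[of "-1"]] by (simp add: cp_uminus cp_one)

lemma ceq_diff: "p \<approx> r \<Longrightarrow> p' \<approx> r' \<Longrightarrow> p - p' \<approx> r - r'"
  using ceq_add[OF _ ceq_uminus, of p r p' r'] by simp

lemma ceq_rel: "p \<in> Fc \<Longrightarrow> r \<in> Fc \<Longrightarrow> p - r \<in> daha_rels N q v \<Longrightarrow> p \<approx> r"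
  by (simp add: ceq_def class_relI)

text \<open>Used with x = Y_j and x = Y_i Y_{i+1} to carry commutation rules over to the
  inverses.\<close>

lemma ceq_inverse_commute:
  assumes "y * x \<approx> x * y'" "x * x' \<approx> 1" "x' * x \<approx> 1" "y \<in> Fc" "y' \<in> Fc" "x \<in> Fc" "x' \<in> Fc"
  shows "x' * y \<approx> y' * x'"
proof -
  have "x' * (y * (x * x')) \<approx> x' * (y * 1)"
    using assms by (intro ceq_multL) auto
  then have "x' * y \<approx> x' * (y * (x * x'))" by (simp add: ceq_sym)
  also have "x' * (y * (x * x')) = x' * (y * x) * x'" by (simp add: mult.assoc)
  also have "\<dots> \<approx> x' * (x * y') * x'"
    by (rule ceq_multR[OF assms(7) ceq_multL[OF assms(7,1)]])
  also have "x' * (x * y') * x' = (x' * x) * (y' * x')" by (simp add: mult.assoc)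
  also have "\<dots> \<approx> 1 * (y' * x')" using assms by (intro ceq_multR) (auto intro: car_mult)
  finally show ?thesis by simp
qed

lemma YYi: "i \<in> {1..N} \<Longrightarrow> gp (YG i) * gp (YInvG i) \<approx> 1" "i \<in> {1..N} \<Longrightarrow> gp (YInvG i) * gp (YG i) \<approx> 1"
  by (intro ceq_rel Fc_intros daha_rels_mem; assumption)+

lemma YY: "i \<in> {1..N} \<Longrightarrow> j \<in> {1..N} \<Longrightarrow> gp (YG i) * gp (YG j) \<approx> gp (YG j) * gp (YG i)"
  by (intro ceq_rel Fc_intros daha_rels_mem; assumption)

lemma YiY: "i \<in> {1..N} \<Longrightarrow> j \<in> {1..N} \<Longrightarrow> gp (YInvG i) * gp (YG j) \<approx> gp (YG j) * gp (YInvG i)"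
  by (rule ceq_inverse_commute[where x = "gp (YG i)"]) (auto intro: YY YYi)

lemma PiPi: "gp PiG * gp PiInvG \<approx> 1" "gp PiInvG * gp PiG \<approx> 1"
  by (intro ceq_rel Fc_intros daha_rels_mem)+

section \<open>Powers and ordered monomials\<close>

definition Yp :: "nat \<Rightarrow> int \<Rightarrow> gen free_poly" where
  "Yp i j = (if j \<ge> 0 then gp (YG i) ^ nat j else gp (YInvG i) ^ nat (- j))"

lemma Yp_car: "i \<in> {1..N} \<Longrightarrow> Yp i j \<in> Fc"
  unfolding Yp_def by (auto intro: car_power)

lemma Y_Yp_same:
  assumes i: "i \<in> {1..N}" shows "gp (YG i) * Yp i j \<approx> Yp i (j + 1)"
proof (cases "j \<ge> 0")
  case True
  then have "gp (YG i) * Yp i j = Yp i (j + 1)" by (simp add: Yp_def nat_add_distrib)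
  then show ?thesis using Yp_car[OF i] by (simp add: ceq_refl)
next
  case False
  then obtain k where k: "nat (- j) = Suc k" by (cases "nat (- j)") auto
  then have "nat (- (j + 1)) = k" "j + 1 \<ge> 0 \<Longrightarrow> k = 0" "j + 1 \<ge> 0 \<Longrightarrow> j + 1 = 0" using False by linarith+
  then have e: "Yp i (j + 1) = gp (YInvG i) ^ k" unfolding Yp_def by auto
  have "gp (YG i) * Yp i j = (gp (YG i) * gp (YInvG i)) * gp (YInvG i) ^ k"
    using False k by (simp add: Yp_def mult.assoc)
  also have "\<dots> \<approx> 1 * gp (YInvG i) ^ k" using i by (intro ceq_multR YYi car_power) auto
  finally show ?thesis unfolding e by simp
qed

lemma Y_power_commute:
  assumes i: "i \<in> {1..N}" and x: "x \<in> Fc" "gp (YG i) * x \<approx> x * gp (YG i)"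
  shows "gp (YG i) * x ^ k \<approx> x ^ k * gp (YG i)"
proof (induct k)
  case 0 then show ?case using i by (simp add: ceq_refl)
next
  case (Suc k)
  have "gp (YG i) * x ^ Suc k = (gp (YG i) * x) * x ^ k" by (simp add: mult.assoc)
  also have "\<dots> \<approx> (x * gp (YG i)) * x ^ k" by (intro ceq_multR car_power x)
  also have "(x * gp (YG i)) * x ^ k = x * (gp (YG i) * x ^ k)" by (simp add: mult.assoc)
  also have "\<dots> \<approx> x * (x ^ k * gp (YG i))" by (intro ceq_multL x Suc)
  finally show ?case by (simp add: mult.assoc)
qed

lemma Y_Yp: "i \<in> {1..N} \<Longrightarrow> j \<in> {1..N} \<Longrightarrow> gp (YG i) * Yp j e \<approx> Yp j e * gp (YG i)"
  unfolding Yp_def using YY[of i j] ceq_sym[OF YiY[of j i]] by (auto intro!: Y_power_commute)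

definition ymon :: "nat list \<Rightarrow> (nat \<Rightarrow> int) \<Rightarrow> gen free_poly" where
  "ymon xs k = prod_list (map (\<lambda>i. Yp i (k i)) xs)"

lemma ymon_car: "set xs \<subseteq> {1..N} \<Longrightarrow> ymon xs k \<in> Fc"
  unfolding ymon_def by (induct xs) (simp_all add: car_one car_mult Yp_car)

lemma Y_ymon:
  "distinct xs \<Longrightarrow> set xs \<subseteq> {1..N} \<Longrightarrow> i \<in> set xs \<Longrightarrow> gp (YG i) * ymon xs k \<approx> ymon xs (k(i := k i + 1))"
proof (induct xs)
  case (Cons x xs)
  have e: "ymon (x # xs) l = Yp x (l x) * ymon xs l" for l by (simp add: ymon_def)
  have i: "i \<in> {1..N}" using Cons.prems by auto
  have x: "x \<in> {1..N}" "set xs \<subseteq> {1..N}" using Cons.prems by auto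
  show ?case
  proof (cases "x = i")
    case True
    then have s: "ymon xs (k(i := k i + 1)) = ymon xs k" using Cons.prems by (auto simp: ymon_def intro!: arg_cong[of _ _ prod_list])
    have "(gp (YG i) * Yp i (k i)) * ymon xs k \<approx> Yp i (k i + 1) * ymon xs k"
      by (intro ceq_multR ymon_car x Y_Yp_same i)
    then show ?thesis unfolding e by (simp only: True s mult.assoc fun_upd_same)
  next
    case False
    have "gp (YG i) * ymon (x # xs) k = (gp (YG i) * Yp x (k x)) * ymon xs k" unfolding e by (simp add: mult.assoc)
    also have "\<dots> \<approx> (Yp x (k x) * gp (YG i)) * ymon xs k" by (intro ceq_multR ymon_car x Y_Yp i)
    also have "(Yp x (k x) * gp (YG i)) * ymon xs k = Yp x (k x) * (gp (YG i) * ymon xs k)" by (simp add: mult.assoc)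
    also have "\<dots> \<approx> Yp x (k x) * ymon xs (k(i := k i + 1))"
      using Cons False by (intro ceq_multL Yp_car x Cons.hyps) auto
    finally show ?thesis unfolding e using False by simp
  qed
qed simp

definition Ym :: "(nat \<Rightarrow> int) \<Rightarrow> gen free_poly" where "Ym = ymon [1..<N+1]"

lemma Ym_car [simp]: "Ym k \<in> Fc"
  unfolding Ym_def by (rule ymon_car) auto

lemma Y_Ym: "i \<in> {1..N} \<Longrightarrow> gp (YG i) * Ym k \<approx> Ym (k(i := k i + 1))"
  unfolding Ym_def by (rule Y_ymon) auto

lemma Yi_Ym:
  assumes i: "i \<in> {1..N}" shows "gp (YInvG i) * Ym k \<approx> Ym (k(i := k i - 1))"
proof -
  let ?k = "k(i := k i - 1)"
  have "gp (YG i) * Ym ?k \<approx> Ym k" using Y_Ym[OF i, of ?k] by simp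
  then have "gp (YInvG i) * Ym k \<approx> gp (YInvG i) * (gp (YG i) * Ym ?k)"
    by (rule ceq_multL[OF Fc_gens(5)[OF i] ceq_sym])
  also have "\<dots> = (gp (YInvG i) * gp (YG i)) * Ym ?k" by (simp add: mult.assoc)
  also have "\<dots> \<approx> 1 * Ym ?k" using i by (intro ceq_multR YYi) auto
  finally show ?thesis by simp
qed

lemma Ym_zero: "(\<And>i. i \<in> {1..N} \<Longrightarrow> k i = 0) \<Longrightarrow> Ym k = 1"
proof -
  assume "\<And>i. i \<in> {1..N} \<Longrightarrow> k i = 0"
  moreover have "prod_list (map (\<lambda>i. Yp i (k i)) xs) = 1" if "\<forall>i\<in>set xs. k i = 0" for xs
    using that by (induct xs) (simp_all add: Yp_def)
  ultimately show ?thesis unfolding Ym_def ymon_def by (simp del: upt_Suc)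
qed

section \<open>Commutation rules for T_i and pi with the Y_j\<close>

lemma TT_inverse: "i \<in> {1..<N} \<Longrightarrow> gp (TG i) * (gp (TG i) - cp cc) \<approx> 1"
  using class_T_inverse[of i] unfolding ceq_def dT_def
  by (auto simp: class_mult class_one car_diff car_mult car_one)

lemma TT: 
  assumes i: "i \<in> {1..<N}" shows "gp (TG i) * gp (TG i) \<approx> cp cc * gp (TG i) + 1"
proof -
  have "gp (TG i) * (gp (TG i) - cp cc) + cp cc * gp (TG i) \<approx> 1 + cp cc * gp (TG i)"
    using i by (intro ceq_add TT_inverse ceq_refl Fc_intros) auto
  moreover have "gp (TG i) * (gp (TG i) - cp cc) + cp cc * gp (TG i) = gp (TG i) * gp (TG i)"
    by (simp add: right_diff_distrib cp_mult[of cc])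
  ultimately show ?thesis by (simp add: add.commute)
qed

lemma TYT: "i \<in> {1..<N} \<Longrightarrow> gp (TG i) * gp (YG i) * gp (TG i) \<approx> gp (YG (i+1))"
  by (intro ceq_rel Fc_intros daha_rels_mem) auto

lemma TY_raw:
  assumes i: "i \<in> {1..<N}"
  shows "gp (TG i) * gp (YG i) \<approx> gp (YG (i+1)) * gp (TG i) - cp cc * gp (YG (i+1))"
proof -
  let ?t = "gp (TG i)"
  have c: "?t \<in> Fc" "gp (YG i) \<in> Fc" "?t - cp cc \<in> Fc" using i by (auto intro: car_diff)
  have "?t * gp (YG i) * (?t * (?t - cp cc)) \<approx> ?t * gp (YG i) * 1"
    using i c by (intro ceq_multL TT_inverse car_mult)
  then have "?t * gp (YG i) \<approx> ?t * gp (YG i) * (?t * (?t - cp cc))" by (simp add: ceq_sym)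
  also have "\<dots> = ?t * gp (YG i) * ?t * (?t - cp cc)" by (simp add: mult.assoc)
  also have "\<dots> \<approx> gp (YG (i+1)) * (?t - cp cc)" using i c by (intro ceq_multR TYT)
  also have "\<dots> = gp (YG (i+1)) * ?t - cp cc * gp (YG (i+1))" by (simp add: right_diff_distrib cp_mult[of cc])
  finally show ?thesis .
qed

lemma TY'_raw:
  assumes i: "i \<in> {1..<N}"
  shows "gp (TG i) * gp (YG (i+1)) \<approx> gp (YG i) * gp (TG i) + cp cc * gp (YG (i+1))"
proof -
  let ?t = "gp (TG i)"
  have c: "?t \<in> Fc" "gp (YG i) \<in> Fc" "gp (YG (i+1)) \<in> Fc" using i by (auto intro: car_diff)
  have "?t * gp (YG (i+1)) \<approx> ?t * (?t * gp (YG i) * ?t)"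
    using i c by (intro ceq_multL ceq_sym[OF TYT])
  also have "\<dots> = (?t * ?t) * (gp (YG i) * ?t)" by (simp add: mult.assoc)
  also have "\<dots> \<approx> (cp cc * ?t + 1) * (gp (YG i) * ?t)" using i c by (intro ceq_multR TT car_mult)
  also have "\<dots> = cp cc * (?t * gp (YG i) * ?t) + gp (YG i) * ?t" by (simp add: distrib_right mult.assoc)
  also have "\<dots> \<approx> cp cc * gp (YG (i+1)) + gp (YG i) * ?t"
    using i c by (intro ceq_add ceq_multL TYT ceq_refl car_mult) auto
  finally show ?thesis by (simp add: add.commute)
qed

lemma TY_far: "i \<in> {1..<N} \<Longrightarrow> j \<in> {1..N} \<Longrightarrow> j \<noteq> i \<Longrightarrow> j \<noteq> i + 1 \<Longrightarrow> gp (TG i) * gp (YG j) \<approx> gp (YG j) * gp (TG i)"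
  by (intro ceq_rel Fc_intros daha_rels_mem)

lemma TYi_far: "i \<in> {1..<N} \<Longrightarrow> j \<in> {1..N} \<Longrightarrow> j \<noteq> i \<Longrightarrow> j \<noteq> i + 1 \<Longrightarrow> gp (TG i) * gp (YInvG j) \<approx> gp (YInvG j) * gp (TG i)"
  by (rule ceq_sym[OF ceq_inverse_commute[OF TY_far YYi]]; (assumption | rule Fc_gens)+)

text \<open>The correction terms of \<open>TY_raw\<close> and \<open>TY'_raw\<close> cancel in the
  symmetric product.\<close>

lemma TYY:
  assumes i: "i \<in> {1..<N}"
  shows "gp (TG i) * (gp (YG i) * gp (YG (i+1))) \<approx> (gp (YG i) * gp (YG (i+1))) * gp (TG i)"
proof -
  let ?t = "gp (TG i)" let ?y = "gp (YG i)" let ?z = "gp (YG (i+1))"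
  have c: "?t \<in> Fc" "?y \<in> Fc" "?z \<in> Fc" "cp cc \<in> Fc" and ii: "i \<in> {1..N}" "i+1 \<in> {1..N}" using i by auto
  have "?t * (?y * ?z) = (?t * ?y) * ?z" by (simp add: mult.assoc)
  also have "\<dots> \<approx> (?z * ?t - cp cc * ?z) * ?z" by (intro ceq_multR c TY_raw i)
  also have "\<dots> = ?z * (?t * ?z) - cp cc * ?z * ?z" by (simp add: left_diff_distrib mult.assoc)
  also have "\<dots> \<approx> ?z * (?y * ?t + cp cc * ?z) - cp cc * ?z * ?z"
    by (intro ceq_diff ceq_multL c TY'_raw i ceq_refl car_mult)
  also have "\<dots> = (?z * ?y) * ?t"
  proof -
    have "?z * (cp cc * ?z) = (?z * cp cc) * ?z" by (simp only: mult.assoc)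
    also have "?z * cp cc = cp cc * ?z" by (rule cp_mult[symmetric])
    finally have "?z * (cp cc * ?z) = cp cc * ?z * ?z" .
    then show ?thesis by (simp add: distrib_left mult.assoc)
  qed
  also have "\<dots> \<approx> (?y * ?z) * ?t" by (intro ceq_multR c YY ii)
  finally show ?thesis .
qed

lemma YYi2:
  assumes "i \<in> {1..N}" "j \<in> {1..N}"
  shows "(gp (YG i) * gp (YG j)) * (gp (YInvG j) * gp (YInvG i)) \<approx> 1"
    "(gp (YInvG j) * gp (YInvG i)) * (gp (YG i) * gp (YG j)) \<approx> 1"
proof -
  have c: "gp (YG i) \<in> Fc" "gp (YG j) \<in> Fc" "gp (YInvG i) \<in> Fc" "gp (YInvG j) \<in> Fc" using assms by auto
  have "gp (YG i) * (gp (YG j) * gp (YInvG j)) * gp (YInvG i) \<approx> gp (YG i) * 1 * gp (YInvG i)"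
    by (intro ceq_multR ceq_multL c YYi assms)
  also have "gp (YG i) * 1 * gp (YInvG i) = gp (YG i) * gp (YInvG i)" by simp
  also have "\<dots> \<approx> 1" by (rule YYi[OF assms(1)])
  finally show "(gp (YG i) * gp (YG j)) * (gp (YInvG j) * gp (YInvG i)) \<approx> 1" by (simp add: mult.assoc)
  have "gp (YInvG j) * (gp (YInvG i) * gp (YG i)) * gp (YG j) \<approx> gp (YInvG j) * 1 * gp (YG j)"
    by (intro ceq_multR ceq_multL c YYi assms)
  also have "gp (YInvG j) * 1 * gp (YG j) = gp (YInvG j) * gp (YG j)" by simp
  also have "\<dots> \<approx> 1" by (rule YYi[OF assms(2)])
  finally show "(gp (YInvG j) * gp (YInvG i)) * (gp (YG i) * gp (YG j)) \<approx> 1" by (simp add: mult.assoc)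
qed

lemma TYYi:
  assumes i: "i \<in> {1..<N}"
  shows "gp (TG i) * (gp (YInvG (i+1)) * gp (YInvG i)) \<approx> (gp (YInvG (i+1)) * gp (YInvG i)) * gp (TG i)"
proof -
  have ii: "i \<in> {1..N}" "i + 1 \<in> {1..N}" using i by auto
  show ?thesis
    by (rule ceq_sym[OF ceq_inverse_commute[OF TYY[OF i] YYi2[OF ii]]]; (rule car_mult Fc_gens i ii)+)
qed

lemma PiY_raw:
  assumes i: "i \<in> {1..N}"
  shows "gp PiG * gp (YG i) \<approx> cp (if i = N then q else 1) * gp (YG (if i = N then 1 else i + 1)) * gp PiG"
proof -
  let ?r = "cp (if i = N then q else 1) * gp (YG (if i = N then 1 else i + 1))"
  have i': "(if i = N then 1 else i + 1) \<in> {1..N}" using i N by auto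
  have c: "gp (YG i) \<in> Fc" "?r \<in> Fc" using i i' by (auto intro!: car_mult Fc_gens(4))
  have "gp PiG * gp (YG i) * (gp PiInvG * gp PiG) \<approx> gp PiG * gp (YG i) * 1"
    by (intro ceq_multL PiPi car_mult c Fc_gens)
  then have "gp PiG * gp (YG i) \<approx> gp PiG * gp (YG i) * (gp PiInvG * gp PiG)" by (simp add: ceq_sym)
  also have "\<dots> = gp PiG * gp (YG i) * gp PiInvG * gp PiG" by (simp add: mult.assoc)
  also have "\<dots> \<approx> ?r * gp PiG"
    by (intro ceq_multR ceq_rel daha_rels_mem i car_mult c Fc_gens)
  finally show ?thesis .
qed

end

section \<open>Spans of monomials modulo the tensor relations\<close>

context daha_sigma
begin

text \<open>As all of \<open>L\<close> is included, membership says that modulo \<open>L\<close> the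
  element is a combination of monomials with exponents in S.\<close>

inductive_set mon_span :: "(nat \<Rightarrow> int) set \<Rightarrow> gen free_poly set" for S where
  mon_span_L: "p \<in> L \<Longrightarrow> p \<in> mon_span S"
| mon_span_mon: "k \<in> S \<Longrightarrow> Ym k \<in> mon_span S"
| mon_span_add: "p \<in> mon_span S \<Longrightarrow> r \<in> mon_span S \<Longrightarrow> p + r \<in> mon_span S"
| mon_span_scale: "p \<in> mon_span S \<Longrightarrow> cp c * p \<in> mon_span S"

lemma mon_span_car: "p \<in> mon_span S \<Longrightarrow> p \<in> Fc"
  by (induct p rule: mon_span.induct) (simp_all add: L_car car_add car_mult)

lemma mon_span_mono: "p \<in> mon_span S \<Longrightarrow> S \<subseteq> S' \<Longrightarrow> p \<in> mon_span S'"
  by (induct p rule: mon_span.induct) (auto intro: mon_span.intros)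

lemma mon_span_diff: "p \<in> mon_span S \<Longrightarrow> r \<in> mon_span S \<Longrightarrow> p - r \<in> mon_span S"
proof -
  assume a: "p \<in> mon_span S" "r \<in> mon_span S"
  have "p + cp (-1) * r \<in> mon_span S" by (intro mon_span_add mon_span_scale a)
  then show ?thesis by (simp add: cp_uminus cp_one)
qed

lemma mon_span_eqL: "p - r \<in> L \<Longrightarrow> r \<in> mon_span S \<Longrightarrow> p \<in> mon_span S"
proof -
  assume a: "p - r \<in> L" "r \<in> mon_span S"
  have "(p - r) + r \<in> mon_span S" by (intro mon_span_add mon_span_L a)
  then show ?thesis by simp
qed

lemma mon_span_ceq: "p \<approx> r \<Longrightarrow> r \<in> mon_span S \<Longrightarrow> p \<in> mon_span S"
  by (rule mon_span_eqL[OF L_class_eq]) (auto simp: ceq_def)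

lemma mon_span_map:
  assumes g: "g \<in> Fc" and mon: "\<And>k. k \<in> S \<Longrightarrow> g * Ym k \<in> mon_span S'" and p: "p \<in> mon_span S"
  shows "g * p \<in> mon_span S'"
  using p
proof (induct p rule: mon_span.induct)
  case (mon_span_scale p c)
  have "g * (cp c * p) = cp c * (g * p)" by (simp only: mult.assoc[symmetric] cp_mult[of c g])
  then show ?case using mon_span_scale by (simp add: mon_span.mon_span_scale)
qed (use g mon in \<open>auto intro: mon_span.intros L_left simp: distrib_left\<close>)

lemma mon_span_Y: "i \<in> {1..N} \<Longrightarrow> p \<in> mon_span S \<Longrightarrow> (\<And>k. k \<in> S \<Longrightarrow> k(i := k i + 1) \<in> S') \<Longrightarrow> gp (YG i) * p \<in> mon_span S'"
  by (rule mon_span_map[OF Fc_gens(4)]) (assumption, rule mon_span_ceq[OF Y_Ym mon_span_mon])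

lemma mon_span_Yi: "i \<in> {1..N} \<Longrightarrow> p \<in> mon_span S \<Longrightarrow> (\<And>k. k \<in> S \<Longrightarrow> k(i := k i - 1) \<in> S') \<Longrightarrow> gp (YInvG i) * p \<in> mon_span S'"
  by (rule mon_span_map[OF Fc_gens(5)]) (assumption, rule mon_span_ceq[OF Yi_Ym mon_span_mon])

lemma mon_span_coeffs:
  assumes "finite S" "p \<in> mon_span S" shows "\<exists>c. p - (\<Sum>k\<in>S. cp (c k) * Ym k) \<in> L"
  using assms(2)
proof (induct p rule: mon_span.induct)
  case (mon_span_L p) then show ?case by (intro exI[of _ "\<lambda>_. 0"]) simp
next
  case (mon_span_mon k)
  have "(\<Sum>l\<in>S. cp (if l = k then 1 else 0) * Ym l) = (\<Sum>l\<in>S. if l = k then Ym k else 0)"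
    by (rule sum.cong) (auto simp: cp_one)
  then show ?case using assms(1) mon_span_mon L_zero by (intro exI[of _ "\<lambda>l. if l = k then 1 else 0"]) simp
next
  case (mon_span_add p r)
  then obtain c d where "p - (\<Sum>k\<in>S. cp (c k) * Ym k) \<in> L" "r - (\<Sum>k\<in>S. cp (d k) * Ym k) \<in> L" by blast
  from L_add[OF this] show ?case
    by (intro exI[of _ "\<lambda>k. c k + d k"]) (simp add: cp_add distrib_right sum.distrib add_diff_add)
next
  case (mon_span_scale p c)
  then obtain d where "p - (\<Sum>k\<in>S. cp (d k) * Ym k) \<in> L" by blast
  from L_left[OF cp_car this, of c] show ?case
    by (intro exI[of _ "\<lambda>k. c * d k"]) (simp add: cp_times right_diff_distrib sum_distrib_left mult.assoc)
qed

section \<open>T_i on monomials\<close>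

definition weight :: "(nat \<Rightarrow> int) \<Rightarrow> nat" where "weight k = (\<Sum>i\<in>{1..N}. nat \<bar>k i\<bar>)"

lemma weight_upd: "j \<in> {1..N} \<Longrightarrow> weight (k(j := x)) + nat \<bar>k j\<bar> = weight k + nat \<bar>x\<bar>"
  unfolding weight_def by (subst (1 2) sum.remove[of _ j]) auto

lemma weight_dec: "j \<in> {1..N} \<Longrightarrow> \<bar>x\<bar> < \<bar>k j\<bar> \<Longrightarrow> weight (k(j := x)) < weight k"
  using weight_upd[of j k x] by linarith

lemma eqL_mult: "p \<approx> r \<Longrightarrow> r - s \<in> L \<Longrightarrow> p - s \<in> L"
  using L_add[OF L_class_eq, of p r "r - s"] by (auto simp: ceq_def)

text \<open>Passes the eigenvalue v of T_i from p to g p when g commutes with T_i. The factors g are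
  Y_j and Y_j^-1 for j away from i, and Y_i Y_{i+1} and its inverse.\<close>

lemma T_commute_Ym_step:
  assumes g: "g \<in> Fc" "gp (TG i) * g \<approx> g * gp (TG i)" and i: "i \<in> {1..<N}" and p: "p \<in> Fc"
    and k: "k \<approx> g * p" and IH: "gp (TG i) * p - cp v * p \<in> L"
  shows "gp (TG i) * k - cp v * k \<in> L"
proof -
  have t: "gp (TG i) \<in> Fc" using i by simp
  have "gp (TG i) * k \<approx> gp (TG i) * (g * p)" by (intro ceq_multL t k)
  also have "\<dots> = (gp (TG i) * g) * p" by (simp add: mult.assoc)
  also have "\<dots> \<approx> (g * gp (TG i)) * p" by (intro ceq_multR g p)
  also have "\<dots> = g * (gp (TG i) * p)" by (simp add: mult.assoc)
  finally have 1: "gp (TG i) * k \<approx> g * (gp (TG i) * p)" .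
  have "g * (gp (TG i) * p) - g * (cp v * p) \<in> L"
    using L_left[OF g(1) IH] by (simp add: right_diff_distrib)
  moreover have "g * (cp v * p) = cp v * (g * p)" by (simp only: mult.assoc[symmetric] cp_mult[of v g])
  ultimately have 2: "gp (TG i) * k - cp v * (g * p) \<in> L" using eqL_mult[OF 1] by simp
  have "cp v * k \<approx> cp v * (g * p)" by (intro ceq_multL k Fc_gens)
  then have "cp v * (g * p) - cp v * k \<in> L" by (intro L_class_eq) (auto simp: ceq_def)
  from L_add[OF 2 this] show ?thesis by simp
qed

text \<open>A monomial with equal exponents at i and i + 1 is built from 1 by factors that commute
  with T_i, and on 1 the tensor relations give v.\<close>

lemma T_Ym_diag:
  assumes i: "i \<in> {1..<N}" and "k i = k (i+1)"
  shows "gp (TG i) * Ym k - cp v * Ym k \<in> L"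
  using assms(2)
proof (induct "weight k" arbitrary: k rule: less_induct)
  case less
  have ii: "i \<in> {1..N}" "i + 1 \<in> {1..N}" "i + 1 \<noteq> i" using i by auto
  show ?case
  proof (cases "\<exists>j\<in>{1..N}. k j \<noteq> 0")
    case False
    then have "Ym k = 1" by (intro Ym_zero) auto
    then show ?thesis using L_gens(1)[OF i] by simp
  next
    case True
    then obtain j where j: "j \<in> {1..N}" "k j \<noteq> 0" by blast
    consider "j \<noteq> i" "j \<noteq> i + 1" "k j > 0" | "j \<noteq> i" "j \<noteq> i + 1" "k j < 0"
      | "k i > 0" | "k i < 0" using j less(2) by (metis linorder_neqE_linordered_idom)
    then show ?thesis
    proof cases
      case 1
      let ?k = "k(j := k j - 1)"
      have IH: "gp (TG i) * Ym ?k - cp v * Ym ?k \<in> L"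
        by (rule less(1)) (use 1 j less(2) in \<open>auto intro!: weight_dec\<close>)
      have "Ym k \<approx> gp (YG j) * Ym ?k" using ceq_sym[OF Y_Ym[OF j(1), of ?k]] by simp
      then show ?thesis by (rule T_commute_Ym_step[OF Fc_gens(4)[OF j(1)] TY_far[OF i j(1) 1(1,2)] i Ym_car _ IH])
    next
      case 2
      let ?k = "k(j := k j + 1)"
      have IH: "gp (TG i) * Ym ?k - cp v * Ym ?k \<in> L"
        by (rule less(1)) (use 2 j less(2) in \<open>auto intro!: weight_dec\<close>)
      have "Ym k \<approx> gp (YInvG j) * Ym ?k" using ceq_sym[OF Yi_Ym[OF j(1), of ?k]] by simp
      then show ?thesis by (rule T_commute_Ym_step[OF Fc_gens(5)[OF j(1)] TYi_far[OF i j(1) 2(1,2)] i Ym_car _ IH])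
    next
      case 3
      let ?l = "k(i+1 := k (i+1) - 1)" let ?k = "?l(i := k i - 1)"
      have "weight ?k < weight ?l" using 3 ii by (intro weight_dec) auto
      also have "weight ?l < weight k" using 3 ii less(2) by (intro weight_dec) auto
      finally have IH: "gp (TG i) * Ym ?k - cp v * Ym ?k \<in> L"
        using less(2) by (intro less(1)) auto
      have "gp (YG i) * Ym ?k \<approx> Ym ?l" using Y_Ym[OF ii(1), of ?k] by (simp add: fun_upd_idem)
      then have "gp (YG (i+1)) * (gp (YG i) * Ym ?k) \<approx> gp (YG (i+1)) * Ym ?l" by (intro ceq_multL Fc_gens ii)
      also have "\<dots> \<approx> Ym k" using Y_Ym[OF ii(2), of ?l] by simp
      finally have "Ym k \<approx> (gp (YG (i+1)) * gp (YG i)) * Ym ?k" by (simp add: ceq_sym mult.assoc)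
      also have "\<dots> \<approx> (gp (YG i) * gp (YG (i+1))) * Ym ?k" by (intro ceq_multR YY ii Ym_car)
      finally have "Ym k \<approx> (gp (YG i) * gp (YG (i+1))) * Ym ?k" .
      then show ?thesis by (rule T_commute_Ym_step[OF car_mult[OF Fc_gens(4)[OF ii(1)] Fc_gens(4)[OF ii(2)]] TYY[OF i] i Ym_car _ IH])
    next
      case 4
      let ?l = "k(i+1 := k (i+1) + 1)" let ?k = "?l(i := k i + 1)"
      have "weight ?k < weight ?l" using 4 ii by (intro weight_dec) auto
      also have "weight ?l < weight k" using 4 ii less(2) by (intro weight_dec) auto
      finally have IH: "gp (TG i) * Ym ?k - cp v * Ym ?k \<in> L"
        using less(2) by (intro less(1)) auto
      have "gp (YInvG i) * Ym ?k \<approx> Ym ?l" using Yi_Ym[OF ii(1), of ?k] by (simp add: fun_upd_idem)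
      then have "gp (YInvG (i+1)) * (gp (YInvG i) * Ym ?k) \<approx> gp (YInvG (i+1)) * Ym ?l" by (intro ceq_multL Fc_gens ii)
      also have "\<dots> \<approx> Ym k" using Yi_Ym[OF ii(2), of ?l] by simp
      finally have "Ym k \<approx> (gp (YInvG (i+1)) * gp (YInvG i)) * Ym ?k" by (simp add: ceq_sym mult.assoc)
      then show ?thesis by (rule T_commute_Ym_step[OF car_mult[OF Fc_gens(5)[OF ii(2)] Fc_gens(5)[OF ii(1)]] TYYi[OF i] i Ym_car _ IH])
    qed
  qed
qed

text \<open>For k i > k (i+1) the interval is half-open and excludes k itself.
  \<open>moving_profile_step\<close> depends on this strictness.\<close>

definition T_support :: "nat \<Rightarrow> (nat \<Rightarrow> int) \<Rightarrow> (nat \<Rightarrow> int) set" where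
  "T_support i k = {l. (\<forall>j. j \<noteq> i \<and> j \<noteq> i+1 \<longrightarrow> l j = k j) \<and> l i + l (i+1) = k i + k (i+1) \<and>
    (if k i > k (i+1) then k (i+1) \<le> l i \<and> l i < k i else k i \<le> l i \<and> l i \<le> k (i+1))}"

text \<open>Induction on the distance of the two exponents: \<open>TY_raw\<close> or
  \<open>TY'_raw\<close> strips one Y, down to the symmetric case \<open>T_Ym_diag\<close>.\<close>

lemma T_Ym:
  assumes i: "i \<in> {1..<N}" shows "gp (TG i) * Ym k \<in> mon_span (T_support i k)"
proof (induct "nat \<bar>k i - k (i+1)\<bar>" arbitrary: k rule: less_induct)
  case less
  have ii: "i \<in> {1..N}" "i + 1 \<in> {1..N}" "i + 1 \<noteq> i" using i by auto
  have t: "gp (TG i) \<in> Fc" using i by simp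
  consider "k i = k (i+1)" | "k i > k (i+1)" | "k i < k (i+1)" by linarith
  then show ?case
  proof cases
    case 1
    then have "k \<in> T_support i k" by (simp add: T_support_def)
    then show ?thesis by (intro mon_span_eqL[OF T_Ym_diag[OF i 1]] mon_span_scale mon_span_mon)
  next
    case 2
    let ?k = "k(i := k i - 1)"
    have "gp (TG i) * Ym ?k \<in> mon_span (T_support i ?k)" by (rule less) (use 2 ii in auto)
    then have 1: "gp (YG (i+1)) * (gp (TG i) * Ym ?k) \<in> mon_span (T_support i k)"
      by (rule mon_span_Y[OF ii(2)]) (use 2 ii(3) in \<open>auto simp: T_support_def split: if_splits\<close>)
    have kk: "?k(i+1 := ?k (i+1) + 1) \<in> T_support i k" using 2 ii(3) by (auto simp: T_support_def)
    have 2: "gp (YG (i+1)) * Ym ?k \<in> mon_span (T_support i k)"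
      by (rule mon_span_ceq[OF Y_Ym[OF ii(2)] mon_span_mon[OF kk]])
    have "Ym k \<approx> gp (YG i) * Ym ?k" using ceq_sym[OF Y_Ym[OF ii(1), of ?k]] by simp
    then have "gp (TG i) * Ym k \<approx> gp (TG i) * (gp (YG i) * Ym ?k)" by (intro ceq_multL t)
    also have "\<dots> = (gp (TG i) * gp (YG i)) * Ym ?k" by (simp add: mult.assoc)
    also have "\<dots> \<approx> (gp (YG (i+1)) * gp (TG i) - cp cc * gp (YG (i+1))) * Ym ?k"
      by (intro ceq_multR TY_raw i Ym_car)
    also have "\<dots> = gp (YG (i+1)) * (gp (TG i) * Ym ?k) - cp cc * (gp (YG (i+1)) * Ym ?k)"
      by (simp add: left_diff_distrib mult.assoc)
    finally show ?thesis by (rule mon_span_ceq) (intro mon_span_diff mon_span_scale 1 2)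
  next
    case 3
    let ?k = "k(i+1 := k (i+1) - 1)"
    have "gp (TG i) * Ym ?k \<in> mon_span (T_support i ?k)" by (rule less) (use 3 ii in auto)
    then have 1: "gp (YG i) * (gp (TG i) * Ym ?k) \<in> mon_span (T_support i k)"
      by (rule mon_span_Y[OF ii(1)]) (use 3 ii(3) in \<open>auto simp: T_support_def split: if_splits\<close>)
    have kk: "k \<in> T_support i k" using 3 by (auto simp: T_support_def)
    have k: "gp (YG (i+1)) * Ym ?k \<approx> Ym k" using Y_Ym[OF ii(2), of ?k] by simp
    have 2: "gp (YG (i+1)) * Ym ?k \<in> mon_span (T_support i k)"
      by (rule mon_span_ceq[OF k mon_span_mon[OF kk]])
    have "gp (TG i) * Ym k \<approx> gp (TG i) * (gp (YG (i+1)) * Ym ?k)" by (intro ceq_multL t ceq_sym[OF k])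
    also have "\<dots> = (gp (TG i) * gp (YG (i+1))) * Ym ?k" by (simp add: mult.assoc)
    also have "\<dots> \<approx> (gp (YG i) * gp (TG i) + cp cc * gp (YG (i+1))) * Ym ?k"
      by (intro ceq_multR TY'_raw i Ym_car)
    also have "\<dots> = gp (YG i) * (gp (TG i) * Ym ?k) + cp cc * (gp (YG (i+1)) * Ym ?k)"
      by (simp add: distrib_right mult.assoc)
    finally show ?thesis by (rule mon_span_ceq) (intro mon_span_add mon_span_scale 1 2)
  qed
qed

lemma mon_span_T: "i \<in> {1..<N} \<Longrightarrow> p \<in> mon_span S \<Longrightarrow> (\<And>k. k \<in> S \<Longrightarrow> T_support i k \<subseteq> S') \<Longrightarrow> gp (TG i) * p \<in> mon_span S'"
  by (rule mon_span_map[OF Fc_gens(1)]) (assumption, rule mon_span_mono[OF T_Ym])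

section \<open>Boxes of exponents and the reduction of every element to monomials\<close>

definition Box :: "int \<Rightarrow> int \<Rightarrow> (nat \<Rightarrow> int) set" where
  "Box a b = {k. (\<forall>i\<in>{1..N}. a \<le> k i \<and> k i \<le> b) \<and> (\<forall>i. i \<notin> {1..N} \<longrightarrow> k i = 0)}"

lemma Box_mono: "a' \<le> a \<Longrightarrow> b \<le> b' \<Longrightarrow> Box a b \<subseteq> Box a' b'"
  by (force simp: Box_def)

lemma T_support_Box: "i \<in> {1..<N} \<Longrightarrow> k \<in> Box a b \<Longrightarrow> T_support i k \<subseteq> Box a b"
proof
  fix l assume i: "i \<in> {1..<N}" and k: "k \<in> Box a b" and l: "l \<in> T_support i k"
  have kk: "a \<le> k i" "k i \<le> b" "a \<le> k (i+1)" "k (i+1) \<le> b" using i k by (auto simp: Box_def)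
  have "a \<le> l i \<and> l i \<le> b \<and> a \<le> l (i+1) \<and> l (i+1) \<le> b"
    using l kk by (auto simp: T_support_def split: if_splits)
  moreover have "l j = k j" if "j \<noteq> i" "j \<noteq> i + 1" for j using l that by (auto simp: T_support_def)
  moreover have "i \<in> {1..N}" "i + 1 \<in> {1..N}" using i by auto
  ultimately show "l \<in> Box a b" using k unfolding Box_def by (smt (verit) mem_Collect_eq)
qed

lemma finite_Box: "finite (Box a b)"
proof -
  have "Box a b \<subseteq> {k. \<forall>i. (i \<in> {1..N} \<longrightarrow> k i \<in> {a..b}) \<and> (i \<notin> {1..N} \<longrightarrow> k i = 0)}"
    by (auto simp: Box_def)
  then show ?thesis by (rule finite_subset) (intro finite_set_of_finite_funs; simp)
qed

text \<open>The polynomials that reduce to monomials modulo \<open>L\<close>; by \<open>Fc_U\<close>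
  these are all. The box makes the finite set of exponents explicit for the dimension count.\<close>

definition U :: "gen free_poly set" where "U = (\<Union>b\<in>{0..}. mon_span (Box (- b) b))"

lemma U_I: "p \<in> mon_span (Box (- b) b) \<Longrightarrow> 0 \<le> b \<Longrightarrow> p \<in> U" by (auto simp: U_def)

lemma U_E: assumes "p \<in> U" obtains b where "0 \<le> b" "p \<in> mon_span (Box (- b) b)"
  using assms by (auto simp: U_def)

lemma U_add: "p \<in> U \<Longrightarrow> r \<in> U \<Longrightarrow> p + r \<in> U"
proof (elim U_E)
  fix b c :: int assume a: "0 \<le> b" "p \<in> mon_span (Box (- b) b)" "0 \<le> c" "r \<in> mon_span (Box (- c) c)"
  have "p \<in> mon_span (Box (- max b c) (max b c))" "r \<in> mon_span (Box (- max b c) (max b c))"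
    by (rule mon_span_mono[OF a(2) Box_mono] mon_span_mono[OF a(4) Box_mono]; simp)+
  then have "p + r \<in> mon_span (Box (- max b c) (max b c))" by (rule mon_span_add)
  then show "p + r \<in> U" by (rule U_I) (use a in simp)
qed

lemma U_scale: "p \<in> U \<Longrightarrow> cp c * p \<in> U"
  by (elim U_E) (auto intro: U_I mon_span_scale)

lemma U_eqL: "p - r \<in> L \<Longrightarrow> r \<in> U \<Longrightarrow> p \<in> U"
  by (elim U_E) (auto intro: U_I mon_span_eqL)

lemma U_ceq: "p \<approx> r \<Longrightarrow> r \<in> U \<Longrightarrow> p \<in> U"
  by (elim U_E) (auto intro: U_I mon_span_ceq)

lemma U_T: "i \<in> {1..<N} \<Longrightarrow> p \<in> U \<Longrightarrow> gp (TG i) * p \<in> U"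
  by (elim U_E) (rule U_I[OF mon_span_T], auto intro: T_support_Box[THEN subsetD])

lemma U_Y: "i \<in> {1..N} \<Longrightarrow> p \<in> U \<Longrightarrow> gp (YG i) * p \<in> U"
proof (elim U_E)
  fix b :: int assume a: "i \<in> {1..N}" "0 \<le> b" "p \<in> mon_span (Box (- b) b)"
  have "gp (YG i) * p \<in> mon_span (Box (- (b+1)) (b+1))"
    by (rule mon_span_Y[OF a(1,3)]) (use a in \<open>force simp: Box_def\<close>)
  then show ?thesis by (rule U_I) (use a in simp)
qed

lemma U_Yi: "i \<in> {1..N} \<Longrightarrow> p \<in> U \<Longrightarrow> gp (YInvG i) * p \<in> U"
proof (elim U_E)
  fix b :: int assume a: "i \<in> {1..N}" "0 \<le> b" "p \<in> mon_span (Box (- b) b)"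
  have "gp (YInvG i) * p \<in> mon_span (Box (- (b+1)) (b+1))"
    by (rule mon_span_Yi[OF a(1,3)]) (use a in \<open>force simp: Box_def\<close>)
  then show ?thesis by (rule U_I) (use a in simp)
qed

lemma Ym_U: "(\<And>i. i \<notin> {1..N} \<Longrightarrow> k i = 0) \<Longrightarrow> Ym k \<in> U"
proof -
  assume z: "\<And>i. i \<notin> {1..N} \<Longrightarrow> k i = 0"
  have "\<bar>k i\<bar> \<le> int (weight k)" if "i \<in> {1..N}" for i
  proof -
    have "nat \<bar>k i\<bar> \<le> weight k" unfolding weight_def using that by (intro member_le_sum) auto
    then show ?thesis by linarith
  qed
  then have "k \<in> Box (- int (weight k)) (int (weight k))" using z unfolding Box_def by (auto simp: abs_le_iff) (smt (verit))+
  then show ?thesis by (intro U_I[OF mon_span_mon]) auto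
qed

lemma U_one: "1 \<in> U"
  using Ym_U[of "\<lambda>_. 0"] Ym_zero[of "\<lambda>_. 0"] by simp

text \<open>Moving a generator \<open>g\<close> past the monomials reduces its action to its action on \<open>1\<close>.\<close>

lemma U_push:
  assumes g: "g \<in> Fc" and one: "g \<in> U"
    and Y: "\<And>i. i \<in> {1..N} \<Longrightarrow> \<exists>c j. j \<in> {1..N} \<and> g * gp (YG i) \<approx> cp c * gp (YG j) * g"
    and Yi: "\<And>i. i \<in> {1..N} \<Longrightarrow> \<exists>c j. j \<in> {1..N} \<and> g * gp (YInvG i) \<approx> cp c * gp (YInvG j) * g"
    and p: "p \<in> U"
  shows "g * p \<in> U"
proof -
  have mon: "g * Ym k \<in> U" for k
  proof (induct "weight k" arbitrary: k rule: less_induct)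
    case less
    show ?case
    proof (cases "\<exists>j\<in>{1..N}. k j \<noteq> 0")
      case False
      then have "Ym k = 1" by (intro Ym_zero) auto
      then show ?thesis using one by simp
    next
      case True
      then obtain j where j: "j \<in> {1..N}" "k j \<noteq> 0" by blast
      show ?thesis
      proof (cases "k j > 0")
        case True
        let ?k = "k(j := k j - 1)"
        obtain c i where ci: "i \<in> {1..N}" "g * gp (YG j) \<approx> cp c * gp (YG i) * g" using Y[OF j(1)] by blast
        have IH: "g * Ym ?k \<in> U" by (rule less) (use True j in \<open>auto intro!: weight_dec\<close>)
        have "Ym k \<approx> gp (YG j) * Ym ?k" using ceq_sym[OF Y_Ym[OF j(1), of ?k]] by simp
        then have "g * Ym k \<approx> g * (gp (YG j) * Ym ?k)" by (intro ceq_multL g)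
        also have "\<dots> = (g * gp (YG j)) * Ym ?k" by (simp add: mult.assoc)
        also have "\<dots> \<approx> (cp c * gp (YG i) * g) * Ym ?k" by (intro ceq_multR ci Ym_car)
        also have "\<dots> = cp c * (gp (YG i) * (g * Ym ?k))" by (simp add: mult.assoc)
        finally show ?thesis by (rule U_ceq) (intro U_scale U_Y ci IH)
      next
        case False
        let ?k = "k(j := k j + 1)"
        obtain c i where ci: "i \<in> {1..N}" "g * gp (YInvG j) \<approx> cp c * gp (YInvG i) * g" using Yi[OF j(1)] by blast
        have IH: "g * Ym ?k \<in> U" by (rule less) (use False j in \<open>auto intro!: weight_dec\<close>)
        have "Ym k \<approx> gp (YInvG j) * Ym ?k" using ceq_sym[OF Yi_Ym[OF j(1), of ?k]] by simp
        then have "g * Ym k \<approx> g * (gp (YInvG j) * Ym ?k)" by (intro ceq_multL g)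
        also have "\<dots> = (g * gp (YInvG j)) * Ym ?k" by (simp add: mult.assoc)
        also have "\<dots> \<approx> (cp c * gp (YInvG i) * g) * Ym ?k" by (intro ceq_multR ci Ym_car)
        also have "\<dots> = cp c * (gp (YInvG i) * (g * Ym ?k))" by (simp add: mult.assoc)
        finally show ?thesis by (rule U_ceq) (intro U_scale U_Yi ci IH)
      qed
    qed
  qed
  from p obtain b where "p \<in> mon_span (Box (- b) b)" by (rule U_E)
  then show ?thesis
  proof (induct p rule: mon_span.induct)
    case (mon_span_L p)
    then show ?case using U_eqL[of "g * p" 0] L_left[OF g] L_zero U_I[OF mon_span.mon_span_L, of 0 0] by simp
  next
    case (mon_span_scale p c)
    have "g * (cp c * p) = cp c * (g * p)" by (simp only: mult.assoc[symmetric] cp_mult[of c g])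
    then show ?case using mon_span_scale by (simp add: U_scale)
  qed (auto simp: distrib_left intro: U_add mon)
qed

lemma cp_U: "cp c \<in> U" using U_scale[OF U_one, of c] by simp

lemma Yi_conj:
  assumes "g * gp (YG i) \<approx> cp c * gp (YG j) * g" "c \<noteq> 0" "g \<in> Fc" "i \<in> {1..N}" "j \<in> {1..N}"
  shows "g * gp (YInvG i) \<approx> cp (inverse c) * gp (YInvG j) * g"
proof -
  have f: "gp (YG i) \<in> Fc" "gp (YInvG i) \<in> Fc" "gp (YInvG j) \<in> Fc" "cp (inverse c) \<in> Fc" "cp c \<in> Fc" using assms by auto
  have cc: "cp (inverse c) * cp c = 1" using assms(2) by (simp add: cp_times[symmetric] cp_one)
  have m: "cp d * (gp x * p) = gp x * (cp d * p)" for d x p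
    by (simp only: mult.assoc[symmetric] cp_mult[of d "gp x"])
  have "cp (inverse c) * gp (YInvG j) * (g * gp (YG i)) * gp (YInvG i)
     \<approx> cp (inverse c) * gp (YInvG j) * (cp c * gp (YG j) * g) * gp (YInvG i)"
    by (intro ceq_multR ceq_multL car_mult f assms)
  also have "\<dots> = (cp (inverse c) * cp c) * (gp (YInvG j) * gp (YG j)) * (g * gp (YInvG i))"
    by (simp only: mult.assoc m)
  also have "\<dots> = (gp (YInvG j) * gp (YG j)) * (g * gp (YInvG i))" by (simp only: cc mult_1_left)
  also have "\<dots> \<approx> 1 * (g * gp (YInvG i))" by (intro ceq_multR YYi car_mult f assms)
  finally have 1: "cp (inverse c) * gp (YInvG j) * (g * gp (YG i)) * gp (YInvG i) \<approx> g * gp (YInvG i)" by simp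
  have "cp (inverse c) * gp (YInvG j) * (g * gp (YG i)) * gp (YInvG i) = cp (inverse c) * gp (YInvG j) * g * (gp (YG i) * gp (YInvG i))"
    by (simp only: mult.assoc)
  also have "\<dots> \<approx> cp (inverse c) * gp (YInvG j) * g * 1" by (intro ceq_multL YYi car_mult f assms)
  finally have "cp (inverse c) * gp (YInvG j) * (g * gp (YG i)) * gp (YInvG i) \<approx> cp (inverse c) * gp (YInvG j) * g" by simp
  from ceq_trans[OF ceq_sym[OF 1] this] show ?thesis .
qed

lemma Pi_push: "i \<in> {1..N} \<Longrightarrow> \<exists>c j. c \<noteq> 0 \<and> j \<in> {1..N} \<and> gp PiG * gp (YG i) \<approx> cp c * gp (YG j) * gp PiG"
  using PiY_raw[of i] q N
  by (intro exI[of _ "if i = N then q else 1"] exI[of _ "if i = N then 1 else i + 1"]) auto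

lemma PiInv_push:
  assumes j: "j \<in> {1..N}" shows "\<exists>c i. c \<noteq> 0 \<and> i \<in> {1..N} \<and> gp PiInvG * gp (YG j) \<approx> cp c * gp (YG i) * gp PiInvG"
proof -
  \<comment> \<open>The cyclic predecessor of j, so that pi moves past Y_i as a multiple of
    Y_j.\<close>
  define i where "i = (if j = 1 then N else j - 1)"
  define c where "c = (if i = N then q else 1)"
  have i: "i \<in> {1..N}" "(if i = N then 1 else i + 1) = j" using j N by (auto simp: i_def)
  have c0: "c \<noteq> 0" using q by (simp add: c_def)
  have r: "gp PiG * gp (YG i) \<approx> cp c * gp (YG j) * gp PiG" using PiY_raw[OF i(1)] unfolding i(2) c_def .
  have f: "gp (YG i) \<in> Fc" "gp (YG j) \<in> Fc" "cp (inverse c) \<in> Fc" "cp c \<in> Fc" using i j by auto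
  have cc: "cp (inverse c) * cp c = 1" using c0 by (simp add: cp_times[symmetric] cp_one)
  have m: "cp d * (gp x * p) = gp x * (cp d * p)" for d x p
    by (simp only: mult.assoc[symmetric] cp_mult[of d "gp x"])
  have "cp (inverse c) * gp PiInvG * (gp PiG * gp (YG i)) * gp PiInvG \<approx> cp (inverse c) * gp PiInvG * (cp c * gp (YG j) * gp PiG) * gp PiInvG"
    by (intro ceq_multR ceq_multL car_mult f r Fc_gens)
  also have "\<dots> = (cp (inverse c) * cp c) * (gp PiInvG * gp (YG j)) * (gp PiG * gp PiInvG)"
    by (simp only: mult.assoc m)
  also have "\<dots> = (gp PiInvG * gp (YG j)) * (gp PiG * gp PiInvG)" by (simp only: cc mult_1_left)
  also have "\<dots> \<approx> (gp PiInvG * gp (YG j)) * 1" by (intro ceq_multL PiPi car_mult f Fc_gens)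
  finally have 1: "cp (inverse c) * gp PiInvG * (gp PiG * gp (YG i)) * gp PiInvG \<approx> gp PiInvG * gp (YG j)" by simp
  have "cp (inverse c) * gp PiInvG * (gp PiG * gp (YG i)) * gp PiInvG = cp (inverse c) * ((gp PiInvG * gp PiG) * (gp (YG i) * gp PiInvG))"
    by (simp only: mult.assoc)
  also have "\<dots> \<approx> cp (inverse c) * (1 * (gp (YG i) * gp PiInvG))" by (intro ceq_multL ceq_multR PiPi car_mult f Fc_gens)
  finally have "cp (inverse c) * gp PiInvG * (gp PiG * gp (YG i)) * gp PiInvG \<approx> cp (inverse c) * gp (YG i) * gp PiInvG" by (simp add: mult.assoc)
  from ceq_trans[OF ceq_sym[OF 1] this] show ?thesis using c0 i by (intro exI[of _ "inverse c"] exI[of _ i]) auto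
qed

lemma U_gen: assumes g: "g \<in> gens N" and p: "p \<in> U" shows "gp g * p \<in> U"
proof (cases g)
  case PiG
  have Y: "\<exists>c j. j \<in> {1..N} \<and> gp PiG * gp (YG i) \<approx> cp c * gp (YG j) * gp PiG" if "i \<in> {1..N}" for i
    using Pi_push[OF that] by blast
  have Yi: "\<exists>c j. j \<in> {1..N} \<and> gp PiG * gp (YInvG i) \<approx> cp c * gp (YInvG j) * gp PiG" if "i \<in> {1..N}" for i
    using Pi_push[OF that] Yi_conj[OF _ _ Fc_gens(2) that] by blast
  show ?thesis unfolding PiG by (rule U_push[OF Fc_gens(2) U_eqL[OF L_gens(2) cp_U] Y Yi p])
next
  case PiInvG
  have Y: "\<exists>c j. j \<in> {1..N} \<and> gp PiInvG * gp (YG i) \<approx> cp c * gp (YG j) * gp PiInvG" if "i \<in> {1..N}" for i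
    using PiInv_push[OF that] by blast
  have Yi: "\<exists>c j. j \<in> {1..N} \<and> gp PiInvG * gp (YInvG i) \<approx> cp c * gp (YInvG j) * gp PiInvG" if "i \<in> {1..N}" for i
    using PiInv_push[OF that] Yi_conj[OF _ _ Fc_gens(3) that] by blast
  show ?thesis unfolding PiInvG by (rule U_push[OF Fc_gens(3) U_eqL[OF L_gens(3) cp_U] Y Yi p])
qed (use g p in \<open>auto intro: U_T U_Y U_Yi\<close>)

lemma Fc_U: assumes "p \<in> Fc" shows "p \<in> U"
proof -
  have w: "Poly_Mapping.single w 1 \<in> U" if "w \<in> lists (gens N)" for w
    using that
  proof (induct w)
    case Nil show ?case using cp_U[of 1] by simp
  next
    case (Cons g w) then show ?case using U_gen[of g "Poly_Mapping.single w 1"] by (simp add: gp_mult_single)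
  qed
  have "Poly_Mapping.keys p \<subseteq> lists (gens N)" using assms by (simp add: car_def)
  then show ?thesis
  proof (induct p rule: pm_induct_keys)
    case zero show ?case using cp_U[of 0] by simp
  next
    case (single k c)
    have "Poly_Mapping.single k c = cp c * Poly_Mapping.single k 1" by (simp add: mult_single plus_list_def)
    then show ?case using U_scale[OF w[OF single], of c] by simp
  qed (rule U_add)
qed

end

section \<open>Triangularity of \<open>A\<^sub>1 T\<^sub>1 \<cdots> T\<^sub>N\<^sub>-\<^sub>1\<close>\<close>

context daha_sigma
begin

section \<open>Exponents under Y_1 T_1 ... T_{N-1}\<close>

definition T_chain :: "gen free_poly \<Rightarrow> gen free_poly" where
  "T_chain p = foldr (\<lambda>i p. gp (TG i) * p) [1..<N] p"

text \<open>By \<open>ev_omega\<close>, evaluation carries this to \<open>Omega\<close>, that is to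
  A_1 T_1 ... T_{N-1} on tensors. The same round is thus followed twice, on exponents of monomials
  and on indices of tensors.\<close>

definition omega :: "gen free_poly \<Rightarrow> gen free_poly" where
  "omega p = gp (YG 1) * T_chain p"

text \<open>While the factor taken from the end sits at j, those behind it are pushed one place to
  the right; hence s + 1 in place of s for i > j.\<close>

definition ub :: "int \<Rightarrow> nat \<Rightarrow> nat \<Rightarrow> nat \<Rightarrow> int" where
  "ub b s j i = (if (if i < j then i \<le> s else i \<le> s + 1) then b else b - 1)"

definition lb :: "int \<Rightarrow> int \<Rightarrow> nat \<Rightarrow> nat \<Rightarrow> nat \<Rightarrow> int" where
  "lb a a' s j i = (if (if i < j then i \<le> s else i \<le> s + 1) then a' else a)"

text \<open>The exponents after s rounds started in \<open>Box a (b - 1)\<close>: the first s have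
  already been moved. Their own lower bound a' equals c + 1 with a = c in
  \<open>omega_const_exp\<close>, and a' = a in \<open>box_step\<close>.\<close>

definition profile :: "int \<Rightarrow> int \<Rightarrow> int \<Rightarrow> nat \<Rightarrow> (nat \<Rightarrow> int) set" where
  "profile a a' b s = {k. (\<forall>i. i \<notin> {1..N} \<longrightarrow> k i = 0) \<and>
     (\<forall>i\<in>{1..N}. if i \<le> s then a' \<le> k i \<and> k i \<le> b else a \<le> k i \<and> k i \<le> b - 1)}"

definition moving_profile :: "int \<Rightarrow> int \<Rightarrow> int \<Rightarrow> nat \<Rightarrow> nat \<Rightarrow> (nat \<Rightarrow> int) set" where
  "moving_profile a a' b s j = {k. (\<forall>i. i \<notin> {1..N} \<longrightarrow> k i = 0) \<and> a \<le> k j \<and> k j \<le> b - 1 \<and>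
     (\<forall>i\<in>{1..N} - {j}. lb a a' s j i \<le> k i \<and> k i \<le> ub b s j i)}"

text \<open>When the moving exponent passes a larger one, strictness in \<open>T_support\<close>
  keeps it at most b - 1 and the one left behind at least a + 1 \<ge> a'.\<close>

lemma moving_profile_step:
  assumes i: "i \<in> {1..<N}" and a: "a \<le> a'" "a' \<le> a + 1" and k: "k \<in> moving_profile a a' b s (i+1)"
  shows "T_support i k \<subseteq> moving_profile a a' b s i"
proof
  fix l assume l: "l \<in> T_support i k"
  have off: "l j = k j" if "j \<noteq> i" "j \<noteq> i + 1" for j using l that by (auto simp: T_support_def)
  have ii: "i \<in> {1..N} - {i+1}" "i + 1 \<in> {1..N}" using i by auto
  have y: "a \<le> k (i+1)" "k (i+1) \<le> b - 1" using k by (auto simp: moving_profile_def)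
  have x: "lb a a' s (i+1) i \<le> k i" "k i \<le> ub b s (i+1) i" using k ii by (auto simp: moving_profile_def)
  have same: "lb a a' s (i+1) i = lb a a' s i (i+1)" "ub b s (i+1) i = ub b s i (i+1)" by (auto simp: lb_def ub_def)
  have lba: "lb a a' s i (i+1) \<le> a + 1" "a \<le> lb a a' s i (i+1)" "ub b s i (i+1) \<le> b" "b - 1 \<le> ub b s i (i+1)"
    using a by (auto simp: lb_def ub_def)
  have li: "a \<le> l i \<and> l i \<le> b - 1 \<and> lb a a' s i (i+1) \<le> l (i+1) \<and> l (i+1) \<le> ub b s i (i+1)"
    using l x y lba unfolding same T_support_def by (auto split: if_splits)
  have oth: "lb a a' s i j \<le> l j \<and> l j \<le> ub b s i j" if j: "j \<in> {1..N} - {i}" for j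
  proof (cases "j = i + 1")
    case False
    then have "lb a a' s (i+1) j = lb a a' s i j" "ub b s (i+1) j = ub b s i j" using j by (auto simp: lb_def ub_def)
    moreover have "lb a a' s (i+1) j \<le> k j \<and> k j \<le> ub b s (i+1) j" using k j False unfolding moving_profile_def by blast
    ultimately show ?thesis using off[of j] False j by simp
  qed (use li in simp)
  have "l j = 0" if "j \<notin> {1..N}" for j using that k off[of j] ii unfolding moving_profile_def by auto
  then show "l \<in> moving_profile a a' b s i" using li oth unfolding moving_profile_def by blast
qed

lemma T_chain_moving_profile:
  assumes a: "a \<le> a'" "a' \<le> a + 1" and s: "s < N" and p: "p \<in> mon_span (profile a a' b s)" and j: "j \<le> N" "j \<ge> 1"
  shows "foldr (\<lambda>i p. gp (TG i) * p) [j..<N] p \<in> mon_span (moving_profile a a' b s j)"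
  using j
proof (induct j rule: inc_induct)
  case base
  have "profile a a' b s \<subseteq> moving_profile a a' b s N"
    using N s by (auto simp: profile_def moving_profile_def lb_def ub_def)
  then show ?case using p mon_span_mono by simp
next
  case (step j)
  have e: "[j..<N] = j # [Suc j..<N]" using step by (simp add: upt_conv_Cons)
  have "gp (TG j) * foldr (\<lambda>i p. gp (TG i) * p) [Suc j..<N] p \<in> mon_span (moving_profile a a' b s j)"
    by (rule mon_span_T) (use step moving_profile_step[OF _ a, of j] in auto)
  then show ?case unfolding e by simp
qed

lemma omega_profile:
  assumes a: "a \<le> a'" "a' \<le> a + 1" and s: "s < N" and p: "p \<in> mon_span (profile a a' b s)"
  shows "omega p \<in> mon_span (profile a a' b (s + 1))"
  unfolding omega_def
proof (rule mon_span_Y)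
  show "1 \<in> {1..N}" using N by simp
  show "T_chain p \<in> mon_span (moving_profile a a' b s 1)" unfolding T_chain_def by (rule T_chain_moving_profile[OF a s p N]) simp
  fix k assume "k \<in> moving_profile a a' b s 1"
  then have k: "\<And>i. i \<notin> {1..N} \<Longrightarrow> k i = 0" "a \<le> k 1" "k 1 \<le> b - 1"
    "\<And>i. i \<in> {1..N} - {1} \<Longrightarrow> lb a a' s 1 i \<le> k i \<and> k i \<le> ub b s 1 i"
    unfolding moving_profile_def by blast+
  have "if i \<le> s + 1 then a' \<le> (k(1 := k 1 + 1)) i \<and> (k(1 := k 1 + 1)) i \<le> b
      else a \<le> (k(1 := k 1 + 1)) i \<and> (k(1 := k 1 + 1)) i \<le> b - 1" if i: "i \<in> {1..N}" for i
    using a k(2,3) k(4)[of i] i by (cases "i = 1") (auto simp: lb_def ub_def)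
  moreover have "(k(1 := k 1 + 1)) i = 0" if "i \<notin> {1..N}" for i using k(1)[OF that] that N by auto
  ultimately show "k(1 := k 1 + 1) \<in> profile a a' b (s + 1)" unfolding profile_def by blast
qed

lemma omega_pow_profile:
  assumes a: "a \<le> a'" "a' \<le> a + 1" and p: "p \<in> mon_span (Box a (b - 1))"
  shows "s \<le> N \<Longrightarrow> (omega ^^ s) p \<in> mon_span (profile a a' b s)"
proof (induct s)
  case 0
  have "Box a (b - 1) = profile a a' b 0" by (auto simp: Box_def profile_def)
  then show ?case using p by simp
next
  case (Suc s) then show ?case using omega_profile[OF a, of s] by simp
qed

section \<open>Tensor indices under A_1 T_1 ... T_{N-1}\<close>

definition Omega :: "tensor \<Rightarrow> tensor" where "Omega f = Aop (Tup f)"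

lemma ev_TG: "i \<in> {1..<N} \<Longrightarrow> p \<in> Fc \<Longrightarrow> ev (cl (gp (TG i) * p)) = T i (ev (cl p))"
  by (simp add: ev_class_mult act_sig_T[unfolded dT_def])

lemma T_chain_car: "set xs \<subseteq> {1..<N} \<Longrightarrow> p \<in> Fc \<Longrightarrow> foldr (\<lambda>i p. gp (TG i) * p) xs p \<in> Fc"
  by (induct xs) (auto intro: car_mult)

lemma ev_omega: "p \<in> Fc \<Longrightarrow> ev (cl (omega p)) = Omega (ev (cl p))"
proof -
  assume p: "p \<in> Fc"
  have 1: "ev (cl (foldr (\<lambda>i p. gp (TG i) * p) xs p)) = foldr T xs (ev (cl p))" if "set xs \<subseteq> {1..<N}" for xs
    using that by (induct xs) (auto simp: ev_TG T_chain_car p)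
  have "ev (cl (omega p)) = act (\<sigma> (dY N q v 1)) (ev (cl (T_chain p)))"
    unfolding omega_def dY_def using N p by (intro ev_class_mult) (auto simp: T_chain_def intro: T_chain_car)
  then show ?thesis using 1[of "[1..<N]"] by (simp add: act_sig_Y1[simplified] Omega_def T_chain_def Tup_def)
qed

lemma omega_car: "p \<in> Fc \<Longrightarrow> omega p \<in> Fc"
  unfolding omega_def T_chain_def using N by (intro car_mult T_chain_car) auto

lemma ev_omega_pow: "p \<in> Fc \<Longrightarrow> (omega ^^ s) p \<in> Fc \<and> ev (cl ((omega ^^ s) p)) = (Omega ^^ s) (ev (cl p))"
  by (induct s) (auto simp: omega_car ev_omega)

text \<open>A configuration \<open>l\<close> has a factor at position \<open>j\<close> that is being moved and that is displaced
  by \<open>D\<close>. The other factors at positions up to \<open>s\<close> (in the original numbering) are bounded by \<open>b\<close>,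
  the remaining ones by \<open>b - 1\<close>.\<close>

definition top_weight :: "int \<Rightarrow> nat \<Rightarrow> int \<Rightarrow> (nat \<Rightarrow> int) \<Rightarrow> nat" where
  "top_weight b j D l = card {i \<in> {1..N} - {j}. l i = b} + of_bool (l j - D = b - 1)"

text \<open>c bounds \<open>top_weight\<close>, the number of factors at b, where the moving factor
  counts already at b - 1 because the round will raise it by one. S is the total of the indices
  without the displacement.\<close>

definition config :: "int \<Rightarrow> int \<Rightarrow> nat \<Rightarrow> int \<Rightarrow> nat \<Rightarrow> int \<Rightarrow> nat \<Rightarrow> (nat \<Rightarrow> int) set" where
  "config a b s S j D c = {l. (\<forall>i. i \<notin> {1..N} \<longrightarrow> l i = 0) \<and> (\<Sum>i\<in>{1..N}. l i) = S + D \<and>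
     a \<le> l j - D \<and> l j - D \<le> b - 1 \<and> (\<forall>i\<in>{1..N} - {j}. a \<le> l i \<and> l i \<le> ub b s j i) \<and> top_weight b j D l \<le> c}"

lemma card_pair:
  assumes i: "i \<in> {1..<N}"
  shows "card {t \<in> {1..N} - {i}. l t = (b::int)} = card {t \<in> {1..N} - {i,i+1}. l t = b} + of_bool (l (i+1) = b)"
    "card {t \<in> {1..N} - {i+1}. l t = (b::int)} = card {t \<in> {1..N} - {i,i+1}. l t = b} + of_bool (l i = b)"
proof -
  have "{t \<in> {1..N} - {i}. l t = b} = (if l (i+1) = b then insert (i+1) {t \<in> {1..N} - {i,i+1}. l t = b} else {t \<in> {1..N} - {i,i+1}. l t = b})"
    using i by auto
  then show "card {t \<in> {1..N} - {i}. l t = b} = card {t \<in> {1..N} - {i,i+1}. l t = b} + of_bool (l (i+1) = b)" by simp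
  have "{t \<in> {1..N} - {i+1}. l t = b} = (if l i = b then insert i {t \<in> {1..N} - {i,i+1}. l t = b} else {t \<in> {1..N} - {i,i+1}. l t = b})"
    using i by auto
  then show "card {t \<in> {1..N} - {i+1}. l t = b} = card {t \<in> {1..N} - {i,i+1}. l t = b} + of_bool (l i = b)" by simp
qed

lemma sum_pair:
  assumes i: "i \<in> {1..<N}"
  shows "(\<Sum>t\<in>{1..N}. l t) = l i + l (i+1) + (\<Sum>t\<in>{1..N} - {i,i+1}. (l t :: int))"
proof -
  have "{1..N} = insert i (insert (i+1) ({1..N} - {i,i+1}))" using i by auto
  then have "(\<Sum>t\<in>{1..N}. l t) = (\<Sum>t\<in>insert i (insert (i+1) ({1..N} - {i,i+1})). l t)" by simp
  also have "\<dots> = l i + l (i+1) + (\<Sum>t\<in>{1..N} - {i,i+1}. l t)" by (subst sum.insert) auto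
  finally show ?thesis .
qed

text \<open>Only the positions i and i + 1 change. The last assumption compares the old and new
  contributions of this pair to \<open>top_weight\<close>, written with sums to avoid subtraction of
  naturals.\<close>

lemma config_up:
  assumes i: "i \<in> {1..<N}" and l: "l \<in> config a b s S (i+1) D c0"
    and off: "\<And>j. j \<noteq> i \<Longrightarrow> j \<noteq> i + 1 \<Longrightarrow> l' j = l j" and su: "l' i + l' (i+1) = l i + l (i+1)"
    and mv: "a \<le> l' i - D" "l' i - D \<le> b - 1" and st: "a \<le> l' (i+1)" "l' (i+1) \<le> ub b s (i+1) i"
    and c: "of_bool (l' (i+1) = b) + of_bool (l' i - D = b - 1) + c0 \<le> c + (of_bool (l i = b) + of_bool (l (i+1) - D = b - 1))"
  shows "l' \<in> config a b s S i D c"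
proof -
  have "(\<Sum>t\<in>{1..N} - {i,i+1}. l' t) = (\<Sum>t\<in>{1..N} - {i,i+1}. l t)" by (rule sum.cong) (auto simp: off)
  then have s: "(\<Sum>t\<in>{1..N}. l' t) = (\<Sum>t\<in>{1..N}. l t)" unfolding sum_pair[OF i] using su by simp
  have "{t \<in> {1..N} - {i,i+1}. l' t = b} = {t \<in> {1..N} - {i,i+1}. l t = b}" by (auto simp: off)
  then have P: "top_weight b i D l' \<le> c" using l c unfolding config_def top_weight_def card_pair[OF i] by auto
  have "a \<le> l' j \<and> l' j \<le> ub b s i j" if j: "j \<in> {1..N} - {i}" for j
  proof (cases "j = i + 1")
    case True then show ?thesis using st by (auto simp: ub_def split: if_splits)
  next
    case False
    then have "a \<le> l j \<and> l j \<le> ub b s (i+1) j" using l j unfolding config_def by auto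
    moreover have "ub b s (i+1) j = ub b s i j" using j False by (auto simp: ub_def)
    ultimately show ?thesis using off[of j] j False by simp
  qed
  moreover have "l' j = 0" if "j \<notin> {1..N}" for j
    using l i off[of j] that unfolding config_def by auto
  ultimately show ?thesis using l P s mv unfolding config_def by auto
qed

lemma config_down:
  assumes i: "i \<in> {1..<N}" and l: "l \<in> config a b s S i D c0"
    and off: "\<And>j. j \<noteq> i \<Longrightarrow> j \<noteq> i + 1 \<Longrightarrow> l' j = l j" and su: "l' i + l' (i+1) = l i + l (i+1)"
    and mv: "a \<le> l' (i+1) - D" "l' (i+1) - D \<le> b - 1" and st: "a \<le> l' i" "l' i \<le> ub b s i (i+1)"
    and c: "of_bool (l' i = b) + of_bool (l' (i+1) - D = b - 1) + c0 \<le> c + (of_bool (l (i+1) = b) + of_bool (l i - D = b - 1))"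
  shows "l' \<in> config a b s S (i+1) D c"
proof -
  have "(\<Sum>t\<in>{1..N} - {i,i+1}. l' t) = (\<Sum>t\<in>{1..N} - {i,i+1}. l t)" by (rule sum.cong) (auto simp: off)
  then have s: "(\<Sum>t\<in>{1..N}. l' t) = (\<Sum>t\<in>{1..N}. l t)" unfolding sum_pair[OF i] using su by simp
  have "{t \<in> {1..N} - {i,i+1}. l' t = b} = {t \<in> {1..N} - {i,i+1}. l t = b}" by (auto simp: off)
  then have P: "top_weight b (i+1) D l' \<le> c" using l c unfolding config_def top_weight_def card_pair[OF i] by auto
  have "a \<le> l' j \<and> l' j \<le> ub b s (i+1) j" if j: "j \<in> {1..N} - {i+1}" for j
  proof (cases "j = i")
    case True then show ?thesis using st by (auto simp: ub_def split: if_splits)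
  next
    case False
    then have "a \<le> l j \<and> l j \<le> ub b s i j" using l j unfolding config_def by auto
    moreover have "ub b s (i+1) j = ub b s i j" using j False by (auto simp: ub_def)
    ultimately show ?thesis using off[of j] j False by simp
  qed
  moreover have "l' j = 0" if "j \<notin> {1..N}" for j
    using l i off[of j] that unfolding config_def by auto
  ultimately show ?thesis using l P s mv unfolding config_def by auto
qed

lemma nat_mult_ge: "j \<ge> 1 \<Longrightarrow> int n \<le> int n * j" and nat_mult_le: "j \<le> -1 \<Longrightarrow> int n * j \<le> - int n"
  using mult_left_mono[of 1 j "int n"] mult_left_mono[of j "-1" "int n"] by auto

text \<open>If the moving factor counts, with index b - 1, then no correction term has b - 1 in the
  moving place or b in the other, so the weight drops by one; otherwise it does not grow. The shift
  j = 0 stands for the diagonal term.\<close>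

lemma T_moving:
  assumes i: "i \<in> {1..<N}" and l: "l \<in> config a b s S (i+1) 0 c"
  shows "\<exists>g. g \<noteq> 0 \<and> T i (basis l) - scale g (basis (swap_at i l))
      \<in> bspan (config a b s S i 0 (c - of_bool (l (i+1) = b - 1)))"
    and "swap_at i l \<in> config a b s S i 0 c"
proof -
  let ?G = "config a b s S i 0 (c - of_bool (l (i+1) = b - 1))"
  have ii: "i \<in> {1..N} - {i+1}" using i by auto
  have y: "a \<le> l (i+1)" "l (i+1) \<le> b - 1" using l by (auto simp: config_def)
  have x: "a \<le> l i" "l i \<le> ub b s (i+1) i" using l ii by (auto simp: config_def)
  have u: "ub b s (i+1) i \<le> b" "b - 1 \<le> ub b s (i+1) i" by (auto simp: ub_def)
  show "swap_at i l \<in> config a b s S i 0 c"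
    by (rule config_up[OF i l]) (use x y in \<open>auto simp: swap_at_def\<close>)
  have cpos: "c \<ge> 1" if "l (i+1) = b - 1"
    using l that unfolding config_def top_weight_def by auto
  have inner: "l(i := l i + int n * j, i+1 := l (i+1) - int n * j) \<in> ?G"
    if j: "(j \<ge> 0 \<and> l i + int n * j < l (i+1)) \<or> (j \<le> -1 \<and> l i + int n * j > l (i+1))" for j
  proof -
    define l' where "l' = l(i := l i + int n * j, i+1 := l (i+1) - int n * j)"
    define w where "w = int n * j"
    have e: "l' i = l i + w" "l' (i+1) = l (i+1) - w" by (auto simp: w_def l'_def)
    have off: "l' t = l t" if "t \<noteq> i" "t \<noteq> i + 1" for t using that by (simp add: l'_def)
    consider (1) "j \<ge> 0" "l i + w < l (i+1)" "w \<ge> 0" | (2) "j \<le> -1" "l i + w > l (i+1)" "w \<le> -1"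
      using j nat_mult_le[of j] n unfolding w_def by (cases "j \<ge> 0") auto
    then have "a \<le> l' i - 0 \<and> l' i - 0 \<le> b - 1 \<and> a \<le> l' (i+1) \<and> l' (i+1) \<le> ub b s (i+1) i \<and>
      of_bool (l' (i+1) = b) + of_bool (l' i - 0 = b - 1) + c \<le> (c - of_bool (l (i+1) = b - 1)) + (of_bool (l i = b) + of_bool (l (i+1) - 0 = b - 1))"
    proof cases
      case 1
      have "l (i+1) - w \<noteq> b" "l i + w \<noteq> b - 1" using 1 y by linarith+
      then show ?thesis unfolding e using 1 x y u cpos by auto
    next
      case 2
      \<comment> \<open>A moving factor now at b - 1 comes from a factor at b, so the weight does
        not grow. The value b - 1 of l (i+1) is excluded since l i + w is at most b - 1.\<close>
      have "l (i+1) - w \<noteq> b" "l i + w = b - 1 \<Longrightarrow> l i = b" "l (i+1) \<noteq> b - 1" using 2 x y u by linarith+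
      then show ?thesis unfolding e using 2 x y u by auto
    qed
    then have f: "a \<le> l' i - 0" "l' i - 0 \<le> b - 1" "a \<le> l' (i+1)" "l' (i+1) \<le> ub b s (i+1) i"
      "of_bool (l' (i+1) = b) + of_bool (l' i - 0 = b - 1) + c \<le> (c - of_bool (l (i+1) = b - 1)) + (of_bool (l i = b) + of_bool (l (i+1) - 0 = b - 1))"
      by blast+
    have "l' \<in> ?G" by (rule config_up[OF i l off]) (use f e in simp_all)
    then show ?thesis unfolding l'_def .
  qed
  have TI: "T_inner n i l \<subseteq> ?G" unfolding T_inner_def using inner by fastforce
  have id: "l \<in> ?G" if "l i < l (i+1)" using inner[of 0] that by (simp add: fun_upd_idem)
  obtain g r where g: "g \<noteq> 0" and r: "r \<in> bspan (T_inner n i l)"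
    and T: "T i (basis l) = scale g (basis (swap_at i l)) + (if l i < l (i+1) then scale cc (basis l) else 0) + r"
    using T_formula[OF n v, of l i] by blast
  have "T i (basis l) - scale g (basis (swap_at i l)) = (if l i < l (i+1) then scale cc (basis l) else 0) + r" unfolding T by simp
  also have "\<dots> \<in> bspan ?G" using id r bspan_mono[OF TI] by (auto intro!: bspan_add bspan_scale bspan_basis)
  finally show "\<exists>g. g \<noteq> 0 \<and> T i (basis l) - scale g (basis (swap_at i l)) \<in> bspan ?G" using g by blast
qed

text \<open>As T_i^-1 = T_i - (v - v^-1), the diagonal term now occurs for l i > l (i+1). The bounds
  on d keep every correction term within the index bounds and make the weight drop when the moving
  factor counts.\<close>

lemma Tinv_moving:
  assumes i: "i \<in> {1..<N}" and d: "0 \<le> d" "d \<le> int n - 2" and l: "l \<in> config a b s S i (-d) c"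
  shows "\<exists>g. g \<noteq> 0 \<and> Tinv i (basis l) - scale g (basis (swap_at i l))
      \<in> bspan (config a b s S (i+1) (-d) (c - of_bool (l i + d = b - 1)))"
    and "swap_at i l \<in> config a b s S (i+1) (-d) c"
proof -
  let ?G = "config a b s S (i+1) (-d) (c - of_bool (l i + d = b - 1))"
  have ii: "i + 1 \<in> {1..N} - {i}" using i by auto
  have x: "a \<le> l i + d" "l i + d \<le> b - 1" using l by (auto simp: config_def)
  have y: "a \<le> l (i+1)" "l (i+1) \<le> ub b s i (i+1)" using l ii by (auto simp: config_def)
  have u: "ub b s i (i+1) \<le> b" "b - 1 \<le> ub b s i (i+1)" by (auto simp: ub_def)
  show "swap_at i l \<in> config a b s S (i+1) (-d) c"
    by (rule config_down[OF i l]) (use x y in \<open>auto simp: swap_at_def\<close>)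
  have cpos: "c \<ge> 1" if "l i + d = b - 1"
    using l that unfolding config_def top_weight_def by auto
  have inner: "l(i := l i + int n * j, i+1 := l (i+1) - int n * j) \<in> ?G"
    if j: "(j \<ge> 1 \<and> l i + int n * j < l (i+1)) \<or> (j \<le> 0 \<and> l i + int n * j > l (i+1))" for j
  proof -
    define l' where "l' = l(i := l i + int n * j, i+1 := l (i+1) - int n * j)"
    define w where "w = int n * j"
    have e: "l' i = l i + w" "l' (i+1) = l (i+1) - w" by (auto simp: w_def l'_def)
    have off: "l' t = l t" if "t \<noteq> i" "t \<noteq> i + 1" for t using that by (simp add: l'_def)
    consider (1) "j \<ge> 1" "l i + w < l (i+1)" "w \<ge> int n" | (2) "j \<le> 0" "l i + w > l (i+1)" "w \<le> 0"
      using j nat_mult_ge[of j] n unfolding w_def by (cases "j \<ge> 1") (auto simp: mult_nonneg_nonpos)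
    then have "a \<le> l' (i+1) - (-d) \<and> l' (i+1) - (-d) \<le> b - 1 \<and> a \<le> l' i \<and> l' i \<le> ub b s i (i+1) \<and>
      of_bool (l' i = b) + of_bool (l' (i+1) - (-d) = b - 1) + c \<le> (c - of_bool (l i + d = b - 1)) + (of_bool (l (i+1) = b) + of_bool (l i - (-d) = b - 1))"
    proof cases
      case 1
      \<comment> \<open>As w \<ge> n and d \<le> n - 2, the undisplaced index l (i+1) - w + d is at
        most b - 2.\<close>
      have "l i + w \<noteq> b" "l (i+1) - w - (-d) \<noteq> b - 1" using 1 x y u d by linarith+
      then show ?thesis unfolding e using 1 x y u cpos d by auto
    next
      case 2
      have "l i + w \<noteq> b" "l (i+1) - w - (-d) \<noteq> b - 1" using 2 x y u d by linarith+
      then show ?thesis unfolding e using 2 x y u cpos d by auto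
    qed
    then have f: "a \<le> l' (i+1) - (-d)" "l' (i+1) - (-d) \<le> b - 1" "a \<le> l' i" "l' i \<le> ub b s i (i+1)"
      "of_bool (l' i = b) + of_bool (l' (i+1) - (-d) = b - 1) + c \<le> (c - of_bool (l i + d = b - 1)) + (of_bool (l (i+1) = b) + of_bool (l i - (-d) = b - 1))"
      by blast+
    have "l' \<in> ?G" by (rule config_down[OF i l off]) (use f e in simp_all)
    then show ?thesis unfolding l'_def .
  qed
  have TI: "T_inner n i l \<subseteq> ?G" unfolding T_inner_def using inner by fastforce
  have id: "l \<in> ?G" if "l i > l (i+1)" using inner[of 0] that by (simp add: fun_upd_idem)
  obtain g r where g: "g \<noteq> 0" "l i = l (i+1) \<Longrightarrow> g = v" and r: "r \<in> bspan (T_inner n i l)"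
    and T: "T i (basis l) = scale g (basis (swap_at i l)) + (if l i < l (i+1) then scale cc (basis l) else 0) + r"
    using T_formula[OF n v, of l i] by blast
  have rG: "r \<in> bspan ?G" using r bspan_mono[OF TI] by blast
  show "\<exists>g. g \<noteq> 0 \<and> Tinv i (basis l) - scale g (basis (swap_at i l)) \<in> bspan ?G"
  proof (cases "l i = l (i+1)")
    case True
    have "swap_at i l = l" using True by (auto simp: swap_at_def fun_eq_iff)
    then have "Tinv i (basis l) - scale (inverse v) (basis (swap_at i l)) = r"
      unfolding Tinv_def T using True g(2) by (simp add: scale_diff_left)
    then show ?thesis using rG v by (intro exI[of _ "inverse v"]) auto
  next
    case False
    have "Tinv i (basis l) - scale g (basis (swap_at i l)) = (if l i < l (i+1) then 0 else - scale cc (basis l)) + r"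
      unfolding Tinv_def T by simp
    also have "\<dots> \<in> bspan ?G" using id rG False by (auto intro!: bspan_add bspan_scale bspan_basis bspan_minus bspan_diff)
    finally show ?thesis using g by blast
  qed
qed

lemma PiM_config:
  assumes l: "l \<in> config a b s S N D c"
  shows "(rot N l)(1 := l N - int n') \<in> config a b s S 1 (D - int n') c"
proof -
  let ?l = "(rot N l)(1 := l N - int n')"
  have v: "?l i = l (i - 1)" if "i \<in> {2..N}" for i using that by (auto simp: rot_def)
  have v1: "?l 1 = l N - int n'" by simp
  have S1: "{1..N} = insert 1 {2..N}" and S2: "{1..N} = insert N {1..<N}" and S3: "{2..N} = Suc ` {1..<N}"
    using N by (auto simp: image_iff)
  have "(\<Sum>i\<in>{2..N}. ?l i) = (\<Sum>i\<in>{1..<N}. l i)"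
  proof -
    have "(\<Sum>i\<in>{2..N}. ?l i) = (\<Sum>i\<in>{2..N}. l (i - 1))" by (rule sum.cong[OF refl v])
    also have "\<dots> = (\<Sum>i\<in>{1..<N}. l i)" unfolding S3 by (subst sum.reindex) auto
    finally show ?thesis .
  qed
  moreover have "(\<Sum>i\<in>{1..N}. ?l i) = ?l 1 + (\<Sum>i\<in>{2..N}. ?l i)" unfolding S1 by (subst sum.insert) auto
  moreover have "(\<Sum>i\<in>{1..N}. l i) = l N + (\<Sum>i\<in>{1..<N}. l i)" unfolding S2 by (subst sum.insert) auto
  ultimately have su: "(\<Sum>i\<in>{1..N}. ?l i) = S + (D - int n')" using l v1 unfolding config_def by auto
  have "{i \<in> {1..N} - {1}. ?l i = b} = Suc ` {i \<in> {1..N} - {N}. l i = b}"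
  proof -
    have "{i \<in> {1..N} - {1}. ?l i = b} = {i \<in> {2..N}. l (i - 1) = b}" using v by (auto simp: rot_def)
    also have "\<dots> = Suc ` {i \<in> {1..<N}. l i = b}"
    proof (intro equalityI subsetI)
      fix x assume "x \<in> {i \<in> {2..N}. l (i - 1) = b}"
      then have "x = Suc (x - 1)" "x - 1 \<in> {i \<in> {1..<N}. l i = b}" by auto
      then show "x \<in> Suc ` {i \<in> {1..<N}. l i = b}" by (rule image_eqI)
    qed auto
    also have "{i \<in> {1..<N}. l i = b} = {i \<in> {1..N} - {N}. l i = b}" by auto
    finally show ?thesis .
  qed
  then have "card {i \<in> {1..N} - {1}. ?l i = b} = card {i \<in> {1..N} - {N}. l i = b}" by (simp add: card_image)
  then have P: "top_weight b 1 (D - int n') ?l \<le> c" using l v1 unfolding config_def top_weight_def by auto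
  have "a \<le> ?l i \<and> ?l i \<le> ub b s 1 i" if "i \<in> {1..N} - {1}" for i
  proof -
    have i: "i \<in> {2..N}" "i - 1 \<in> {1..N} - {N}" using that by auto
    then have "a \<le> l (i - 1) \<and> l (i - 1) \<le> ub b s N (i - 1)" using l unfolding config_def by blast
    moreover have "ub b s N (i - 1) = ub b s 1 i" using i by (auto simp: ub_def)
    ultimately show ?thesis using v[OF i(1)] by simp
  qed
  moreover have "?l i = 0" if "i \<notin> {1..N}" for i using l that N unfolding config_def by (auto simp: rot_def)
  ultimately show ?thesis using su P l v1 unfolding config_def by auto
qed

lemma Y_config: "l \<in> config a b s S 1 D c \<Longrightarrow> l(1 := l 1 + int n) \<in> config a b s S 1 (D + int n) c"
proof -
  assume l: "l \<in> config a b s S 1 D c"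
  let ?l = "l(1 := l 1 + int n)"
  have S1: "{1..N} = insert 1 {2..N}" using N by auto
  have "(\<Sum>i\<in>{2..N}. ?l i) = (\<Sum>i\<in>{2..N}. l i)" by (rule sum.cong) auto
  then have "(\<Sum>i\<in>{1..N}. ?l i) = (\<Sum>i\<in>{1..N}. l i) + int n" unfolding S1 by (subst (1 2) sum.insert) auto
  moreover have "{i \<in> {1..N} - {1}. ?l i = b} = {i \<in> {1..N} - {1}. l i = b}" by auto
  then have "top_weight b 1 (D + int n) ?l = top_weight b 1 D l" unfolding top_weight_def by simp
  ultimately show ?thesis using l N unfolding config_def by auto
qed


section \<open>Triangular operators and their composition\<close>

lemma config_mono: "c \<le> c' \<Longrightarrow> config a b s S j D c \<subseteq> config a b s S j D c'"
  by (auto simp: config_def)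

text \<open>Triangularity in a form that composes: basis l goes to a nonzero multiple of basis (h
  l), and the errors lose one unit of weight whenever the moving factor counts.\<close>

definition moves :: "int \<Rightarrow> int \<Rightarrow> nat \<Rightarrow> int \<Rightarrow> (tensor \<Rightarrow> tensor) \<Rightarrow> ((nat \<Rightarrow> int) \<Rightarrow> nat \<Rightarrow> int) \<Rightarrow>
    nat \<Rightarrow> int \<Rightarrow> nat \<Rightarrow> int \<Rightarrow> bool" where
  "moves a b s S F h j D j' D' \<longleftrightarrow> lin F \<and> (\<forall>c l. l \<in> config a b s S j D c \<longrightarrow>
     h l \<in> config a b s S j' D' c \<and> h l j' - D' = l j - D \<and>
     (\<exists>g. g \<noteq> 0 \<and> F (basis l) - scale g (basis (h l)) \<in> bspan (config a b s S j' D' (c - of_bool (l j - D = b - 1)))))"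

lemma moves_bspan:
  assumes m: "moves a b s S F h j D j' D'" and f: "f \<in> bspan (config a b s S j D c)"
  shows "F f \<in> bspan (config a b s S j' D' c)"
proof (rule lin_bspan[OF _ f])
  show "lin F" using m by (simp add: moves_def)
  fix l assume "l \<in> config a b s S j D c"
  then obtain g where g: "h l \<in> config a b s S j' D' c"
    "F (basis l) - scale g (basis (h l)) \<in> bspan (config a b s S j' D' (c - of_bool (l j - D = b - 1)))"
    using m unfolding moves_def by blast
  have "F (basis l) - scale g (basis (h l)) \<in> bspan (config a b s S j' D' c)"
    using g(2) bspan_mono[OF config_mono] by (meson diff_le_self subsetD)
  then have "(F (basis l) - scale g (basis (h l))) + scale g (basis (h l)) \<in> bspan (config a b s S j' D' c)"
    by (rule bspan_add) (intro bspan_scale bspan_basis g(1))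
  then show "F (basis l) \<in> bspan (config a b s S j' D' c)" by simp
qed

text \<open>The undisplaced index of the moving factor is preserved, so both operators grant the
  same loss of weight, and by \<open>moves_bspan\<close> the second does not raise the weight of the
  errors of the first.\<close>

lemma moves_comp:
  assumes m1: "moves a b s S F h j D j' D'" and m2: "moves a b s S F' h' j' D' j'' D''"
  shows "moves a b s S (\<lambda>f. F' (F f)) (\<lambda>l. h' (h l)) j D j'' D''"
  unfolding moves_def
proof (intro conjI allI impI)
  have lF: "lin F" "lin F'" using m1 m2 by (auto simp: moves_def)
  show "lin (\<lambda>f. F' (F f))" by (rule lin_comp[OF lF(2,1)])
  fix c l assume l: "l \<in> config a b s S j D c"
  let ?e = "c - of_bool (l j - D = b - 1)"
  from l m1 obtain g where g: "h l \<in> config a b s S j' D' c" "h l j' - D' = l j - D" "g \<noteq> 0"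
    "F (basis l) - scale g (basis (h l)) \<in> bspan (config a b s S j' D' ?e)" unfolding moves_def by blast
  from g(1) m2 obtain g' where g': "h' (h l) \<in> config a b s S j'' D'' c" "h' (h l) j'' - D'' = h l j' - D'" "g' \<noteq> 0"
    "F' (basis (h l)) - scale g' (basis (h' (h l))) \<in> bspan (config a b s S j'' D'' (c - of_bool (h l j' - D' = b - 1)))"
    unfolding moves_def by blast
  show "h' (h l) \<in> config a b s S j'' D'' c" by (rule g')
  show "h' (h l) j'' - D'' = l j - D" using g g' by simp
  have "F' (F (basis l) - scale g (basis (h l))) \<in> bspan (config a b s S j'' D'' ?e)"
    by (rule moves_bspan[OF m2 g(4)])
  moreover have "scale g (F' (basis (h l)) - scale g' (basis (h' (h l)))) \<in> bspan (config a b s S j'' D'' ?e)"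
    using g'(4) unfolding g(2) by (rule bspan_scale)
  ultimately have "F' (F (basis l) - scale g (basis (h l))) + scale g (F' (basis (h l)) - scale g' (basis (h' (h l))))
    \<in> bspan (config a b s S j'' D'' ?e)" by (rule bspan_add)
  moreover have "F' (F (basis l) - scale g (basis (h l))) + scale g (F' (basis (h l)) - scale g' (basis (h' (h l))))
    = F' (F (basis l)) - scale (g * g') (basis (h' (h l)))"
    by (simp add: lin_diff[OF lF(2)] lin_scale[OF lF(2)] scale_diff)
  ultimately show "\<exists>g. g \<noteq> 0 \<and> F' (F (basis l)) - scale g (basis (h' (h l))) \<in> bspan (config a b s S j'' D'' ?e)"
    using g(3) g'(3) by (intro exI[of _ "g * g'"]) auto
qed

lemma moves_T: "i \<in> {1..<N} \<Longrightarrow> moves a b s S (T i) (swap_at i) (i+1) 0 i 0"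
  unfolding moves_def using T_moving by (auto simp: swap_at_def)

lemma moves_Tinv: "i \<in> {1..<N} \<Longrightarrow> 0 \<le> d \<Longrightarrow> d \<le> int n - 2 \<Longrightarrow> moves a b s S (Tinv i) (swap_at i) i (-d) (i+1) (-d)"
  unfolding moves_def using Tinv_moving[of i d] by (auto simp: swap_at_def)

lemma moves_PiM: "moves a b s S PiM (\<lambda>l. (rot N l)(1 := l N - int n')) N D 1 (D - int n')"
  unfolding moves_def
proof (intro conjI allI impI)
  fix c l assume l: "l \<in> config a b s S N D c"
  show "(rot N l)(1 := l N - int n') \<in> config a b s S 1 (D - int n') c" by (rule PiM_config[OF l])
  show "\<exists>g. g \<noteq> 0 \<and> PiM (basis l) - scale g (basis ((rot N l)(1 := l N - int n')))
      \<in> bspan (config a b s S 1 (D - int n') (c - of_bool (l N - D = b - 1)))"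
    by (intro exI[of _ "Pi_coeff (l N)"]) (simp only: Pi_basis diff_self bspan_zero Pi_coeff_nz not_False_eq_True)
qed auto

lemma moves_Y: "moves a b s S (Y 1) (\<lambda>l. l(1 := l 1 + int n)) 1 D 1 (D + int n)"
  unfolding moves_def
proof (intro conjI allI impI)
  fix c l assume l: "l \<in> config a b s S 1 D c"
  show "l(1 := l 1 + int n) \<in> config a b s S 1 (D + int n) c" by (rule Y_config[OF l])
  show "\<exists>g. g \<noteq> 0 \<and> Y 1 (basis l) - scale g (basis (l(1 := l 1 + int n)))
      \<in> bspan (config a b s S 1 (D + int n) (c - of_bool (l 1 - D = b - 1)))"
    by (intro exI[of _ 1]) (simp only: Ypow_basis mult_1_right scale_one diff_self bspan_zero, simp)
qed auto

lemma basis_inj: "basis k = basis l \<Longrightarrow> k = l"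
proof -
  assume "basis k = basis l"
  then have "Poly_Mapping.keys (basis k) = Poly_Mapping.keys (basis l)" by (rule arg_cong)
  then show "k = l" by simp
qed

lemma foldr_swap_at: "foldr swap_at [1..<N] l = rot N l"
proof -
  have "foldr (\<circ>) (map s_op xs) id (basis l) = basis (foldr swap_at xs l)" for xs
    by (induct xs) (simp_all add: s_op_basis)
  then have "basis (foldr swap_at [1..<N] l) = basis (\<lambda>j. if j = 1 then l N else if 1 < j \<and> j \<le> N then l (j - 1) else l j)"
    using foldr_s_op[OF N, of l] by simp
  then have "foldr swap_at [1..<N] l = (\<lambda>j. if j = 1 then l N else if 1 < j \<and> j \<le> N then l (j - 1) else l j)"
    by (rule basis_inj)
  then show ?thesis by (auto simp: rot_def fun_eq_iff)
qed

lemma moves_id: "moves a b s S (\<lambda>f. f) (\<lambda>l. l) j D j D"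
  unfolding moves_def
proof (intro conjI allI impI)
  fix c l
  show "\<exists>g. g \<noteq> 0 \<and> basis l - scale g (basis l) \<in> bspan (config a b s S j D (c - of_bool (l j - D = b - 1)))"
    by (intro exI[of _ 1]) simp
qed (simp_all add: lin_id)

lemma moves_Tup: "moves a b s S Tup (rot N) N 0 1 0"
proof -
  have "moves a b s S (foldr T [j..<N]) (foldr swap_at [j..<N]) N 0 j 0" if "j \<le> N" "j \<ge> 1" for j
    using that
  proof (induct j rule: inc_induct)
    case base
    have "foldr T [N..<N] = (\<lambda>f. f)" "foldr swap_at [N..<N] = (\<lambda>l. l)" by (simp_all add: fun_eq_iff)
    then show ?case using moves_id by simp
  next
    case (step j)
    have e: "foldr T [j..<N] = (\<lambda>f. T j (foldr T [Suc j..<N] f))" "foldr swap_at [j..<N] = (\<lambda>f. swap_at j (foldr swap_at [Suc j..<N] f))"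
      using step by (simp_all add: upt_conv_Cons fun_eq_iff)
    have mT: "moves a b s S (T j) (swap_at j) (Suc j) 0 j 0" using step moves_T[of j] by auto
    have "moves a b s S (foldr T [Suc j..<N]) (foldr swap_at [Suc j..<N]) N 0 (Suc j) 0" using step by simp
    from moves_comp[OF this mT] show ?case unfolding e .
  qed
  from this[of 1] N have "moves a b s S (foldr T [1..<N]) (foldr swap_at [1..<N]) N 0 1 0" by simp
  moreover have "foldr T [1..<N] = Tup" "foldr swap_at [1..<N] = rot N"
    by (rule ext, simp only: Tup_def foldr_swap_at)+
  ultimately show ?thesis by simp
qed

text \<open>The T_i^-1 carry the first factor to the end and pi brings it back to the front, so on
  leading indices X_1^-1 only lowers the first entry by n'.\<close>

lemma moves_XI:
  assumes d: "0 \<le> d" "d \<le> int n - 2"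
  shows "moves a b s S XI (\<lambda>l. l(1 := l 1 - int n')) 1 (-d) 1 (-d - int n')"
proof -
  have "moves a b s S (foldr Tinv (rev [1..<Suc k])) (foldr swap_at (rev [1..<Suc k])) 1 (-d) (Suc k) (-d)" if "Suc k \<le> N" for k
    using that
  proof (induct k)
    case 0
    have "foldr Tinv (rev [1..<Suc 0]) = (\<lambda>f. f)" "foldr swap_at (rev [1..<Suc 0]) = (\<lambda>f. f)" by (simp_all add: fun_eq_iff)
    then show ?case using moves_id by simp
  next
    case (Suc k)
    have r: "rev [1..<Suc (Suc k)] = Suc k # rev [1..<Suc k]" by simp
    have e: "foldr Tinv (rev [1..<Suc (Suc k)]) = (\<lambda>f. Tinv (Suc k) (foldr Tinv (rev [1..<Suc k]) f))"
      "foldr swap_at (rev [1..<Suc (Suc k)]) = (\<lambda>f. swap_at (Suc k) (foldr swap_at (rev [1..<Suc k]) f))"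
      unfolding r by (rule ext, simp only: foldr.simps o_def)+
    have mT: "moves a b s S (Tinv (Suc k)) (swap_at (Suc k)) (Suc k) (-d) (Suc (Suc k)) (-d)"
      using Suc.prems d moves_Tinv[of "Suc k"] by auto
    have "moves a b s S (foldr Tinv (rev [1..<Suc k])) (foldr swap_at (rev [1..<Suc k])) 1 (-d) (Suc k) (-d)"
      using Suc by simp
    from moves_comp[OF this mT] show ?case unfolding e .
  qed
  from this[of "N - 1"] N have m: "moves a b s S (foldr Tinv (rev [1..<N])) (foldr swap_at (rev [1..<N])) 1 (-d) N (-d)"
    by (simp del: upt_Suc)
  have inv: "foldr swap_at xs (foldr swap_at (rev xs) l) = l" for xs l
  proof (induct xs arbitrary: l)
    case (Cons x xs)
    have "swap_at x (swap_at x l) = l" by (auto simp: swap_at_def fun_eq_iff)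
    then show ?case using Cons by simp
  qed simp
  have h: "(rot N (foldr swap_at (rev [1..<N]) l))(1 := foldr swap_at (rev [1..<N]) l N - int n') = l(1 := l 1 - int n')" for l
  proof -
    let ?m = "foldr swap_at (rev [1..<N]) l"
    have r: "rot N ?m = l" using inv[of "[1..<N]" l] by (simp only: foldr_swap_at)
    have "rot N ?m 1 = ?m N" by (simp add: rot_def)
    then show ?thesis unfolding r by simp
  qed
  have "XI = (\<lambda>f. PiM (foldr Tinv (rev [1..<N]) f))" by (simp add: fun_eq_iff XI_def Tdown_def)
  then show ?thesis using moves_comp[OF m moves_PiM] unfolding h by simp
qed

text \<open>-d is the displacement of the moving factor when the letter at j acts. Let f and r be
  quotient and residue of j m by m + m'. Since n (m + m') = 1 + (n + n') m, m d = f + n r - m. At a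
  letter X_1^-1 one has r < m, and the bounds follow from f + n r > 0 and f \<le> m < n.\<close>

lemma A_displacement:
  assumes j: "1 \<le> j" "j \<le> m + m'" and X: "\<not> m \<le> (j * m) mod (m + m')"
  defines "d \<equiv> int n * int j - int (n + n') * int ((j * m) div (m + m')) - 1"
  shows "0 \<le> d" "d \<le> int n - 2"
proof -
  define f r where fr: "f = int ((j * m) div (m + m'))" "r = int ((j * m) mod (m + m'))"
  have m0: "m > 0" using X by auto
  have jm: "int j * int m = f * int (m + m') + r"
    unfolding fr by (metis div_mult_mod_eq of_nat_add of_nat_mult)
  have r: "0 \<le> r" "r \<le> int m - 1" using X unfolding fr by auto
  have f0: "0 \<le> f" by (simp add: fr)
  have "(j * m) div (m + m') \<le> ((m + m') * m) div (m + m')" using j by (intro div_le_mono mult_le_mono1)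
  then have fm: "f \<le> int m" unfolding fr using m0 by simp
  have det': "int n * int (m + m') = 1 + int (n + n') * int m" using det by (simp add: algebra_simps)
  have "int m * d = int n * (int j * int m) - (int (n + n') * int m) * f - int m"
    unfolding d_def fr by (simp add: algebra_simps)
  also have "\<dots> = f + int n * r - int m"
  proof -
    have "int n * (f * int (m + m') + r) = (int n * int (m + m')) * f + int n * r" by (simp add: algebra_simps)
    also have "\<dots> = (1 + int (n + n') * int m) * f + int n * r" unfolding det' ..
    finally show ?thesis unfolding jm by (simp add: algebra_simps)
  qed
  finally have md: "int m * d = f + int n * r - int m" .
  show "0 \<le> d"
  proof (rule ccontr)
    assume "\<not> 0 \<le> d"
    then have "int m * d \<le> int m * (-1)" by (intro mult_left_mono) auto
    then have le: "f + int n * r \<le> 0" using md by simp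
    have nr: "0 \<le> int n * r" using r by simp
    have "f = 0" "int n * r = 0" using le nr f0 by linarith+
    then have "r = 0" using n by simp
    then have "int j * int m = 0" using jm \<open>f = 0\<close> by simp
    then show False using j m0 by simp
  qed
  show "d \<le> int n - 2"
  proof (rule ccontr)
    assume "\<not> d \<le> int n - 2"
    then have "int m * (int n - 1) \<le> int m * d" by (intro mult_left_mono) auto
    then have 1: "int m * int n \<le> f + int n * r" unfolding md by (simp add: algebra_simps)
    have "int n * r \<le> int n * (int m - 1)" using r by (intro mult_left_mono) auto
    then have "int n \<le> f" using 1 by (simp add: algebra_simps)
    then show False using fm mn by simp
  qed
qed

lemma moves_Aop: "moves a b s S Aop (\<lambda>l. l(1 := l 1 + 1)) 1 0 1 1"
proof -
  let ?s = "m + m'"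
  \<comment> \<open>The displacement once the letters from J + 1 on have acted: a letter Y_1 adds n
    and X_1^-1 subtracts n'. The determinant condition makes it start at 0 for J = m + m' and end at
    1 for J = 0.\<close>
  define D where "D = (\<lambda>J. 1 - int n * int J + int (n + n') * int ((J * m) div ?s))"
  have s: "?s > 0" "m \<le> ?s" using m' by auto
  have Ds: "D ?s = 0"
  proof -
    have "(?s * m) div ?s = m" using s by simp
    then show ?thesis unfolding D_def using det by (simp add: algebra_simps)
  qed
  have "moves a b s S (foldr (slope_op m ?s) [J+1..<?s+1]) (\<lambda>l. l(1 := l 1 + D J)) 1 0 1 (D J)" if "J \<le> ?s" for J
    using that
  proof (induct J rule: inc_induct)
    case base
    have "foldr (slope_op m ?s) [?s+1..<?s+1] = (\<lambda>f. f)" by (simp add: fun_eq_iff)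
    then show ?case using moves_id[of a b s S 1 0] Ds by (simp del: upt_Suc)
  next
    case (step J)
    have e: "foldr (slope_op m ?s) [J+1..<?s+1] = (\<lambda>f. slope_op m ?s (Suc J) (foldr (slope_op m ?s) [Suc J+1..<?s+1] f))"
    proof -
      have l: "[J+1..<?s+1] = Suc J # [Suc J+1..<?s+1]" using step(2) by (simp add: upt_conv_Cons del: upt_Suc)
      show ?thesis unfolding l by (rule ext) (simp del: upt_Suc)
    qed
    note st = slope_step[OF s, of "Suc J"]
    show ?case
    proof (cases "m \<le> (Suc J * m) mod ?s")
      case True
      then have "(Suc J * m) div ?s = (J * m) div ?s" using st(1) by simp
      then have DJ: "D J = D (Suc J) + int n" unfolding D_def by (simp add: algebra_simps)
      have h: "(\<lambda>l. l(1 := l 1 + D J)) = (\<lambda>l. (l(1 := l 1 + D (Suc J)))(1 := (l(1 := l 1 + D (Suc J))) 1 + int n))"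
        unfolding DJ by (simp add: fun_eq_iff)
      have sl: "slope_op m ?s (Suc J) = Y 1" using True by (simp add: slope_op_def)
      show ?thesis unfolding e h sl
        by (rule moves_comp[OF step(3)]) (unfold DJ, rule moves_Y)
    next
      case False
      then have dv: "(Suc J * m) div ?s = Suc ((J * m) div ?s)" using st(4) by simp
      have DJ: "D J = D (Suc J) - int n'" unfolding D_def dv by (simp add: algebra_simps)
      have h: "(\<lambda>l. l(1 := l 1 + D J)) = (\<lambda>l. (l(1 := l 1 + D (Suc J)))(1 := (l(1 := l 1 + D (Suc J))) 1 - int n'))"
        unfolding DJ by (simp add: fun_eq_iff)
      have sl: "slope_op m ?s (Suc J) = XI" using False by (simp add: slope_op_def)
      define d where "d = - D (Suc J)"
      have "0 \<le> d" "d \<le> int n - 2"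
        using A_displacement[of "Suc J"] step(2) False unfolding d_def D_def by auto
      from moves_XI[OF this] have mX: "moves a b s S XI (\<lambda>l. l(1 := l 1 - int n')) 1 (D (Suc J)) 1 (D J)"
        unfolding DJ by (simp add: d_def)
      show ?thesis unfolding e h sl by (rule moves_comp[OF step(3) mX])
    qed
  qed
  from this[of 0] have "moves a b s S (foldr (slope_op m ?s) [0+1..<?s+1]) (\<lambda>l. l(1 := l 1 + D 0)) 1 0 1 (D 0)" by simp
  moreover have "D 0 = 1" by (simp add: D_def)
  moreover have "foldr (slope_op m ?s) [0+1..<?s+1] = Aop" by (rule ext) (simp only: Aop_def add_0)
  ultimately show ?thesis by simp
qed

lemma moves_Omega: "moves a b s S Omega (\<lambda>l. (rot N l)(1 := l N + 1)) N 0 1 1"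
proof -
  have "(\<lambda>l. (rot N l)(1 := rot N l 1 + 1)) = (\<lambda>l. (rot N l)(1 := l N + 1))" by (simp add: rot_def)
  moreover have "Omega = (\<lambda>f. Aop (Tup f))" by (simp add: fun_eq_iff Omega_def)
  ultimately show ?thesis using moves_comp[OF moves_Tup moves_Aop] by simp
qed

section \<open>Several rounds of Omega\<close>

definition top_count :: "int \<Rightarrow> (nat \<Rightarrow> int) \<Rightarrow> nat" where "top_count b l = card {i \<in> {1..N}. l i = b}"

definition tot :: "(nat \<Rightarrow> int) \<Rightarrow> int" where "tot l = (\<Sum>i\<in>{1..N}. l i)"

text \<open>The bound becomes \<open>Suc c\<close> because the last factor, about to move, counts
  already at b - 1.\<close>

lemma profile_config:
  assumes l: "l \<in> profile a a b s" and s: "s < N" and c: "top_count b l \<le> c" and S: "tot l = S"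
  shows "l \<in> config a b s S N 0 (Suc c)"
proof -
  have "card {i \<in> {1..N} - {N}. l i = b} \<le> top_count b l" unfolding top_count_def by (intro card_mono) auto
  then have P: "top_weight b N 0 l \<le> Suc c" using c unfolding top_weight_def by auto
  have lp: "if i \<le> s then a \<le> l i \<and> l i \<le> b else a \<le> l i \<and> l i \<le> b - 1" if "i \<in> {1..N}" for i
    using l that unfolding profile_def by blast
  have "a \<le> l N \<and> l N \<le> b - 1" using lp[of N] N s by (simp split: if_splits)
  moreover have "a \<le> l i \<and> l i \<le> ub b s N i" if "i \<in> {1..N} - {N}" for i
    using lp[of i] that by (auto simp: ub_def split: if_splits)
  ultimately show ?thesis using l P S unfolding config_def profile_def tot_def by auto
qed

lemma config_profile:
  assumes l: "l \<in> config a b s S 1 1 c"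
  shows "l \<in> profile a a b (s + 1)" "top_count b l \<le> c" "tot l = S + 1"
proof -
  have S1: "{i \<in> {1..N}. l i = b} = (if l 1 = b then insert 1 {i \<in> {1..N} - {1}. l i = b} else {i \<in> {1..N} - {1}. l i = b})"
    using N by auto
  have "top_count b l = card {i \<in> {1..N} - {1}. l i = b} + of_bool (l 1 = b)" unfolding top_count_def S1 by simp
  then have "top_count b l = top_weight b 1 1 l" unfolding top_weight_def by simp
  then show "top_count b l \<le> c" using l unfolding config_def by simp
  show "tot l = S + 1" using l unfolding config_def tot_def by simp
  have l1: "a \<le> l 1 - 1" "l 1 - 1 \<le> b - 1" and lo: "a \<le> l i \<and> l i \<le> ub b s 1 i" if "i \<in> {1..N} - {1}" for i
    using l that unfolding config_def by blast+
  have l1: "a \<le> l 1 - 1" "l 1 - 1 \<le> b - 1" using l unfolding config_def by blast+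
  have "if i \<le> s + 1 then a \<le> l i \<and> l i \<le> b else a \<le> l i \<and> l i \<le> b - 1" if "i \<in> {1..N}" for i
    using lo[of i] l1 that by (cases "i = 1") (auto simp: ub_def)
  then show "l \<in> profile a a b (s + 1)" using l unfolding config_def profile_def by blast
qed

text \<open>The leading index after s rounds: the last s entries, each raised by one, stand in
  front.\<close>

definition shifted :: "(nat \<Rightarrow> int) \<Rightarrow> nat \<Rightarrow> nat \<Rightarrow> int" where
  "shifted k s = (\<lambda>t. if 1 \<le> t \<and> t \<le> s then k (N - s + t) + 1 else if s < t \<and> t \<le> N then k (t - s) else k t)"

lemma shifted_Suc:
  assumes "s < N" shows "(rot N (shifted k s))(1 := shifted k s N + 1) = shifted k (Suc s)"
proof
  fix t
  consider "t = 0" | "t = 1" | "2 \<le> t" "t \<le> Suc s" | "Suc s < t" "t \<le> N" | "t > N" "t \<ge> 2" by linarith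
  then show "((rot N (shifted k s))(1 := shifted k s N + 1)) t = shifted k (Suc s) t"
    by cases (use assms in \<open>auto simp: rot_def shifted_def intro!: arg_cong[of _ _ k]\<close>)
qed

text \<open>A round adds at most one entry b, and if the moving factor stands at b - 1, the new
  correction terms have one fewer than that bound. So after s rounds the errors have fewer than s
  entries b. The total is recorded for \<open>Omega_pow_const_exp\<close>.\<close>

lemma Omega_pow_basis:
  assumes k: "k \<in> Box a (b - 1)" and i: "i \<le> N" and top: "\<And>t. N - i < t \<Longrightarrow> t \<le> N \<Longrightarrow> k t = b - 1"
    and s: "s \<le> i"
  shows "shifted k s \<in> profile a a b s \<and> top_count b (shifted k s) \<le> s \<and> tot (shifted k s) = tot k + int s \<and>
    (\<exists>g. g \<noteq> 0 \<and> (Omega ^^ s) (basis k) - scale g (basis (shifted k s)) \<in> bspan {l \<in> profile a a b s. top_count b l < s \<and> tot l = tot k + int s})"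
  using s
proof (induct s)
  case 0
  have e: "shifted k 0 = k" by (auto simp: shifted_def fun_eq_iff)
  have "k \<in> profile a a b 0" using k by (auto simp: Box_def profile_def)
  moreover have "top_count b k = 0" using k by (force simp: top_count_def Box_def)
  ultimately show ?case unfolding e by (auto intro!: exI[of _ 1])
next
  case (Suc s)
  let ?S = "tot k + int s"
  let ?R = "\<lambda>s. {l \<in> profile a a b s. top_count b l < s \<and> tot l = tot k + int s}"
  from Suc obtain g where IH: "shifted k s \<in> profile a a b s" "top_count b (shifted k s) \<le> s" "tot (shifted k s) = ?S"
    and g: "g \<noteq> 0" "(Omega ^^ s) (basis k) - scale g (basis (shifted k s)) \<in> bspan (?R s)" by auto
  have sN: "s < N" using Suc i by simp
  have linOm: "lin Omega" using moves_Omega unfolding moves_def by blast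
  have kG: "shifted k s \<in> config a b s ?S N 0 (Suc s)" by (rule profile_config[OF IH(1) sN IH(2,3)])
  \<comment> \<open>The factor to move next is number N - s of k, which has index b - 1 because s <
    i.\<close>
  have kN: "shifted k s N - 0 = b - 1" using top[of "N - s"] Suc.prems sN by (auto simp: shifted_def)
  obtain g' where g': "(rot N (shifted k s))(1 := shifted k s N + 1) \<in> config a b s ?S 1 1 (Suc s)" "g' \<noteq> 0"
    "Omega (basis (shifted k s)) - scale g' (basis ((rot N (shifted k s))(1 := shifted k s N + 1)))
       \<in> bspan (config a b s ?S 1 1 (Suc s - of_bool (shifted k s N - 0 = b - 1)))"
    using moves_Omega[of a b s ?S] kG unfolding moves_def by blast
  note g' = g'[unfolded shifted_Suc[OF sN] kN]
  have sub: "config a b s ?S 1 1 s \<subseteq> ?R (Suc s)"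
  proof
    fix l assume "l \<in> config a b s ?S 1 1 s"
    from config_profile[OF this] show "l \<in> ?R (Suc s)" by simp
  qed
  have "?R s \<subseteq> config a b s ?S N 0 s"
  proof
    fix l assume l: "l \<in> ?R s"
    \<comment> \<open>The old errors have at most s - 1 entries b, which leaves room for the moving
      factor in the weight bound s.\<close>
    then obtain c where "s = Suc c" by (cases s) auto
    then show "l \<in> config a b s ?S N 0 s" using profile_config[of l a b s c ?S] l sN by auto
  qed
  then have "(Omega ^^ s) (basis k) - scale g (basis (shifted k s)) \<in> bspan (config a b s ?S N 0 s)" using g(2) bspan_mono by blast
  from moves_bspan[OF moves_Omega this]
  have "Omega ((Omega ^^ s) (basis k) - scale g (basis (shifted k s))) \<in> bspan (config a b s ?S 1 1 s)" .
  moreover have "scale g (Omega (basis (shifted k s)) - scale g' (basis (shifted k (Suc s)))) \<in> bspan (config a b s ?S 1 1 s)"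
    using g'(3) by (intro bspan_scale) simp
  ultimately have "Omega ((Omega ^^ s) (basis k) - scale g (basis (shifted k s))) + scale g (Omega (basis (shifted k s)) - scale g' (basis (shifted k (Suc s))))
     \<in> bspan (config a b s ?S 1 1 s)" by (rule bspan_add)
  then have "(Omega ^^ Suc s) (basis k) - scale (g * g') (basis (shifted k (Suc s))) \<in> bspan (config a b s ?S 1 1 s)"
    by (simp add: lin_diff[OF linOm] lin_scale[OF linOm] scale_diff)
  then have "(Omega ^^ Suc s) (basis k) - scale (g * g') (basis (shifted k (Suc s))) \<in> bspan (?R (Suc s))"
    using bspan_mono[OF sub] by blast
  moreover have "shifted k (Suc s) \<in> profile a a b (Suc s) \<and> top_count b (shifted k (Suc s)) \<le> Suc s \<and> tot (shifted k (Suc s)) = tot k + int (Suc s)"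
    using config_profile[OF g'(1)] by auto
  moreover have "g * g' \<noteq> 0" using g(1) g'(2) by simp
  ultimately show ?case by blast
qed

end

section \<open>The isomorphism\<close>

context daha_sigma
begin

section \<open>Images of spans of monomials\<close>

abbreviation "E k \<equiv> ev (cl (Ym k))"

definition V :: "(nat \<Rightarrow> int) set \<Rightarrow> tensor set" where "V S = (\<lambda>p. ev (cl p)) ` mon_span S"

lemma V_I: "p \<in> mon_span S \<Longrightarrow> ev (cl p) = f \<Longrightarrow> f \<in> V S" unfolding V_def by blast

lemma V_E: assumes "f \<in> V S" obtains p where "p \<in> mon_span S" "ev (cl p) = f"
  using assms unfolding V_def by blast

lemma V_add: "f \<in> V S \<Longrightarrow> g \<in> V S \<Longrightarrow> f + g \<in> V S"
  by (elim V_E) (rule V_I[OF mon_span_add], assumption, assumption, simp add: ev_class_add mon_span_car)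

lemma V_scale: "f \<in> V S \<Longrightarrow> scale c f \<in> V S"
  by (elim V_E) (rule V_I[OF mon_span_scale], auto simp: ev_class_cp mon_span_car)

lemma V_diff: "f \<in> V S \<Longrightarrow> g \<in> V S \<Longrightarrow> f - g \<in> V S"
  using V_add[of f S "scale (-1) g"] V_scale[of g S "-1"] by (simp add: scale_minus_left)

lemma V_scale_iff: "c \<noteq> 0 \<Longrightarrow> scale c f \<in> V S \<Longrightarrow> f \<in> V S"
  using V_scale[of "scale c f" S "inverse c"] by simp

lemma V_mono: "S \<subseteq> S' \<Longrightarrow> V S \<subseteq> V S'"
  unfolding V_def using mon_span_mono by blast

lemma V_zero: "0 \<in> V S" using V_I[OF mon_span_L[OF L_zero] ev_L[OF L_zero]] .

lemma V_T: "i \<in> {1..<N} \<Longrightarrow> f \<in> V (Box a b) \<Longrightarrow> T i f \<in> V (Box a b)"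
  by (elim V_E) (rule V_I[OF mon_span_T], auto simp: ev_TG mon_span_car intro: T_support_Box[THEN subsetD])

lemma V_bspan: "(\<And>k. k \<in> S' \<Longrightarrow> basis k \<in> V S) \<Longrightarrow> f \<in> bspan S' \<Longrightarrow> f \<in> V S"
  by (rotate_tac, induct f rule: bspan_induct) (auto intro: V_zero V_add V_scale)

section \<open>Constant indices, the base of the induction\<close>

definition const_exp :: "int \<Rightarrow> nat \<Rightarrow> int" where "const_exp c = (\<lambda>i. if i \<in> {1..N} then c else 0)"

lemma Box_const_exp: "Box c c = {const_exp c}"
  by (force simp: Box_def const_exp_def fun_eq_iff)

lemma mon_span_single: "p \<in> mon_span {k} \<Longrightarrow> \<exists>x. ev (cl p) = scale x (E k)"
proof (induct p rule: mon_span.induct)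
  case (mon_span_L p) then show ?case by (intro exI[of _ 0]) (simp add: ev_L)
next
  case (mon_span_mon l) then show ?case by (intro exI[of _ 1]) simp
next
  case (mon_span_add p r) then show ?case by (metis ev_class_add mon_span_car scale_add_left)
next
  case (mon_span_scale p c) then show ?case by (metis ev_class_cp mon_span_car scale_scale)
qed

text \<open>Used to see that E k is nonzero: acting on it with sigma of the inverse gives
  w0.\<close>

lemma Ym_left_inverse: "\<exists>g\<in>Fc. g * Ym k \<approx> 1"
proof (induct "weight k" arbitrary: k rule: less_induct)
  case less
  show ?case
  proof (cases "\<exists>j\<in>{1..N}. k j \<noteq> 0")
    case False
    then have "Ym k = 1" by (intro Ym_zero) auto
    then show ?thesis by (intro bexI[of _ 1]) (auto intro: ceq_refl car_one)
  next
    case True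
    then obtain j where j: "j \<in> {1..N}" "k j \<noteq> 0" by blast
    define k' y where ky: "k' = k(j := if k j > 0 then k j - 1 else k j + 1)"
      "y = (if k j > 0 then gp (YInvG j) else gp (YG j))"
    have "weight k' < weight k" unfolding ky using j by (intro weight_dec) auto
    then obtain g where g: "g \<in> Fc" "g * Ym k' \<approx> 1" using less by blast
    have y: "y \<in> Fc" using j by (simp add: ky)
    have "y * Ym k \<approx> Ym k'" unfolding ky using Yi_Ym[OF j(1), of k] Y_Ym[OF j(1), of k] by simp
    then have "g * (y * Ym k) \<approx> g * Ym k'" by (rule ceq_multL[OF g(1)])
    also have "\<dots> \<approx> 1" by (rule g)
    finally show ?thesis using car_mult[OF g(1) y] by (auto simp: mult.assoc intro!: bexI[of _ "g * y"])
  qed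
qed

lemma w0_nz: "w0 \<noteq> 0"
proof
  assume "w0 = 0"
  then have "Poly_Mapping.lookup w0 (\<lambda>_. 0) = 0" by simp
  then show False by (simp add: w0_def)
qed

lemma E_nz: "E k \<noteq> 0"
proof
  assume E: "E k = 0"
  obtain g where g: "g \<in> Fc" "g * Ym k \<approx> 1" using Ym_left_inverse by blast
  have "ev (cl (g * Ym k)) = act (\<sigma> (cl g)) (E k)" using g by (simp add: ev_class_mult)
  then have "ev (cl (g * Ym k)) = 0" using E lin_zero[OF lin_act] by simp
  moreover have "cl (g * Ym k) = cl 1" using g by (simp add: ceq_def)
  ultimately show False using w0_nz by (simp add: class_one ev_one)
qed

lemma lin_Omega: "lin Omega" using moves_Omega unfolding moves_def by blast

text \<open>A_1 = sigma(Y_1) and T_1 ... T_{N-1} are invertible in H, so both act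
  injectively.\<close>

lemma Omega_inj: "Omega f = 0 \<Longrightarrow> f = 0"
proof -
  assume O: "Omega f = 0"
  have 1: "1 \<in> {1..N}" using N by simp
  have f1: "gp (YG 1) \<in> Fc" "gp (YInvG 1) \<in> Fc" by (rule Fc_gens(4)[OF 1], rule Fc_gens(5)[OF 1])
  have "cl (gp (YInvG 1)) \<otimes>\<^bsub>H\<^esub> dY N q v 1 = \<one>\<^bsub>H\<^esub>"
    using YYi(2)[OF 1] unfolding ceq_def dY_def class_mult[OF f1(2,1)] class_one by blast
  then have "\<sigma> (cl (gp (YInvG 1))) \<otimes>\<^bsub>H\<^esub> \<sigma> (dY N q v 1) = \<one>\<^bsub>H\<^esub>"
    using sig_mult[OF class_closed[OF f1(2)] dY_closed[OF 1]] sig_one by metis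
  then have "act (\<sigma> (cl (gp (YInvG 1)))) (Aop (Tup f)) = Tup f"
    using act_mult[OF sig_closed[OF class_closed[OF f1(2)]] sig_closed[OF dY_closed[OF 1]], of "Tup f"]
    by (simp only: act_sig_Y1 act_one)
  then have "Tup f = 0" using O lin_zero[OF lin_act] unfolding Omega_def by simp
  then show "f = 0" using act_inv_left[OF dU(1), of f] lin_zero[OF lin_act] by (simp add: dU(3))
qed

lemma Omega_pow_inj: "(Omega ^^ s) f = 0 \<Longrightarrow> f = 0"
  by (induct s) (auto dest: Omega_inj)

lemma lin_Omega_pow: "lin (Omega ^^ s)" by (rule lin_pow[OF lin_Omega])

text \<open>A correction term would have entries c or c + 1, total N (c + 1), and yet fewer than N
  entries c + 1. There is none.\<close>

lemma Omega_pow_const_exp: "\<exists>g. g \<noteq> 0 \<and> (Omega ^^ N) (basis (const_exp c)) = scale g (basis (const_exp (c + 1)))"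
proof -
  let ?R = "{l \<in> profile c c (c+1) N. top_count (c+1) l < N \<and> tot l = tot (const_exp c) + int N}"
  have sh: "shifted (const_exp c) N = const_exp (c + 1)" by (auto simp: shifted_def const_exp_def fun_eq_iff)
  have "const_exp c \<in> Box c ((c + 1) - 1)" by (simp add: Box_const_exp)
  moreover have "const_exp c t = (c + 1) - 1" if "N - N < t" "t \<le> N" for t using that by (auto simp: const_exp_def)
  ultimately obtain g where g: "g \<noteq> 0" "(Omega ^^ N) (basis (const_exp c)) - scale g (basis (shifted (const_exp c) N)) \<in> bspan ?R"
    using Omega_pow_basis[of "const_exp c" c "c + 1" N N] by blast
  have R: "?R = {}"
  proof -
    have False if l: "l \<in> profile c c (c+1) N" "top_count (c+1) l < N" "tot l = tot (const_exp c) + int N" for l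
    proof -
      have lc: "l i - c = of_bool (l i = c + 1)" if "i \<in> {1..N}" for i
      proof -
        have "c \<le> l i \<and> l i \<le> c + 1" using l(1) that unfolding profile_def by (auto split: if_splits)
        then show ?thesis by auto
      qed
      have "tot l - int N * c = (\<Sum>i\<in>{1..N}. l i - c)" unfolding tot_def by (simp add: sum_subtractf)
      also have "\<dots> = (\<Sum>i\<in>{1..N}. of_bool (l i = c + 1))" by (rule sum.cong[OF refl lc])
      also have "\<dots> = int (top_count (c+1) l)" unfolding top_count_def by (simp add: of_bool_def sum.If_cases Int_def)
      finally have "tot l = int N * c + int (top_count (c+1) l)" by simp
      moreover have "tot (const_exp c) = int N * c" unfolding tot_def const_exp_def by simp
      ultimately show False using l by simp
    qed
    then show ?thesis by blast
  qed
  then have "(Omega ^^ N) (basis (const_exp c)) = scale g (basis (const_exp (c + 1)))" using g(2) unfolding sh R by simp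
  then show ?thesis using g(1) by blast
qed

text \<open>With a' = b = c + 1 all exponents are squeezed to c + 1 after N rounds.\<close>

lemma omega_const_exp: "p \<in> mon_span (Box c c) \<Longrightarrow> (omega ^^ N) p \<in> mon_span (Box (c+1) (c+1))"
proof -
  assume p: "p \<in> mon_span (Box c c)"
  have "profile c (c+1) (c+1) N \<subseteq> Box (c+1) (c+1)" by (auto simp: profile_def Box_def)
  moreover have "(omega ^^ N) p \<in> mon_span (profile c (c+1) (c+1) N)"
    by (rule omega_pow_profile) (use p in auto)
  ultimately show ?thesis using mon_span_mono by blast
qed

text \<open>Upwards the claim is transported by N rounds. Downwards, N rounds send both E and the
  basis vector at c - 1 to multiples of the one vector E at c, so by injectivity of
  \<open>Omega\<close> they are proportional.\<close>

lemma basis_const_exp_V: "basis (const_exp c) \<in> V (Box c c)"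
proof (induct c rule: int_induct[of _ 0])
  case base
  have z: "const_exp 0 = (\<lambda>_. 0)" by (auto simp: const_exp_def)
  have "Ym (const_exp 0) = 1" unfolding z by (rule Ym_zero) simp
  then have "E (const_exp 0) = basis (const_exp 0)" unfolding z by (simp add: class_one ev_one w0_def)
  then show ?case by (intro V_I[OF mon_span_mon]) (auto simp: Box_const_exp)
next
  case (step1 c)
  obtain g where g: "g \<noteq> 0" "(Omega ^^ N) (basis (const_exp c)) = scale g (basis (const_exp (c + 1)))" using Omega_pow_const_exp by blast
  from step1(2) obtain p where p: "p \<in> mon_span (Box c c)" "ev (cl p) = basis (const_exp c)" by (rule V_E)
  have "ev (cl ((omega ^^ N) p)) = scale g (basis (const_exp (c + 1)))"
    using ev_omega_pow[OF mon_span_car[OF p(1)], of N] p g by simp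
  then have "scale g (basis (const_exp (c + 1))) \<in> V (Box (c+1) (c+1))" by (rule V_I[OF omega_const_exp[OF p(1)]])
  then show ?case using g(1) V_scale_iff by blast
next
  case (step2 c)
  define d where "d = c - 1"
  have c: "c = d + 1" by (simp add: d_def)
  obtain g where g: "g \<noteq> 0" "(Omega ^^ N) (basis (const_exp d)) = scale g (basis (const_exp c))" using Omega_pow_const_exp[of d] c by auto
  have Ed: "Ym (const_exp d) \<in> mon_span (Box d d)" by (rule mon_span_mon) (simp add: Box_const_exp)
  have "(omega ^^ N) (Ym (const_exp d)) \<in> mon_span {const_exp c}" using omega_const_exp[OF Ed] by (simp add: c[symmetric] Box_const_exp)
  then obtain x where x: "ev (cl ((omega ^^ N) (Ym (const_exp d)))) = scale x (E (const_exp c))" using mon_span_single by blast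
  then have 1: "(Omega ^^ N) (E (const_exp d)) = scale x (E (const_exp c))" using ev_omega_pow[OF Ym_car, of N "const_exp d"] by simp
  from step2(2) obtain p where p: "p \<in> mon_span {const_exp c}" "ev (cl p) = basis (const_exp c)" unfolding Box_const_exp by (rule V_E)
  then obtain y where y: "basis (const_exp c) = scale y (E (const_exp c))" using mon_span_single[OF p(1)] by auto
  have bnz: "basis k \<noteq> 0" for k by (metis keys_single keys_zero insert_not_empty zero_neq_one)
  have y0: "y \<noteq> 0" using y bnz[of "const_exp c"] by auto
  \<comment> \<open>Chosen so that N rounds give the same vector on z times the basis vector as on E
    at d.\<close>
  define z where "z = x / (y * g)"
  have "(Omega ^^ N) (scale z (basis (const_exp d))) = scale x (E (const_exp c))"
    using y0 g(1) unfolding lin_scale[OF lin_Omega_pow] g(2) y z_def by simp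
  then have "(Omega ^^ N) (E (const_exp d) - scale z (basis (const_exp d))) = 0" using 1 by (simp add: lin_diff[OF lin_Omega_pow])
  then have f: "E (const_exp d) = scale z (basis (const_exp d))" using Omega_pow_inj by fastforce
  then have "z \<noteq> 0" using E_nz[of "const_exp d"] by auto
  moreover have "scale z (basis (const_exp d)) \<in> V (Box d d)" by (rule V_I[OF Ed f])
  ultimately show ?case using V_scale_iff unfolding d_def by blast
qed

section \<open>Induction over boxes\<close>

lemma top_count_pair:
  assumes i: "i \<in> {1..<N}"
  shows "top_count b l = card {t \<in> {1..N} - {i,i+1}. l t = b} + of_bool (l i = b) + of_bool (l (i+1) = b)"
proof -
  have "{t \<in> {1..N}. l t = b} = (if l i = b then insert i {t \<in> {1..N} - {i}. l t = b} else {t \<in> {1..N} - {i}. l t = b})"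
    using i by auto
  then have "top_count b l = card {t \<in> {1..N} - {i}. l t = b} + of_bool (l i = b)" unfolding top_count_def by simp
  then show ?thesis unfolding card_pair[OF i] by simp
qed

text \<open>The second component of the induction measure in \<open>box_step\<close>: it drops when
  an entry b moves one place to the left.\<close>

definition pos_sum :: "int \<Rightarrow> (nat \<Rightarrow> int) \<Rightarrow> nat" where "pos_sum b l = (\<Sum>t\<in>{1..N}. if l t = b then t else 0)"

lemma pos_sum_swap_at:
  assumes i: "i \<in> {1..<N}" "l i \<noteq> b" "l (i+1) = b" shows "pos_sum b (swap_at i l) < pos_sum b l"
proof -
  have d: "{1..N} = insert i (insert (i+1) ({1..N} - {i,i+1}))" using i by auto
  have e: "pos_sum b k = (if k i = b then i else 0) + (if k (i+1) = b then i + 1 else 0) + (\<Sum>t\<in>{1..N} - {i,i+1}. if k t = b then t else 0)" for k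
    unfolding pos_sum_def by (subst d, subst sum.insert, simp, simp, subst sum.insert) auto
  have "(\<Sum>t\<in>{1..N} - {i,i+1}. if swap_at i l t = b then t else 0) = (\<Sum>t\<in>{1..N} - {i,i+1}. if l t = b then t else 0)"
    by (rule sum.cong) (auto simp: swap_at_def)
  then show ?thesis unfolding e using i by (auto simp: swap_at_def)
qed

text \<open>Induction on the number of entries b, then on the sum of their positions. If an entry b
  can move left, k is the leading index of T_j applied to the index where it has moved. Otherwise
  the entries b stand in front, and k is the leading index of i rounds of \<open>Omega\<close> on an
  index of the smaller box. In both cases the corrections have fewer entries b.\<close>

lemma box_step:
  assumes ab: "a < b" and IH: "\<And>k. k \<in> Box a (b - 1) \<Longrightarrow> basis k \<in> V (Box a (b - 1))"
    and k: "k \<in> Box a b"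
  shows "basis k \<in> V (Box a b)"
  using k
proof (induct "top_count b k" arbitrary: k rule: less_induct)
  case (less k0)
  have "basis k \<in> V (Box a b)" if "top_count b k = top_count b k0" "k \<in> Box a b" for k
    using that
  proof (induct "pos_sum b k" arbitrary: k rule: less_induct)
    case inner: (less k)
    have lower: "basis l \<in> V (Box a b)" if "top_count b l < top_count b k" "l \<in> Box a b" for l
      using less(1) that inner.prems by simp
    show ?case
    proof (cases "\<exists>j\<in>{1..<N}. k j \<noteq> b \<and> k (j+1) = b")
      case True
      then obtain j where j: "j \<in> {1..<N}" "k j \<noteq> b" "k (j+1) = b" by blast
      have jj: "j \<in> {1..N}" "j + 1 \<in> {1..N}" using j by auto
      let ?k = "swap_at j k"
      have kb: "a \<le> k j" "k j < b" using inner.prems j(2) jj unfolding Box_def by force+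
      have kk: "?k j = b" "?k (j+1) = k j" using j by (auto simp: swap_at_def)
      have off: "?k t = k t" if "t \<noteq> j" "t \<noteq> j + 1" for t using that by (simp add: swap_at_def)
      have kB: "?k \<in> Box a b" using inner.prems jj unfolding Box_def by (auto simp: swap_at_def)
      have "{t \<in> {1..N} - {j,j+1}. ?k t = b} = {t \<in> {1..N} - {j,j+1}. k t = b}" using off by auto
      then have Nk: "top_count b ?k = top_count b k" unfolding top_count_pair[OF j(1)] kk using j by simp
      have "basis ?k \<in> V (Box a b)"
        by (rule inner.hyps) (use pos_sum_swap_at[OF j] Nk kB inner.prems in auto)
      then have TV: "T j (basis ?k) \<in> V (Box a b)" by (rule V_T[OF j(1)])
      obtain g r where g: "g \<noteq> 0" and r: "r \<in> bspan (T_inner n j ?k)"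
        and T: "T j (basis ?k) = scale g (basis (swap_at j ?k)) + (if ?k j < ?k (j+1) then scale cc (basis ?k) else 0) + r"
        using T_formula[OF n v, of ?k j] by blast
      have "r \<in> V (Box a b)"
      proof (rule V_bspan[OF _ r])
        fix l assume "l \<in> T_inner n j ?k"
        then obtain t where l: "l = ?k(j := ?k j + int n * t, j+1 := ?k (j+1) - int n * t)"
          and "(t \<ge> 1 \<and> ?k j + int n * t < ?k (j+1)) \<or> (t \<le> -1 \<and> ?k j + int n * t > ?k (j+1))"
          unfolding T_inner_def by blast
        \<comment> \<open>The larger entry b stands first, so only the second alternative remains.
          Both new entries lie strictly between k j and b, and an entry b is lost.\<close>
        then have t: "t \<le> -1" "b + int n * t > k j" using kk kb nat_mult_ge[of t] by auto
        have nt: "int n * t \<le> -1" using nat_mult_le[OF t(1)] n by simp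
        have lj: "l j = b + int n * t" "l (j+1) = k j - int n * t" unfolding l kk by auto
        have loff: "l s = k s" if "s \<noteq> j" "s \<noteq> j + 1" for s unfolding l using that off by simp
        have "{s \<in> {1..N} - {j,j+1}. l s = b} = {s \<in> {1..N} - {j,j+1}. k s = b}" using loff by auto
        moreover have "l j \<noteq> b" "l (j+1) \<noteq> b" unfolding lj using nt t by linarith+
        ultimately have "top_count b l < top_count b k" unfolding top_count_pair[OF j(1)] using j by simp
        moreover have "l \<in> Box a b"
        proof -
          have "a \<le> l s \<and> l s \<le> b" if s: "s \<in> {1..N}" for s
          proof -
            consider "s = j" | "s = j + 1" | "s \<noteq> j" "s \<noteq> j + 1" by blast
            then show ?thesis
            proof cases
              case 1 show ?thesis unfolding 1 lj using nt t kb by linarith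
            next
              case 2 show ?thesis unfolding 2 lj using nt t kb by linarith
            next
              case 3 then show ?thesis using loff[OF 3] inner.prems s unfolding Box_def by auto
            qed
          qed
          moreover have "l s = 0" if "s \<notin> {1..N}" for s
          proof -
            have "s \<noteq> j" "s \<noteq> j + 1" using that jj by auto
            then show ?thesis using loff[of s] inner.prems that unfolding Box_def by auto
          qed
          ultimately show ?thesis unfolding Box_def by blast
        qed
        ultimately show "basis l \<in> V (Box a b)" by (rule lower)
      qed
      then have "T j (basis ?k) - r \<in> V (Box a b)" using TV by (intro V_diff)
      moreover have "swap_at j ?k = k" by (auto simp: swap_at_def fun_eq_iff)
      then have "T j (basis ?k) - r = scale g (basis k)" unfolding T using kk kb by simp
      ultimately show ?thesis using g V_scale_iff by metis
    next
      case False
      define A where "A = {t \<in> {1..N}. k t = b}"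
      \<comment> \<open>As no b directly follows a smaller entry, the positions of b form an initial
        segment.\<close>
      have dc: "s \<in> A" if "t \<in> A" "s \<le> t" "1 \<le> s" for s t
        using that(2,1,3)
      proof (induct s rule: inc_induct)
        case (step s)
        then have "Suc s \<in> A" by simp
        then have "k (s+1) = b" "s \<in> {1..<N}" using step unfolding A_def by auto
        then have "k s = b" using False by blast
        then show ?case using \<open>s \<in> {1..<N}\<close> unfolding A_def by auto
      qed
      show ?thesis
      proof (cases "A = {}")
        case True
        have "k \<in> Box a (b - 1)"
        proof -
          have "a \<le> k i \<and> k i \<le> b - 1" if "i \<in> {1..N}" for i
          proof -
            have "k i \<noteq> b" using True that unfolding A_def by blast
            moreover have "a \<le> k i" "k i \<le> b" using inner.prems that unfolding Box_def by auto
            ultimately show ?thesis by simp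
          qed
          then show ?thesis using inner.prems unfolding Box_def by auto
        qed
        then show ?thesis using IH V_mono[OF Box_mono[of a a "b - 1" b]] by auto
      next
        case ne: False
        define i where "i = Max A"
        have finA: "finite A" unfolding A_def by simp
        have iA: "i \<in> A" unfolding i_def using finA ne by (rule Max_in)
        have A: "A = {1..i}"
        proof
          show "A \<subseteq> {1..i}" using finA unfolding i_def by (auto simp: A_def)
          show "{1..i} \<subseteq> A" using dc[OF iA] by auto
        qed
        have i: "1 \<le> i" "i \<le> N" using iA unfolding A_def by auto
        have NbA: "top_count b k = i" using A unfolding top_count_def A_def by simp
        \<comment> \<open>Undoes i rounds: the front block of entries b is removed, the rest moves
          forward, and the end is filled with b - 1.\<close>
        define k1 where "k1 = (\<lambda>t. if 1 \<le> t \<and> t \<le> N - i then k (t + i) else if N - i < t \<and> t \<le> N then b - 1 else k t)"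
        have sh: "shifted k1 i = k"
        proof
          fix t
          consider "1 \<le> t" "t \<le> i" | "i < t" "t \<le> N" | "t = 0" | "N < t" by linarith
          then show "shifted k1 i t = k t"
          proof cases
            case 1
            then have "t \<in> A" unfolding A by simp
            then have "k t = b" unfolding A_def by simp
            then show ?thesis using 1 i by (auto simp: shifted_def k1_def)
          qed (use i in \<open>auto simp: shifted_def k1_def\<close>)
        qed
        have k1B: "k1 \<in> Box a (b - 1)"
        proof -
          have "a \<le> k1 t \<and> k1 t \<le> b - 1" if t: "t \<in> {1..N}" for t
          proof (cases "t \<le> N - i")
            case True
            then have ti: "t + i \<in> {1..N}" "t + i \<notin> A" using t i unfolding A by auto
            then have "k (t + i) \<noteq> b" unfolding A_def by blast
            moreover have "a \<le> k (t + i)" "k (t + i) \<le> b" using inner.prems ti unfolding Box_def by auto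
            ultimately show ?thesis using True t by (simp add: k1_def)
          next
            case False then show ?thesis using t ab by (simp add: k1_def)
          qed
          moreover have "k1 t = 0" if "t \<notin> {1..N}" for t
            using that inner.prems unfolding Box_def k1_def by auto
          ultimately show ?thesis unfolding Box_def by blast
        qed
        have top: "k1 t = b - 1" if "N - i < t" "t \<le> N" for t using that by (simp add: k1_def)
        obtain g where g: "g \<noteq> 0" and r: "(Omega ^^ i) (basis k1) - scale g (basis k)
            \<in> bspan {l \<in> profile a a b i. top_count b l < i \<and> tot l = tot k1 + int i}"
          using Omega_pow_basis[OF k1B i(2) top order_refl] unfolding sh by blast
        have PB: "profile a a b i \<subseteq> Box a b"
        proof
          fix l assume l: "l \<in> profile a a b i"
          have "a \<le> l t \<and> l t \<le> b" if "t \<in> {1..N}" for t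
            using l that unfolding profile_def by (auto split: if_splits)
          then show "l \<in> Box a b" using l unfolding profile_def Box_def by blast
        qed
        have rV: "(Omega ^^ i) (basis k1) - scale g (basis k) \<in> V (Box a b)"
          by (rule V_bspan[OF _ r]) (use lower NbA PB in blast)
        from IH[OF k1B] obtain p where p: "p \<in> mon_span (Box a (b - 1))" "ev (cl p) = basis k1" by (rule V_E)
        have "(omega ^^ i) p \<in> mon_span (profile a a b i)" by (rule omega_pow_profile) (use p i in auto)
        then have "(omega ^^ i) p \<in> mon_span (Box a b)" using mon_span_mono PB by blast
        then have "(Omega ^^ i) (basis k1) \<in> V (Box a b)"
          by (rule V_I) (use ev_omega_pow[OF mon_span_car[OF p(1)]] p in simp)
        from V_diff[OF this rV] have "scale g (basis k) \<in> V (Box a b)" by simp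
        then show ?thesis using g V_scale_iff by blast
      qed
    qed
  qed
  then show ?case using less(2) by blast
qed

lemma basis_V:
  assumes "a \<le> b" shows "\<forall>k\<in>Box a b. basis k \<in> V (Box a b)"
  using assms
proof (induct b rule: int_ge_induct)
  case base then show ?case using basis_const_exp_V by (simp add: Box_const_exp)
next
  case (step b)
  show ?case
  proof
    fix k assume "k \<in> Box a (b + 1)"
    then show "basis k \<in> V (Box a (b + 1))" using step by (intro box_step[of a "b + 1"]) auto
  qed
qed

section \<open>Independence, and bijectivity of the evaluation\<close>

sublocale tv: vector_space scale
  by standard (simp_all add: scale_add scale_add_left)

lemma ev_sum: "finite S \<Longrightarrow> ev (cl (\<Sum>k\<in>S. cp (c k) * Ym k)) = (\<Sum>k\<in>S. scale (c k) (E k)) \<and> (\<Sum>k\<in>S. cp (c k) * Ym k) \<in> Fc"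
proof (induct S rule: finite_induct)
  case empty then show ?case by (simp add: car_zero ev_L[OF L_zero])
next
  case (insert x S)
  have "cp (c x) * Ym x \<in> Fc" by (intro car_mult) auto
  then show ?case using insert by (simp add: ev_class_add ev_class_cp car_add)
qed

lemma V_span: "V S \<subseteq> tv.span (E ` S)"
proof -
  have "ev (cl p) \<in> tv.span (E ` S)" if "p \<in> mon_span S" for p
    using that
  proof (induct p rule: mon_span.induct)
    case (mon_span_L p) then show ?case using ev_L tv.span_zero by simp
  next
    case (mon_span_mon k) then show ?case by (intro tv.span_base) simp
  next
    case (mon_span_add p r) then show ?case by (simp add: ev_class_add mon_span_car tv.span_add)
  next
    case (mon_span_scale p c) then show ?case by (simp add: ev_class_cp mon_span_car tv.span_scale)
  qed
  then show ?thesis unfolding V_def by blast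
qed

text \<open>On a box, the vectors \<open>E k\<close> span as many independent vectors as there are indices.\<close>

lemma E_independent:
  assumes ab: "a \<le> b" and z: "(\<Sum>k\<in>Box a b. scale (c k) (E k)) = 0" and k: "k \<in> Box a b"
  shows "c k = 0"
proof (rule ccontr)
  assume ck: "c k \<noteq> 0"
  let ?B = "Box a b" let ?S = "E ` (?B - {k})"
  have fin: "finite ?B" by (rule finite_Box)
  have "scale (c k) (E k) = - (\<Sum>l\<in>?B - {k}. scale (c l) (E l))"
    using z fin k by (simp add: sum.remove[of _ k] eq_neg_iff_add_eq_0)
  also have "\<dots> \<in> tv.span ?S"
    by (intro tv.span_neg tv.span_sum tv.span_scale tv.span_base) auto
  finally have "scale (inverse (c k)) (scale (c k) (E k)) \<in> tv.span ?S" by (rule tv.span_scale)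
  then have "E k \<in> tv.span ?S" using ck by simp
  then have "E ` ?B \<subseteq> tv.span ?S" using tv.span_base[of _ ?S] by (auto intro: tv.span_base)
  then have "tv.span (E ` ?B) \<subseteq> tv.span ?S" by (rule tv.span_minimal) (rule tv.subspace_span)
  then have sub: "basis ` ?B \<subseteq> tv.span ?S" using basis_V[OF ab] V_span by blast
  have inj: "inj_on basis ?B" by (rule inj_onI) (rule basis_inj)
  have "tv.independent (basis ` ?B)"
  proof (rule tv.independent_if_scalars_zero)
    show "finite (basis ` ?B)" using fin by simp
    fix f x assume s: "(\<Sum>x\<in>basis ` ?B. scale (f x) x) = 0" and x: "x \<in> basis ` ?B"
    then obtain l where l: "l \<in> ?B" "x = basis l" by blast
    have "(\<Sum>x\<in>basis ` ?B. scale (f x) x) = (\<Sum>k\<in>?B. scale (f (basis k)) (basis k))"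
      by (subst sum.reindex[OF inj]) simp
    then have "0 = Poly_Mapping.lookup (\<Sum>k\<in>?B. scale (f (basis k)) (basis k)) l" using s by simp
    also have "\<dots> = (\<Sum>k\<in>?B. if k = l then f (basis l) else 0)"
      unfolding lookup_sum by (rule sum.cong) (auto simp: lookup_single when_def)
    also have "\<dots> = f x" using l fin by simp
    finally show "f x = 0" by simp
  qed
  then have "card (basis ` ?B) \<le> card ?S" using tv.independent_span_bound[OF _ _ sub] fin by simp
  also have "\<dots> \<le> card (?B - {k})" using fin by (intro card_image_le) simp
  also have "\<dots> < card ?B" using fin k by (intro psubset_card_mono) auto
  finally show False using card_image[OF inj] by simp
qed

text \<open>Modulo \<open>K\<close>, h is a combination of monomials over a box. \<open>ev\<close>
  vanishes on \<open>K\<close>, so \<open>E_independent\<close> forces all coefficients to be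
  0.\<close>

lemma ker_K: "h \<in> carrier H \<Longrightarrow> ev h = 0 \<Longrightarrow> h \<in> K"
proof -
  assume h: "h \<in> carrier H" "ev h = 0"
  then obtain p where p: "p \<in> Fc" "h = cl p" by (elim clE)
  obtain b where b: "0 \<le> b" "p \<in> mon_span (Box (- b) b)" using Fc_U[OF p(1)] by (rule U_E)
  obtain c where c: "p - (\<Sum>k\<in>Box (- b) b. cp (c k) * Ym k) \<in> L" using mon_span_coeffs[OF finite_Box b(2)] by blast
  define s' where "s' = (\<Sum>k\<in>Box (- b) b. cp (c k) * Ym k)"
  note s = ev_sum[OF finite_Box, of c "-b" b, folded s'_def] and c = c[folded s'_def]
  have "ev (cl p) = ev (cl (p - s')) + ev (cl s')"
    using ev_class_add[OF L_car[OF c] conjunct2[OF s]] by simp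
  also have "\<dots> = ev (cl s')" using ev_L[OF c] by simp
  finally have "(\<Sum>k\<in>Box (- b) b. scale (c k) (E k)) = 0" using h p s by simp
  then have "c k = 0" if "k \<in> Box (- b) b" for k using E_independent[OF _ _ that] b(1) by simp
  then have "s' = 0" unfolding s'_def by (simp add: sum.neutral)
  then have "p \<in> L" using c by simp
  then show "h \<in> K" using p by (simp add: L_def)
qed

lemma ev_surj: "f \<in> tensor_space N \<Longrightarrow> \<exists>h\<in>carrier H. ev h = f"
  unfolding tensor_space_eq
proof (induct f rule: bspan_induct)
  case zero
  interpret ring H by (rule ring_daha)
  show ?case using ev_zero by (intro bexI[of _ "\<zero>\<^bsub>H\<^esub>"]) auto
next
  case (basis k)
  have "k \<in> Box (- int (weight k)) (int (weight k))"
  proof -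
    have "\<bar>k i\<bar> \<le> int (weight k)" if "i \<in> {1..N}" for i
    proof -
      have "nat \<bar>k i\<bar> \<le> weight k" unfolding weight_def using that by (intro member_le_sum) auto
      then show ?thesis by linarith
    qed
    then show ?thesis using basis unfolding Box_def abs_le_iff by force
  qed
  then have "basis k \<in> V (Box (- int (weight k)) (int (weight k)))" using basis_V by simp
  then obtain p where "p \<in> mon_span (Box (- int (weight k)) (int (weight k)))" "ev (cl p) = basis k" by (rule V_E)
  then show ?case using class_closed[OF mon_span_car] by blast
next
  case (add f g)
  interpret ring H by (rule ring_daha)
  show ?case using add ev_add by (metis a_closed)
next
  case (scale c f)
  interpret ring H by (rule ring_daha)
  show ?case using scale ev_scal[of _ c] scal_closed by (metis m_closed)
qed

text \<open>The inverse of the map induced by \<open>ev\<close>. The fibre over x is a coset of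
  \<open>K\<close>, hence literally an element of the module as \<open>induced_module\<close>
  encodes it.\<close>

definition Theta :: "tensor \<Rightarrow> daha_elt set" where "Theta x = {h \<in> carrier H. ev h = x}"

lemma coset_iff: "h \<in> carrier H \<Longrightarrow> g \<in> carrier H \<Longrightarrow> ev g = ev h \<longleftrightarrow> g \<ominus>\<^bsub>H\<^esub> h \<in> K"
proof
  interpret ring H by (rule ring_daha)
  assume h: "h \<in> carrier H" "g \<in> carrier H"
  show "ev g = ev h \<Longrightarrow> g \<ominus>\<^bsub>H\<^esub> h \<in> K" using h ev_diff by (intro ker_K) auto
  show "g \<ominus>\<^bsub>H\<^esub> h \<in> K \<Longrightarrow> ev g = ev h" using K_ker h ev_diff[of g h] by simp
qed

lemma minus_plus: "h \<in> carrier H \<Longrightarrow> g \<in> carrier H \<Longrightarrow> g = (g \<ominus>\<^bsub>H\<^esub> h) \<oplus>\<^bsub>H\<^esub> h"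
proof -
  interpret ring H by (rule ring_daha)
  assume "h \<in> carrier H" "g \<in> carrier H"
  then show ?thesis by (simp add: a_minus_def a_assoc l_neg)
qed

lemma Theta_coset: "h \<in> carrier H \<Longrightarrow> Theta (ev h) = K +>\<^bsub>H\<^esub> h"
proof -
  interpret ring H by (rule ring_daha)
  assume h: "h \<in> carrier H"
  show ?thesis
  proof (intro equalityI subsetI)
    fix g assume "g \<in> Theta (ev h)"
    then have g: "g \<in> carrier H" "g \<ominus>\<^bsub>H\<^esub> h \<in> K" using coset_iff[OF h] by (auto simp: Theta_def)
    then show "g \<in> K +>\<^bsub>H\<^esub> h" unfolding a_r_coset_def' using minus_plus[OF h g(1)] by blast
  next
    fix g assume "g \<in> K +>\<^bsub>H\<^esub> h"
    then obtain k where "k \<in> K" "g = k \<oplus>\<^bsub>H\<^esub> h" unfolding a_r_coset_def' by blast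
    then show "g \<in> Theta (ev h)" using h K_simps(1) K_ker by (simp add: Theta_def ev_add)
  qed
qed

lemma Theta_iso:
  "isomorphic_modules H tensor_module (twisted_module H \<sigma> (cherednik_module N q v u_char))"
proof -
  interpret ring H by (rule ring_daha)
  let ?C = "cherednik_module N q v u_char"
  have C: "carrier ?C = a_rcosets\<^bsub>H\<^esub> K" "add ?C = set_add H" "smult ?C = (\<lambda>h C. K <+>\<^bsub>H\<^esub> (h <#\<^bsub>H\<^esub> C))"
    unfolding cherednik_module_def induced_module_def Let_def \<psi>_def[symmetric] Kgen_def[symmetric] K_def[symmetric]
    by simp_all
  show ?thesis unfolding isomorphic_modules_def
  proof (intro exI[of _ Theta] conjI ballI)
    show "bij_betw Theta (carrier tensor_module) (carrier (twisted_module H \<sigma> ?C))"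
      unfolding bij_betw_def
    proof
      show "inj_on Theta (carrier tensor_module)"
      proof (rule inj_onI)
        fix x y assume xy: "x \<in> carrier tensor_module" "y \<in> carrier tensor_module" "Theta x = Theta y"
        then obtain h where "h \<in> carrier H" "ev h = x" using ev_surj by auto
        then have "h \<in> Theta x" by (simp add: Theta_def)
        then show "x = y" unfolding xy(3) using \<open>ev h = x\<close> by (simp add: Theta_def)
      qed
      have "carrier tensor_module = ev ` carrier H" using ev_surj ev_tensor_space by (auto simp: image_iff)
      then show "Theta ` carrier tensor_module = carrier (twisted_module H \<sigma> ?C)"
        unfolding twisted_module_def by (simp add: C A_RCOSETS_def' image_image Theta_coset UNION_singleton_eq_range cong: image_cong_simp)
    qed
    fix x assume x: "x \<in> carrier tensor_module"
    obtain h where h: "h \<in> carrier H" "ev h = x" using x ev_surj by auto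
    { fix y assume y: "y \<in> carrier tensor_module"
      obtain g where g: "g \<in> carrier H" "ev g = y" using y ev_surj by auto
      have "Theta (x + y) = Theta x <+>\<^bsub>H\<^esub> Theta y"
      proof (intro equalityI subsetI)
        fix a assume "a \<in> Theta (x + y)"
        then have a: "a \<in> carrier H" "ev a = x + y" by (auto simp: Theta_def)
        have "a \<ominus>\<^bsub>H\<^esub> g \<in> Theta x" using a g by (simp add: Theta_def ev_diff)
        moreover have "g \<in> Theta y" using g by (simp add: Theta_def)
        ultimately show "a \<in> Theta x <+>\<^bsub>H\<^esub> Theta y" unfolding set_add_def' using minus_plus[OF g(1) a(1)] by blast
      next
        fix a assume "a \<in> Theta x <+>\<^bsub>H\<^esub> Theta y"
        then obtain b c where "b \<in> Theta x" "c \<in> Theta y" "a = b \<oplus>\<^bsub>H\<^esub> c" unfolding set_add_def' by blast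
        then show "a \<in> Theta (x + y)" by (auto simp: Theta_def ev_add)
      qed
      then show "Theta (x \<oplus>\<^bsub>tensor_module\<^esub> y) = Theta x \<oplus>\<^bsub>twisted_module H \<sigma> ?C\<^esub> Theta y"
        unfolding twisted_module_def by (simp add: C) }
  next
    fix a x assume a: "a \<in> carrier H" and x: "x \<in> carrier tensor_module"
    obtain h where h: "h \<in> carrier H" "ev h = x" using x ev_surj by auto
    \<comment> \<open>The twisted module lets a act as multiplication by a', and \<open>ev\<close>
      turns that into the action of sigma(a') = a.\<close>
    define a' where "a' = inv_into (carrier H) \<sigma> a"
    have "a \<in> \<sigma> ` carrier H" using a sig_props(2) unfolding bij_betw_def by simp
    then have a': "a' \<in> carrier H" "\<sigma> a' = a" unfolding a'_def by (simp_all only: inv_into_into f_inv_into_f)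
    have e: "ev (a' \<otimes>\<^bsub>H\<^esub> g) = act a (ev g)" if "g \<in> carrier H" for g using ev_mult[OF a'(1) that] a' by simp
    have "Theta (act a x) = K <+>\<^bsub>H\<^esub> (a' <#\<^bsub>H\<^esub> Theta x)"
    proof (intro equalityI subsetI)
      fix g assume "g \<in> Theta (act a x)"
      then have g: "g \<in> carrier H" "ev g = act a x" by (auto simp: Theta_def)
      have c: "a' \<otimes>\<^bsub>H\<^esub> h \<in> carrier H" using a' h by simp
      have "g \<ominus>\<^bsub>H\<^esub> (a' \<otimes>\<^bsub>H\<^esub> h) \<in> K" using coset_iff[OF c g(1)] g h e by simp
      moreover have "a' \<otimes>\<^bsub>H\<^esub> h \<in> a' <#\<^bsub>H\<^esub> Theta x" using h unfolding l_coset_def Theta_def by blast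
      ultimately show "g \<in> K <+>\<^bsub>H\<^esub> (a' <#\<^bsub>H\<^esub> Theta x)" unfolding set_add_def' using minus_plus[OF c g(1)] by blast
    next
      fix g assume "g \<in> K <+>\<^bsub>H\<^esub> (a' <#\<^bsub>H\<^esub> Theta x)"
      then obtain k b where k: "k \<in> K" "b \<in> Theta x" "g = k \<oplus>\<^bsub>H\<^esub> (a' \<otimes>\<^bsub>H\<^esub> b)"
        unfolding set_add_def' l_coset_def by blast
      then have b: "b \<in> carrier H" "ev b = x" by (auto simp: Theta_def)
      then show "g \<in> Theta (act a x)" using k a' K_simps(1)[OF k(1)] K_ker[OF k(1)] e
        by (simp add: Theta_def ev_add)
    qed
    then show "Theta (a \<odot>\<^bsub>tensor_module\<^esub> x) = a \<odot>\<^bsub>twisted_module H \<sigma> ?C\<^esub> Theta x"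
      unfolding twisted_module_def by (simp add: C a'_def)
  qed
qed

end

theorem theorem3p4:
  fixes n n' N m m' :: nat and q v :: complex and u :: "nat \<Rightarrow> complex"
    and \<sigma> :: "daha_elt \<Rightarrow> daha_elt"
  assumes "n \<ge> 1" and "n' \<ge> 1" and "coprime n n'" and "N \<ge> 1"
    and "q \<noteq> 0" and "v \<noteq> 0" and "\<forall>a<n. u a \<noteq> 0"
    and "int n * int m' - int n' * int m = 1" and "m < n"
    and "is_sigma N q v n n' m m' \<sigma>"
  shows "\<exists>M. is_C_module N n n' q v u M \<and>
    isomorphic_modules (daha N q v) M
      (twisted_module (daha N q v) \<sigma>
        (cherednik_module N q v ((\<Prod>a<n. u a) * q powi (1 - int n))))"
proof -
  interpret daha_sigma n n' N q v u m m' \<sigma>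
    by unfold_locales (use assms in auto)
  show ?thesis using is_C_module_tensor_module Theta_iso unfolding u_char_def by blast
qed

end
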